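(* Let $\Phi$ be any set of MDPs (a structure) on the finite state space $\mathcal{S}$ and finite action space $\mathcal{A}$, and let $\phi\in\Phi$ be ergodic. For any uniformly good algorithm $\pi\in\Pi$ and any initial state $x\in\mathcal{S}$, the regret under $\phi$ satisfies $$\liminf_{T\to\infty}\frac{R_T^\pi(x)}{\log T}\ \ge\ K_\Phi(\phi),$$ where $$K_\Phi(\phi)=\inf_{\eta\in\mathcal{F}_\Phi(\phi)}\ \sum_{(x,a)\in\mathcal{S}\times\mathcal{A}}\eta(x,a)\,\delta^*(x,a;\phi),$$ $$\mathcal{F}_\Phi(\phi)=\Big\{\eta\in\bar{\mathbb{R}}_+^{S\times A}:\ \sum_{(x,a)\in\mathcal{S}\times\mathcal{A}}\eta(x,a)\,\mathrm{KL}_{\phi\mid\psi}(x,a)\ge 1\ \ \forall\psi\in\Delta_\Phi(\phi)\Big\}.$$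
   Context: MDPs. $\mathcal{S}$ and $\mathcal{A}$ are finite sets of sizes $S$ and $A$. An MDP $\phi=(p_\phi,q_\phi)$ consists of transition probabilities $p_\phi(y|x,a)$ and reward distributions $q_\phi(\cdot|x,a)$ on $[0,1]$, with mean $r_\phi(x,a)$, each absolutely continuous w.r.t. a fixed measure $\lambda$ on $[0,1]$ (density also denoted $q_\phi$). In state $x$ with action $a$, the next state is drawn from $p_\phi(\cdot|x,a)$ and the reward from $q_\phi(\cdot|x,a)$. $X_t,A_t,R_t$ denote the state, action and reward at step $t$. Policies and regret. $\Pi$ is the set of policies (algorithms) whose action at step $t$ is a measurable function of the history $(X_1,A_1,R_1,\dots,X_{t-1},A_{t-1},R_{t-1},X_t)$. $V_T^\pi(x)=\mathbb{E}^\pi_x[\sum_{t=1}^T R_t]$ (with $X_1=x$), $V_T^*(x)=\sup_{\pi\in\Pi}V_T^\pi(x)$, and the regret is $R_T^\pi(x)=V_T^*(x)-V_T^\pi(x)$; all of these depend on the underlying MDP. An algorithm $\pi\in\Pi$ is uniformly good (for $\Phi$) if for every ergodic $\phi\in\Phi$, every initial state $x$ and every $\alpha>0$, $R_T^\pi(x)=o(T^\alpha)$ under $\phi$. Gain, bias, gaps. $\Pi_D$ is the set of stationary deterministic policies $f:\mathcal{S}\to\mathcal{A}$. $\phi$ is ergodic if under every $f\in\Pi_D$ the Markov chain $(X_t)$ is irreducible. The gain is $g_\phi^f(x)=\lim_{T\to\infty}\frac1T V_T^f(x)$, and $g_\phi^*(x)=\max_{\pi\in\Pi} g_\phi^\pi(x)$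 (a constant $g^*_\phi$ for ergodic $\phi$); $\Pi^*(\phi)=\{f\in\Pi_D: g_\phi^f(x)=g_\phi^*(x)\ \forall x\}$. The bias of $f$ is $h_\phi^f(x)=\text{C-}\lim_{T\to\infty}\mathbb{E}_x^f[\sum_{t=1}^{T}(R_t-g_\phi^f(X_t))]$ (Cesàro limit), and $h_\phi^*$ is the bias function of an optimal stationary policy (unique up to an additive constant for ergodic $\phi$). For $h:\mathcal{S}\to\mathbb{R}$, $(\mathbf{B}_\phi^a h)(x)=r_\phi(x,a)+\sum_y p_\phi(y|x,a)h(y)$ and $(\mathbf{B}_\phi^* h)(x)=\max_{a\in\mathcal{A}}(\mathbf{B}_\phi^a h)(x)$. $\mathcal{O}(x;\phi)=\{a:(\mathbf{B}_\phi^* h_\phi^* )(x)=(\mathbf{B}_\phi^a h_\phi^* )(x)\}$ and $\delta^*(x,a;\phi)=(\mathbf{B}_\phi^*h_\phi^* )(x)-(\mathbf{B}_\phi^a h_\phi^* )(x)$. Confusing MDPs. $\phi\ll\psi$ means that the kernels of $\phi$ are absolutely continuous w.r.t. those of $\psi$. For $\phi\ll\psi$, $$\mathrm{KL}_{\phi\mid\psi}(x,a)=\sum_{y}p_\phi(y|x,a)\log\frac{p_\phi(y|x,a)}{p_\psi(y|x,a)}+\int_0^1 q_\phi(r|x,a)\log\frac{q_\phi(r|x,a)}{q_\psi(r|x,a)}\lambda(dr).$$ $\Delta_\Phi(\phi)$ is the set of $\psi\in\Phi$ with $\phi\ll\psi$ such that (i) $\mathrm{KL}_{\phi\mid\psi}(x,a)=0$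 for all $x$ and all $a\in\mathcal{O}(x;\phi)$, and (ii) $\Pi^*(\phi)\cap\Pi^*(\psi)=\emptyset$. Finally $\bar{\mathbb{R}}_+=\mathbb{R}_+\cup\{\infty\}$, with $\infty\cdot 0=0$. *)

theory Defs
  imports "HOL-Probability.Probability" "HOL-Library.Landau_Symbols"
begin

text \<open>
  States and actions are the elements of finite types. Reward distributions are given by their
  densities with respect to a fixed Borel measure \<open>lam\<close>, which the theorem takes to be concentrated on
  \<open>[0,1]\<close>; \<open>lam\<close> need not be sigma-finite, so counting measure on \<open>[0,1]\<close> (discrete rewards) is covered.
\<close>

record ('s, 'a) mdp =
  tr :: "'s \<Rightarrow> 'a \<Rightarrow> 's pmf"
  rdens :: "'s \<Rightarrow> 'a \<Rightarrow> real \<Rightarrow> real"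

definition mdps :: "real measure \<Rightarrow> ('s, 'a) mdp set" where
  "mdps lam = {\<phi>. \<forall>x a. rdens \<phi> x a \<in> borel_measurable borel \<and> (\<forall>r. 0 \<le> rdens \<phi> x a r)
                     \<and> (\<integral>\<^sup>+ r. ennreal (rdens \<phi> x a r) \<partial>lam) = 1}"

definition reward_law :: "real measure \<Rightarrow> ('s, 'a) mdp \<Rightarrow> 's \<Rightarrow> 'a \<Rightarrow> real measure" where
  "reward_law lam \<phi> x a = density lam (\<lambda>r. ennreal (rdens \<phi> x a r))"

definition mean_reward :: "real measure \<Rightarrow> ('s, 'a) mdp \<Rightarrow> 's \<Rightarrow> 'a \<Rightarrow> real" where
  "mean_reward lam \<phi> x a = (\<integral> r. r \<partial>reward_law lam \<phi> x a)"

text \<open>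
  A history \<open>(h, s)\<close> with \<open>n\<close> completed steps encodes \<open>(X\<^sub>1, A\<^sub>1, R\<^sub>1, \<dots>, X\<^sub>n, A\<^sub>n, R\<^sub>n, X\<^bsub>n+1\<^esub>)\<close>:
  \<open>h i\<close> is the triple of step \<open>i + 1\<close>, for \<open>i < n\<close>, and \<open>s\<close> is the current state \<open>X\<^bsub>n+1\<^esub>\<close>.
  Accordingly \<open>\<pi> n\<close> is the decision rule that selects \<open>A\<^bsub>n+1\<^esub>\<close>.
\<close>

type_synonym ('s, 'a) hist = "(nat \<Rightarrow> 's \<times> 'a \<times> real) \<times> 's"
type_synonym ('s, 'a) policy = "nat \<Rightarrow> ('s, 'a) hist \<Rightarrow> 'a"

definition hist_space :: "nat \<Rightarrow> ('s, 'a) hist measure" where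
  "hist_space n =
     (\<Pi>\<^sub>M i\<in>{..<n}. count_space UNIV \<Otimes>\<^sub>M (count_space UNIV \<Otimes>\<^sub>M borel)) \<Otimes>\<^sub>M count_space UNIV"

definition policies :: "('s, 'a) policy set" where
  "policies = {\<pi>. \<forall>n. \<pi> n \<in> hist_space n \<rightarrow>\<^sub>M count_space UNIV}"

definition stationary :: "('s \<Rightarrow> 'a) \<Rightarrow> ('s, 'a) policy" where
  "stationary f = (\<lambda>n (h, s). f s)"

text \<open>
  The law, under \<open>\<pi>\<close> and \<open>X\<^sub>1 = x\<close>, of the history with \<open>n\<close> completed steps. Given the current state
  and action, the reward and the next state are drawn independently.
\<close>

primrec hist_law ::
  "real measure \<Rightarrow> ('s, 'a) mdp \<Rightarrow> ('s, 'a) policy \<Rightarrow> 's \<Rightarrow> nat \<Rightarrow> ('s, 'a) hist measure" where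
  "hist_law lam \<phi> \<pi> x 0 = return (hist_space 0) (\<lambda>_. undefined, x)"
| "hist_law lam \<phi> \<pi> x (Suc n) =
     hist_law lam \<phi> \<pi> x n \<bind> (\<lambda>(h, s).
       let a = \<pi> n (h, s) in
       distr (reward_law lam \<phi> s a \<Otimes>\<^sub>M measure_pmf (tr \<phi> s a)) (hist_space (Suc n))
         (\<lambda>(r, s'). (h(n := (s, a, r)), s')))"

definition value_fn ::
  "real measure \<Rightarrow> ('s, 'a) mdp \<Rightarrow> ('s, 'a) policy \<Rightarrow> 's \<Rightarrow> nat \<Rightarrow> real" where
  "value_fn lam \<phi> \<pi> x T = (\<integral> \<omega>. (\<Sum>i<T. snd (snd (fst \<omega> i))) \<partial>hist_law lam \<phi> \<pi> x T)"

definition opt_value :: "real measure \<Rightarrow> ('s, 'a) mdp \<Rightarrow> 's \<Rightarrow> nat \<Rightarrow> real" where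
  "opt_value lam \<phi> x T = (SUP \<pi>\<in>policies. value_fn lam \<phi> \<pi> x T)"

definition regret ::
  "real measure \<Rightarrow> ('s, 'a) mdp \<Rightarrow> ('s, 'a) policy \<Rightarrow> 's \<Rightarrow> nat \<Rightarrow> real" where
  "regret lam \<phi> \<pi> x T = opt_value lam \<phi> x T - value_fn lam \<phi> \<pi> x T"

text \<open>Irreducibility of \<open>(X\<^sub>t)\<close>: every state is reached from every state with positive probability
  at some step; \<open>snd\<close> of a history with \<open>n\<close> completed steps is \<open>X\<^bsub>n+1\<^esub>\<close>.\<close>

definition ergodic :: "real measure \<Rightarrow> ('s, 'a) mdp \<Rightarrow> bool" where
  "ergodic lam \<phi> \<longleftrightarrow>
     (\<forall>f x y. \<exists>n. \<P>(\<omega> in hist_law lam \<phi> (stationary f) x n. snd \<omega> = y) > 0)"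

definition uniformly_good ::
  "real measure \<Rightarrow> ('s, 'a) mdp set \<Rightarrow> ('s, 'a) policy \<Rightarrow> bool" where
  "uniformly_good lam \<Phi> \<pi> \<longleftrightarrow> \<pi> \<in> policies \<and>
     (\<forall>\<phi>\<in>\<Phi>. ergodic lam \<phi> \<longrightarrow>
        (\<forall>x. \<forall>\<alpha>>0. (\<lambda>T. regret lam \<phi> \<pi> x T) \<in> o(\<lambda>T. real T powr \<alpha>)))"

definition gain ::
  "real measure \<Rightarrow> ('s, 'a) mdp \<Rightarrow> ('s, 'a) policy \<Rightarrow> 's \<Rightarrow> real" where
  "gain lam \<phi> \<pi> x = lim (\<lambda>T. value_fn lam \<phi> \<pi> x T / real T)"

text \<open>The limit defining the gain need not exist for a history-dependent policy; the optimal gain is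
  taken over the policies for which it does, which include all stationary ones.\<close>

definition opt_gain :: "real measure \<Rightarrow> ('s, 'a) mdp \<Rightarrow> 's \<Rightarrow> real" where
  "opt_gain lam \<phi> x =
     (SUP \<pi>\<in>{\<pi>\<in>policies. convergent (\<lambda>T. value_fn lam \<phi> \<pi> x T / real T)}. gain lam \<phi> \<pi> x)"

definition opt_policies :: "real measure \<Rightarrow> ('s, 'a) mdp \<Rightarrow> ('s \<Rightarrow> 'a) set" where
  "opt_policies lam \<phi> = {f. \<forall>x. gain lam \<phi> (stationary f) x = opt_gain lam \<phi> x}"

text \<open>The Cesaro limit of \<open>u\<^sub>1, u\<^sub>2, \<dots>\<close>.\<close>

definition cesaro_lim :: "(nat \<Rightarrow> real) \<Rightarrow> real" where
  "cesaro_lim u = lim (\<lambda>N. (\<Sum>T=1..N. u T) / real N)"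

definition bias :: "real measure \<Rightarrow> ('s, 'a) mdp \<Rightarrow> ('s \<Rightarrow> 'a) \<Rightarrow> 's \<Rightarrow> real" where
  "bias lam \<phi> f x = cesaro_lim (\<lambda>T.
     \<integral> \<omega>. (\<Sum>i<T. snd (snd (fst \<omega> i)) - gain lam \<phi> (stationary f) (fst (fst \<omega> i)))
       \<partial>hist_law lam \<phi> (stationary f) x T)"

text \<open>For ergodic \<open>\<phi>\<close> the choice of the optimal policy affects the bias only by an additive constant,
  which does not matter for the optimal actions and the gaps below.\<close>

definition opt_bias :: "real measure \<Rightarrow> ('s, 'a) mdp \<Rightarrow> 's \<Rightarrow> real" where
  "opt_bias lam \<phi> = bias lam \<phi> (SOME f. f \<in> opt_policies lam \<phi>)"

definition bellman ::
  "real measure \<Rightarrow> ('s::finite, 'a) mdp \<Rightarrow> 'a \<Rightarrow> ('s \<Rightarrow> real) \<Rightarrow> 's \<Rightarrow> real" where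
  "bellman lam \<phi> a h x = mean_reward lam \<phi> x a + (\<Sum>y\<in>UNIV. pmf (tr \<phi> x a) y * h y)"

definition bellman_opt ::
  "real measure \<Rightarrow> ('s::finite, 'a::finite) mdp \<Rightarrow> ('s \<Rightarrow> real) \<Rightarrow> 's \<Rightarrow> real" where
  "bellman_opt lam \<phi> h x = (MAX a\<in>UNIV. bellman lam \<phi> a h x)"

definition opt_actions :: "real measure \<Rightarrow> ('s::finite, 'a::finite) mdp \<Rightarrow> 's \<Rightarrow> 'a set" where
  "opt_actions lam \<phi> x =
     {a. bellman_opt lam \<phi> (opt_bias lam \<phi>) x = bellman lam \<phi> a (opt_bias lam \<phi>) x}"

definition gap :: "real measure \<Rightarrow> ('s::finite, 'a::finite) mdp \<Rightarrow> 's \<Rightarrow> 'a \<Rightarrow> real" where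
  "gap lam \<phi> x a =
     bellman_opt lam \<phi> (opt_bias lam \<phi>) x - bellman lam \<phi> a (opt_bias lam \<phi>) x"

text \<open>\<open>mdp_ac \<phi> \<psi>\<close> is \<open>\<phi> \<lless> \<psi>\<close>; the library's \<open>absolutely_continuous M N\<close> means \<open>N \<lless> M\<close>.\<close>

definition mdp_ac :: "real measure \<Rightarrow> ('s, 'a) mdp \<Rightarrow> ('s, 'a) mdp \<Rightarrow> bool" where
  "mdp_ac lam \<phi> \<psi> \<longleftrightarrow> (\<forall>x a.
     absolutely_continuous (measure_pmf (tr \<psi> x a)) (measure_pmf (tr \<phi> x a)) \<and>
     absolutely_continuous (reward_law lam \<psi> x a) (reward_law lam \<phi> x a))"

text \<open>The integral with values in the extended reals. A Bochner integral would be \<open>0\<close> instead of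
  \<open>\<infinity>\<close> when the Kullback-Leibler divergence is infinite. In that use the integral of the
  negative part is always finite when \<open>\<phi> \<lless> \<psi>\<close>.\<close>

definition ext_integral :: "'b measure \<Rightarrow> ('b \<Rightarrow> real) \<Rightarrow> ereal" where
  "ext_integral M f =
     enn2ereal (\<integral>\<^sup>+ r. ennreal (f r) \<partial>M) - enn2ereal (\<integral>\<^sup>+ r. ennreal (- f r) \<partial>M)"

definition KL :: "real measure \<Rightarrow> ('s::finite, 'a) mdp \<Rightarrow> ('s, 'a) mdp \<Rightarrow> 's \<Rightarrow> 'a \<Rightarrow> ereal" where
  "KL lam \<phi> \<psi> x a =
     ereal (\<Sum>y\<in>UNIV. pmf (tr \<phi> x a) y * ln (pmf (tr \<phi> x a) y / pmf (tr \<psi> x a) y)) +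
     ext_integral lam (\<lambda>r. rdens \<phi> x a r * ln (rdens \<phi> x a r / rdens \<psi> x a r))"

definition confusing ::
  "real measure \<Rightarrow> ('s::finite, 'a::finite) mdp set \<Rightarrow> ('s, 'a) mdp \<Rightarrow> ('s, 'a) mdp set" where
  "confusing lam \<Phi> \<phi> = {\<psi>\<in>\<Phi>. mdp_ac lam \<phi> \<psi> \<and>
     (\<forall>x. \<forall>a\<in>opt_actions lam \<phi> x. KL lam \<phi> \<psi> x a = 0) \<and>
     opt_policies lam \<phi> \<inter> opt_policies lam \<psi> = {}}"

definition feasible ::
  "real measure \<Rightarrow> ('s::finite, 'a::finite) mdp set \<Rightarrow> ('s, 'a) mdp \<Rightarrow> ('s \<Rightarrow> 'a \<Rightarrow> ereal) set" where
  "feasible lam \<Phi> \<phi> = {\<eta>. (\<forall>x a. 0 \<le> \<eta> x a) \<and>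
     (\<forall>\<psi>\<in>confusing lam \<Phi> \<phi>. (\<Sum>(x, a)\<in>UNIV. \<eta> x a * KL lam \<phi> \<psi> x a) \<ge> 1)}"

definition K_bound ::
  "real measure \<Rightarrow> ('s::finite, 'a::finite) mdp set \<Rightarrow> ('s, 'a) mdp \<Rightarrow> ereal" where
  "K_bound lam \<Phi> \<phi> =
     (INF \<eta>\<in>feasible lam \<Phi> \<phi>. \<Sum>(x, a)\<in>UNIV. \<eta> x a * ereal (gap lam \<phi> x a))"

end

(*
  Let EN(s,a) be the expected number of uses of action a in state s up to time T. Summing the
  optimality equation along trajectories, the regret is at least the sum of EN * gap up to a
  constant. So regret below c * log T along a subsequence makes EN / log T converge there, for
  suboptimal (s,a), to an allocation of cost at most c.

  This allocation is feasible up to an arbitrarily small perturbation. A confusing psi is again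
  ergodic, and in some state z no action is optimal both for phi and for psi. Under phi a good
  algorithm visits z linearly often and plays there mostly the phi-optimal actions; under psi
  these are suboptimal and are played linearly often only with probability T^(-1+o(1)). The
  Donsker-Varadhan inequality, applied to L times the indicator of this event with L close to
  log T and chained along the history, gives that the sum of EN * KL is at least
  (1 - o(1)) * log T.
*)

theory Submission
  imports Defs
begin

section \<open>Histories as a Markov process\<close>

text \<open>Policies may depend on the whole history, so no Markov chain is at hand. Expected sums
  along the path are reduced to \<open>occ\<close> by a Dynkin formula, and the visits to
  \<open>z\<close> need a Lyapunov function whose drift has the right sign for all actions
  simultaneously. The change of measure uses only the mean of the log-likelihood ratio: the
  Donsker-Varadhan inequality takes the place of a density of the path law and of a concentration
  bound for that ratio. It is proved for densities directly, since \<open>lam\<close> may fail to be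
  sigma-finite; Fubini is applied to probability laws only. Two points concern optimal actions.
  \<open>opt_bias\<close> belongs to an arbitrarily chosen optimal policy, so the optimality
  equation has to be established for the bias of every one of them. And for optimal pairs the ratio
  of EN to log T has no bound, which is harmless because gap and divergence both vanish there. The
  perturbation of the allocation serves the confusing models with an infinite divergence, on which
  the change of measure gives no information.\<close>

definition hist_kernel ::
  "real measure \<Rightarrow> ('s, 'a) mdp \<Rightarrow> ('s, 'a) policy \<Rightarrow> nat \<Rightarrow> ('s, 'a) hist \<Rightarrow> ('s, 'a) hist measure" where
  "hist_kernel lam \<phi> \<pi> n = (\<lambda>(h, s).
       let a = \<pi> n (h, s) in
       distr (reward_law lam \<phi> s a \<Otimes>\<^sub>M measure_pmf (tr \<phi> s a)) (hist_space (Suc n))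
         (\<lambda>(r, s'). (h(n := (s, a, r)), s')))"

lemma hist_law_Suc:
  "hist_law lam \<phi> \<pi> x (Suc n) = hist_law lam \<phi> \<pi> x n \<bind> hist_kernel lam \<phi> \<pi> n"
  by (simp add: hist_kernel_def)

declare hist_law.simps(2) [simp del]

lemma measurable_hist_fst [measurable]:
  "(\<lambda>\<omega>. fst \<omega> i) \<in> hist_space n \<rightarrow>\<^sub>M count_space UNIV \<Otimes>\<^sub>M (count_space UNIV \<Otimes>\<^sub>M borel)" if "i < n"
  unfolding hist_space_def using that
  by (intro measurable_compose[OF measurable_fst measurable_component_singleton]) simp

lemma measurable_hist_snd [measurable]: "snd \<in> hist_space n \<rightarrow>\<^sub>M count_space UNIV"
  unfolding hist_space_def by measurable

lemma measurable_policy [measurable]: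
  "\<pi> \<in> policies \<Longrightarrow> \<pi> n \<in> hist_space n \<rightarrow>\<^sub>M count_space UNIV"
  by (simp add: policies_def)

lemma stationary_in_policies [simp]: "stationary (f :: 's::finite \<Rightarrow> 'a) \<in> policies"
proof -
  have eq: "stationary f n = (\<lambda>\<omega>. f (snd \<omega>))" for n
    by (auto simp: stationary_def)
  have "stationary f n \<in> hist_space n \<rightarrow>\<^sub>M count_space UNIV" for n
    unfolding eq by (rule measurable_compose[OF measurable_hist_snd]) simp
  then show ?thesis unfolding policies_def by blast
qed

text \<open>Jointly measurable in the old history and the new pair \<open>(r, s')\<close>: a fixed
  history gives the one-step map in \<open>hist_kernel\<close>, a varying one gives the
  measurability of that kernel.\<close>

lemma measurable_hist_update:
  assumes "\<pi> \<in> policies"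
  shows "(\<lambda>((h, s), r, s'). (h(n := (s, \<pi> n (h, s), r)), s'))
     \<in> hist_space n \<Otimes>\<^sub>M (borel \<Otimes>\<^sub>M count_space UNIV) \<rightarrow>\<^sub>M
       (hist_space (Suc n) :: ('s, 'a) hist measure)"
proof -
  have eq: "(\<lambda>((h, s), r, s'). (h(n := (s, \<pi> n (h, s), r)), s'))
      = (\<lambda>z. ((fst (fst z))(n := (snd (fst z), \<pi> n (fst z), fst (snd z))), snd (snd z)))"
    by auto
  have [measurable]: "(\<lambda>z. \<pi> n (fst z)) \<in> hist_space n \<Otimes>\<^sub>M (borel \<Otimes>\<^sub>M count_space UNIV) \<rightarrow>\<^sub>M count_space UNIV"
    using assms by measurable
  have [measurable]: "(\<lambda>z. fst (fst z)) \<in> hist_space n \<Otimes>\<^sub>M (borel \<Otimes>\<^sub>M count_space UNIV) \<rightarrow>\<^sub>M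
     (\<Pi>\<^sub>M i\<in>{..<n}. (count_space UNIV :: 's measure) \<Otimes>\<^sub>M ((count_space UNIV :: 'a measure) \<Otimes>\<^sub>M (borel :: real measure)))"
    unfolding hist_space_def by measurable
  have "(\<lambda>z. (fst (fst z))(n := (snd (fst z), \<pi> n (fst z), fst (snd z))))
      \<in> hist_space n \<Otimes>\<^sub>M (borel \<Otimes>\<^sub>M count_space UNIV) \<rightarrow>\<^sub>M
     (\<Pi>\<^sub>M i\<in>{..<Suc n}. (count_space UNIV :: 's measure) \<Otimes>\<^sub>M ((count_space UNIV :: 'a measure) \<Otimes>\<^sub>M (borel :: real measure)))"
    by (rule measurable_fun_upd[where J="{..<n}"]) auto
  then show ?thesis
    unfolding eq hist_space_def[of "Suc n"] by (rule measurable_Pair) simp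
qed

locale mdp_model =
  fixes lam :: "real measure" and \<phi> :: "('s::finite, 'a::finite) mdp"
  assumes sets_lam: "sets lam = sets borel"
    and lam_unit: "emeasure lam (- {0..1}) = 0"
    and in_mdps: "\<phi> \<in> mdps lam"
begin

lemma measurable_rdens_borel [measurable]: "rdens \<phi> s a \<in> borel_measurable borel"
  using in_mdps by (simp add: mdps_def)

lemma measurable_rdens [measurable]: "rdens \<phi> s a \<in> borel_measurable lam"
  by (simp add: measurable_cong_sets[OF sets_lam refl])

lemma rdens_nonneg: "0 \<le> rdens \<phi> s a r"
  using in_mdps by (simp add: mdps_def)

lemma nn_integral_rdens: "(\<integral>\<^sup>+ r. ennreal (rdens \<phi> s a r) \<partial>lam) = 1"
  using in_mdps by (simp add: mdps_def)

lemma sets_reward_law [simp, measurable_cong]: "sets (reward_law lam \<phi> s a) = sets borel"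
  by (simp add: reward_law_def sets_lam)

lemma space_lam [simp]: "space lam = UNIV"
  using sets_eq_imp_space_eq[OF sets_lam] by simp

lemma space_reward_law [simp]: "space (reward_law lam \<phi> s a) = UNIV"
  by (simp add: reward_law_def)

lemma prob_space_reward_law: "prob_space (reward_law lam \<phi> s a)"
proof
  show "emeasure (reward_law lam \<phi> s a) (space (reward_law lam \<phi> s a)) = 1"
    unfolding reward_law_def
    by (subst emeasure_density) (auto simp: nn_integral_rdens sets.top[of lam, unfolded space_lam])
qed

lemma AE_lam_unit: "AE r in lam. r \<in> {0..1}"
  using lam_unit by (intro AE_I[of _ _ "- {0..1}"]) (auto simp: sets_lam)

lemma AE_reward_law_unit: "AE r in reward_law lam \<phi> s a. r \<in> {0..1}"
  unfolding reward_law_def using AE_lam_unit by (subst AE_density) auto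

lemma integral_reward_law:
  fixes F :: "real \<Rightarrow> real"
  assumes "F \<in> borel_measurable borel"
  shows "(\<integral>r. F r \<partial>reward_law lam \<phi> s a) = (\<integral>r. rdens \<phi> s a r * F r \<partial>lam)"
proof -
  have [measurable]: "F \<in> borel_measurable lam"
    using assms by (simp add: measurable_cong_sets[OF sets_lam refl])
  show ?thesis
    unfolding reward_law_def by (subst integral_density) (auto simp: rdens_nonneg)
qed

lemma step_measure_in_prob_algebra:
  "reward_law lam \<phi> s a \<Otimes>\<^sub>M measure_pmf (tr \<phi> s a) \<in> space (prob_algebra (borel \<Otimes>\<^sub>M count_space UNIV))"
proof -
  interpret A: prob_space "reward_law lam \<phi> s a" by (rule prob_space_reward_law)
  interpret P: pair_prob_space "reward_law lam \<phi> s a" "measure_pmf (tr \<phi> s a)" ..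
  show ?thesis
    by (auto simp: space_prob_algebra P.prob_space_axioms intro!: sets_pair_measure_cong)
qed

lemma measurable_hist_kernel [measurable]:
  assumes "\<pi> \<in> policies"
  shows "hist_kernel lam \<phi> \<pi> n \<in> hist_space n \<rightarrow>\<^sub>M prob_algebra (hist_space (Suc n))"
proof -
  \<comment> \<open>The model enters only through the current state and action, and on the discrete
    space of these pairs any family of laws is a kernel. The history then enters through a
    measurable index and a jointly measurable map.\<close>
  define k where "k = (\<lambda>(s, a). reward_law lam \<phi> s a \<Otimes>\<^sub>M measure_pmf (tr \<phi> s a))"
  have k: "k \<in> count_space UNIV \<rightarrow>\<^sub>M prob_algebra (borel \<Otimes>\<^sub>M count_space UNIV)"
    using step_measure_in_prob_algebra by (auto simp: k_def)
  have [measurable]: "(\<lambda>\<omega>. (snd \<omega>, \<pi> n \<omega>)) \<in> hist_space n \<rightarrow>\<^sub>M count_space UNIV"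
    using measurable_Pair[OF measurable_hist_snd measurable_policy[OF assms, of n]]
    by (simp add: pair_measure_countable)
  have eq: "hist_kernel lam \<phi> \<pi> n = (\<lambda>\<omega>. distr (k (snd \<omega>, \<pi> n \<omega>)) (hist_space (Suc n))
      (\<lambda>z. (\<lambda>((h, s), r, s'). (h(n := (s, \<pi> n (h, s), r)), s')) (\<omega>, z)))"
    by (auto simp: hist_kernel_def k_def Let_def fun_eq_iff intro!: arg_cong[where f="distr _ _"])
  show ?thesis unfolding eq
  proof (rule measurable_distr_prob_space2)
    show "(\<lambda>\<omega>. k (snd \<omega>, \<pi> n \<omega>)) \<in> hist_space n \<rightarrow>\<^sub>M prob_algebra (borel \<Otimes>\<^sub>M count_space UNIV)"
      by (rule measurable_compose[OF _ k]) measurable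
  qed (use measurable_hist_update[OF assms, of n] in \<open>simp add: case_prod_beta'\<close>)
qed

section \<open>Laws of histories and the tower property\<close>

lemma hist_law_in_prob_algebra:
  assumes "\<pi> \<in> policies"
  shows "hist_law lam \<phi> \<pi> x n \<in> space (prob_algebra (hist_space n))"
proof (induction n)
  case 0
  have "(\<lambda>_. undefined, x) \<in> space (hist_space 0)"
    by (simp add: hist_space_def space_pair_measure space_PiM)
  then show ?case
    using measurable_space[OF measurable_return_prob_space] by simp
next
  case (Suc n)
  show ?case
    using prob_space_bind'[OF Suc measurable_hist_kernel[OF assms]]
      sets_bind'[OF Suc measurable_hist_kernel[OF assms]]
    by (simp add: hist_law_Suc space_prob_algebra)
qed

lemma prob_space_hist_law: "\<pi> \<in> policies \<Longrightarrow> prob_space (hist_law lam \<phi> \<pi> x n)"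
  using hist_law_in_prob_algebra[of \<pi> x n] by (simp add: space_prob_algebra)

lemma sets_hist_law: "\<pi> \<in> policies \<Longrightarrow> sets (hist_law lam \<phi> \<pi> x n) = sets (hist_space n)"
  using hist_law_in_prob_algebra[of \<pi> x n] by (simp add: space_prob_algebra)

lemma space_hist_law: "\<pi> \<in> policies \<Longrightarrow> space (hist_law lam \<phi> \<pi> x n) = space (hist_space n)"
  by (rule sets_eq_imp_space_eq) (rule sets_hist_law)

lemma measurable_hist_law:
  "\<pi> \<in> policies \<Longrightarrow> measurable (hist_law lam \<phi> \<pi> x n) N = measurable (hist_space n) N"
  by (rule measurable_cong_sets) (simp_all add: sets_hist_law)

lemma integrable_hist_law:
  fixes F :: "_ \<Rightarrow> real"
  assumes "\<pi> \<in> policies" "F \<in> borel_measurable (hist_space n)"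
    and "\<And>\<omega>. \<omega> \<in> space (hist_space n) \<Longrightarrow> \<bar>F \<omega>\<bar> \<le> B"
  shows "integrable (hist_law lam \<phi> \<pi> x n) F"
proof -
  interpret prob_space "hist_law lam \<phi> \<pi> x n" by (rule prob_space_hist_law) fact
  show ?thesis
    by (rule integrable_const_bound[of _ B])
       (use assms in \<open>auto simp: measurable_hist_law space_hist_law\<close>)
qed

text \<open>Fubini for the independent draw of reward and next state. The second and third facts
  pass measurability and the bound on to the integrand as a function of \<open>(r, y)\<close>, the
  form in which \<open>donsker_varadhan_step\<close> takes it.\<close>

lemma integral_hist_kernel:
  fixes F :: "_ \<Rightarrow> real"
  assumes pi: "\<pi> \<in> policies" and F [measurable]: "F \<in> borel_measurable (hist_space (Suc n))"
    and B: "\<And>\<omega>. \<omega> \<in> space (hist_space (Suc n)) \<Longrightarrow> \<bar>F \<omega>\<bar> \<le> B"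
    and \<omega>: "\<omega> \<in> space (hist_space n)"
  defines "s \<equiv> snd \<omega>" and "a \<equiv> \<pi> n \<omega>"
  shows "(\<integral>z. F z \<partial>hist_kernel lam \<phi> \<pi> n \<omega>) =
    (\<integral>r. (\<Sum>y\<in>UNIV. pmf (tr \<phi> s a) y * F ((fst \<omega>)(n := (s, a, r)), y)) \<partial>reward_law lam \<phi> s a)"
    and "(\<lambda>(r, y). F ((fst \<omega>)(n := (s, a, r)), y)) \<in> borel_measurable (borel \<Otimes>\<^sub>M count_space UNIV)"
    and "\<bar>F ((fst \<omega>)(n := (s, a, r)), y)\<bar> \<le> B"
proof -
  interpret A: prob_space "reward_law lam \<phi> s a" by (rule prob_space_reward_law)
  interpret P: pair_prob_space "reward_law lam \<phi> s a" "measure_pmf (tr \<phi> s a)" ..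
  define up :: "real \<times> 's \<Rightarrow> ('s, 'a) hist" where "up = (\<lambda>(r, y). ((fst \<omega>)(n := (s, a, r)), y))"
  have up_eq: "up = (\<lambda>z. (\<lambda>((h, s), r, s'). (h(n := (s, \<pi> n (h, s), r)), s')) (\<omega>, z))"
    by (auto simp: up_def s_def a_def case_prod_beta')
  have up [measurable]: "up \<in> borel \<Otimes>\<^sub>M count_space UNIV \<rightarrow>\<^sub>M hist_space (Suc n)"
    unfolding up_eq by (rule measurable_compose[OF _ measurable_hist_update[OF pi]]) (use \<omega> in measurable)
  show F': "(\<lambda>(r, y). F ((fst \<omega>)(n := (s, a, r)), y)) \<in> borel_measurable (borel \<Otimes>\<^sub>M count_space UNIV)"
    using measurable_compose[OF up F] by (simp add: up_def case_prod_beta')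
  have B': "\<bar>F ((fst \<omega>)(n := (s, a, r)), y)\<bar> \<le> B" for r y
    using B[OF measurable_space[OF up, of "(r, y)"]] by (simp add: up_def space_pair_measure)
  then show "\<bar>F ((fst \<omega>)(n := (s, a, r)), y)\<bar> \<le> B" .
  let ?P = "reward_law lam \<phi> s a \<Otimes>\<^sub>M measure_pmf (tr \<phi> s a)"
  have m: "measurable ?P N = measurable (borel \<Otimes>\<^sub>M count_space UNIV) N" for N :: "'z measure"
    by (intro measurable_cong_sets sets_pair_measure_cong) auto
  have "hist_kernel lam \<phi> \<pi> n \<omega> = distr ?P (hist_space (Suc n)) up"
    by (auto simp: hist_kernel_def up_def s_def a_def Let_def case_prod_beta')
  then have "(\<integral>z. F z \<partial>hist_kernel lam \<phi> \<pi> n \<omega>) = (\<integral>z. F (up z) \<partial>?P)"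
    by (simp add: integral_distr m)
  also have "\<dots> = (\<integral>r. (\<integral>y. F (up (r, y)) \<partial>measure_pmf (tr \<phi> s a)) \<partial>reward_law lam \<phi> s a)"
  proof (rule P.integral_fst'[symmetric])
    show "integrable ?P (\<lambda>z. F (up z))"
      by (rule P.P.integrable_const_bound[of _ B])
         (use B' measurable_compose[OF up F] in \<open>auto simp: m up_def\<close>)
  qed
  also have "\<dots> = (\<integral>r. (\<Sum>y\<in>UNIV. pmf (tr \<phi> s a) y * F ((fst \<omega>)(n := (s, a, r)), y)) \<partial>reward_law lam \<phi> s a)"
    by (subst integral_measure_pmf[of UNIV]) (auto simp: up_def)
  finally show "(\<integral>z. F z \<partial>hist_kernel lam \<phi> \<pi> n \<omega>) = \<dots>" .
qed

lemma integral_hist_law_Suc: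
  fixes F :: "_ \<Rightarrow> real"
  assumes pi: "\<pi> \<in> policies" and F [measurable]: "F \<in> borel_measurable (hist_space (Suc n))"
    and B: "\<And>\<omega>. \<omega> \<in> space (hist_space (Suc n)) \<Longrightarrow> \<bar>F \<omega>\<bar> \<le> B"
  shows "(\<integral>\<omega>. F \<omega> \<partial>hist_law lam \<phi> \<pi> x (Suc n)) =
    (\<integral>\<omega>. (\<integral>z. F z \<partial>hist_kernel lam \<phi> \<pi> n \<omega>) \<partial>hist_law lam \<phi> \<pi> x n)"
  unfolding hist_law_Suc
proof (rule integral_bind[OF F B])
  interpret prob_space "hist_law lam \<phi> \<pi> x n" by (rule prob_space_hist_law) fact
  show "hist_kernel lam \<phi> \<pi> n \<in> hist_law lam \<phi> \<pi> x n \<rightarrow>\<^sub>M subprob_algebra (hist_space (Suc n))"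
    using measurable_prob_algebraD[OF measurable_hist_kernel[OF pi]] by (simp add: measurable_hist_law pi)
  show "finite_measure (hist_law lam \<phi> \<pi> x n)" by (rule finite_measure_axioms)
  show "AE \<omega> in hist_law lam \<phi> \<pi> x n. emeasure (hist_kernel lam \<phi> \<pi> n \<omega>) (space (hist_kernel lam \<phi> \<pi> n \<omega>)) \<le> ennreal 1"
  proof (rule AE_I2)
    fix \<omega> assume "\<omega> \<in> space (hist_law lam \<phi> \<pi> x n)"
    then have "hist_kernel lam \<phi> \<pi> n \<omega> \<in> space (prob_algebra (hist_space (Suc n)))"
      using measurable_space[OF measurable_hist_kernel[OF pi]] by (simp add: space_hist_law pi)
    then show "emeasure (hist_kernel lam \<phi> \<pi> n \<omega>) (space (hist_kernel lam \<phi> \<pi> n \<omega>)) \<le> ennreal 1"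
      by (simp add: space_prob_algebra prob_space.emeasure_space_1)
  qed
qed

lemma measurable_integral_hist_kernel:
  fixes F :: "_ \<Rightarrow> real"
  assumes pi: "\<pi> \<in> policies" and F [measurable]: "F \<in> borel_measurable (hist_space (Suc n))"
  shows "(\<lambda>\<omega>. \<integral>z. F z \<partial>hist_kernel lam \<phi> \<pi> n \<omega>) \<in> borel_measurable (hist_space n)"
  by (rule measurable_compose[OF measurable_prob_algebraD[OF measurable_hist_kernel[OF pi]]
        integral_measurable_subprob_algebra[OF F]])

end

section \<open>Occupation measures\<close>

text \<open>Additive functionals of the completed steps; reward sums, visit counts and the exponents
  of supermartingales are instances.\<close>

definition path_sum :: "nat \<Rightarrow> ('s \<times> 'a \<times> real \<Rightarrow> real) \<Rightarrow> ('s, 'a) hist \<Rightarrow> real" where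
  "path_sum n c \<omega> = (\<Sum>i<n. c (fst \<omega> i))"

text \<open>The EN of the overview, as a sum of probabilities over the first \<open>n\<close>
  decisions: index \<open>i\<close> is the decision taken after \<open>i\<close> completed
  steps.\<close>

definition occ ::
  "real measure \<Rightarrow> ('s, 'a) mdp \<Rightarrow> ('s, 'a) policy \<Rightarrow> 's \<Rightarrow> nat \<Rightarrow> 's \<Rightarrow> 'a \<Rightarrow> real" where
  "occ lam \<phi> \<pi> x n s a =
     (\<Sum>i<n. measure (hist_law lam \<phi> \<pi> x i) {\<omega>\<in>space (hist_space i). snd \<omega> = s \<and> \<pi> i \<omega> = a})"

abbreviation step_mean :: "('s::finite, 'a) mdp \<Rightarrow> ('s \<Rightarrow> real) \<Rightarrow> 's \<Rightarrow> 'a \<Rightarrow> real" where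
  "step_mean \<phi> u s a \<equiv> (\<Sum>y\<in>UNIV. pmf (tr \<phi> s a) y * u y)"

lemma finite_type_bound: "\<exists>D\<ge>0. \<forall>s. \<bar>u s\<bar> \<le> (D::real)" for u :: "'s::finite \<Rightarrow> real"
proof (intro exI conjI allI)
  show "0 \<le> (\<Sum>s\<in>UNIV. \<bar>u s\<bar>)" by (simp add: sum_nonneg)
  show "\<bar>u s\<bar> \<le> (\<Sum>s\<in>UNIV. \<bar>u s\<bar>)" for s by (rule member_le_sum) auto
qed

lemma sum_pmf_UNIV [simp]: "(\<Sum>y\<in>UNIV. pmf p y) = 1" for p :: "'s::finite pmf"
  by (simp add: sum_pmf_eq_1)

lemma step_mean_const [simp]: "step_mean \<phi> (\<lambda>_. c) s a = c" for \<phi> :: "('s::finite, 'a) mdp"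
  by (simp flip: sum_distrib_right)

lemma measurable_hist_snd_comp [measurable]:
  "(\<lambda>\<omega>. u (snd \<omega>)) \<in> borel_measurable (hist_space n)" for u :: "'s::finite \<Rightarrow> real"
  by (rule measurable_compose[OF measurable_hist_snd]) simp

lemma measurable_path_sum [measurable]:
  assumes c: "c \<in> borel_measurable (count_space UNIV \<Otimes>\<^sub>M (count_space UNIV \<Otimes>\<^sub>M borel))"
  shows "path_sum n c \<in> borel_measurable (hist_space n)"
  unfolding path_sum_def
  by (intro borel_measurable_sum measurable_compose[OF measurable_hist_fst c]) simp

lemma path_sum_bound:
  assumes "\<And>z. \<bar>c z\<bar> \<le> C"
  shows "\<bar>path_sum n c \<omega>\<bar> \<le> real n * C"
proof -
  have "\<bar>path_sum n c \<omega>\<bar> \<le> (\<Sum>i<n. \<bar>c (fst \<omega> i)\<bar>)"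
    unfolding path_sum_def by (rule sum_abs)
  also have "\<dots> \<le> (\<Sum>i<n. C)" by (intro sum_mono assms)
  finally show ?thesis by simp
qed

lemma path_sum_update: "path_sum (Suc n) c (h(n := z), y) = path_sum n c (h, y') + c z"
  by (simp add: path_sum_def)

text \<open>Both discrete coordinates range over finite types, so the function is a finite sum of
  indicators times measurable slices.\<close>

lemma measurable_step_function:
  fixes g :: "'s::finite \<Rightarrow> 'a::finite \<Rightarrow> real \<Rightarrow> real"
  assumes g [measurable]: "\<And>s a. g s a \<in> borel_measurable borel"
  shows "(\<lambda>(s, a, r). g s a r) \<in> borel_measurable (count_space UNIV \<Otimes>\<^sub>M (count_space UNIV \<Otimes>\<^sub>M borel))"
proof -
  have "(case z of (s, a, r) \<Rightarrow> g s a r) =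
      (\<Sum>s\<in>UNIV. \<Sum>a\<in>UNIV. indicator {s} (fst z) * (indicator {a} (fst (snd z)) * g s a (snd (snd z))))" for z
  proof -
    obtain s a r where z: "z = (s, a, r)" by (cases z)
    have "(\<Sum>s'\<in>UNIV. \<Sum>a'\<in>UNIV. indicator {s'} s * (indicator {a'} a * g s' a' r)) =
        (\<Sum>s'\<in>UNIV. \<Sum>a'\<in>UNIV. if s' = s then if a' = a then g s a r else 0 else 0)"
      by (intro sum.cong) (auto simp: indicator_def)
    also have "\<dots> = (\<Sum>s'\<in>UNIV. if s' = s then g s a r else 0)"
      by (intro sum.cong refl) auto
    finally show ?thesis by (simp add: z)
  qed
  moreover have "(\<lambda>z. \<Sum>s\<in>UNIV. \<Sum>a\<in>UNIV. indicator {s} (fst z) * (indicator {a} (fst (snd z)) * g s a (snd (snd z))))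
    \<in> borel_measurable ((count_space UNIV :: 's measure) \<Otimes>\<^sub>M ((count_space UNIV :: 'a measure) \<Otimes>\<^sub>M borel))"
    by measurable
  ultimately show ?thesis by presburger
qed

context mdp_model
begin

lemma occ_nonneg: "0 \<le> occ lam \<phi> \<pi> x n s a"
  by (simp add: occ_def sum_nonneg)

text \<open>The finitely many events \<open>?A s a\<close> partition the space, and the integrand is
  constant on each of them.\<close>

lemma integral_state_action:
  fixes G :: "'s \<Rightarrow> 'a \<Rightarrow> real"
  assumes pi: "\<pi> \<in> policies"
  shows "(\<integral>\<omega>. G (snd \<omega>) (\<pi> n \<omega>) \<partial>hist_law lam \<phi> \<pi> x n) =
    (\<Sum>s\<in>UNIV. \<Sum>a\<in>UNIV. measure (hist_law lam \<phi> \<pi> x n) {\<omega>\<in>space (hist_space n). snd \<omega> = s \<and> \<pi> n \<omega> = a} * G s a)"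
    and "(\<lambda>\<omega>. G (snd \<omega>) (\<pi> n \<omega>)) \<in> borel_measurable (hist_space n)"
    and "integrable (hist_law lam \<phi> \<pi> x n) (\<lambda>\<omega>. G (snd \<omega>) (\<pi> n \<omega>))"
proof -
  interpret prob_space "hist_law lam \<phi> \<pi> x n" by (rule prob_space_hist_law) fact
  let ?A = "\<lambda>s a. {\<omega>\<in>space (hist_space n). snd \<omega> = s \<and> \<pi> n \<omega> = a}"
  have [measurable]: "?A s a \<in> sets (hist_space n)" for s a
    using pi by measurable
  have A: "?A s a \<in> events" for s a
    using sets_hist_law[OF pi] by simp
  have eq: "G (snd \<omega>) (\<pi> n \<omega>) = (\<Sum>s\<in>UNIV. \<Sum>a\<in>UNIV. indicator (?A s a) \<omega> * G s a)"
    if "\<omega> \<in> space (hist_space n)" for \<omega>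
  proof -
    have "(\<Sum>s\<in>UNIV. \<Sum>a\<in>UNIV. indicator (?A s a) \<omega> * G s a) =
        (\<Sum>s\<in>UNIV. \<Sum>a\<in>UNIV. if snd \<omega> = s then if \<pi> n \<omega> = a then G s a else 0 else 0)"
      using that by (intro sum.cong) (auto simp: indicator_def)
    also have "\<dots> = (\<Sum>s\<in>UNIV. if snd \<omega> = s then G s (\<pi> n \<omega>) else 0)"
      by (intro sum.cong refl) auto
    also have "\<dots> = G (snd \<omega>) (\<pi> n \<omega>)" by simp
    finally show ?thesis by simp
  qed
  have int: "integrable (hist_law lam \<phi> \<pi> x n) (\<lambda>\<omega>. indicator (?A s a) \<omega> * G s a)" for s a
    using A by (intro integrable_mult_left) (auto simp: less_top[symmetric])
  have eval: "(\<integral>\<omega>. indicator (?A s a) \<omega> * G s a \<partial>hist_law lam \<phi> \<pi> x n) =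
      measure (hist_law lam \<phi> \<pi> x n) (?A s a) * G s a" for s a
    using A by simp
  have "(\<integral>\<omega>. G (snd \<omega>) (\<pi> n \<omega>) \<partial>hist_law lam \<phi> \<pi> x n) =
     (\<integral>\<omega>. (\<Sum>s\<in>UNIV. \<Sum>a\<in>UNIV. indicator (?A s a) \<omega> * G s a) \<partial>hist_law lam \<phi> \<pi> x n)"
    by (intro Bochner_Integration.integral_cong refl eq) (simp add: space_hist_law pi)
  also have "\<dots> = (\<Sum>s\<in>UNIV. \<Sum>a\<in>UNIV. measure (hist_law lam \<phi> \<pi> x n) (?A s a) * G s a)"
    by (simp only: Bochner_Integration.integral_sum[OF Bochner_Integration.integrable_sum[OF int]]
        Bochner_Integration.integral_sum[OF int] eval)
  finally show "(\<integral>\<omega>. G (snd \<omega>) (\<pi> n \<omega>) \<partial>hist_law lam \<phi> \<pi> x n) = \<dots>" .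
  have "(\<lambda>\<omega>. \<Sum>s\<in>UNIV. \<Sum>a\<in>UNIV. indicator (?A s a) \<omega> * G s a) \<in> borel_measurable (hist_space n)"
    by measurable
  then show m: "(\<lambda>\<omega>. G (snd \<omega>) (\<pi> n \<omega>)) \<in> borel_measurable (hist_space n)"
    by (subst measurable_cong[OF eq])
  have "integrable (hist_law lam \<phi> \<pi> x n) (\<lambda>\<omega>. \<Sum>s\<in>UNIV. \<Sum>a\<in>UNIV. indicator (?A s a) \<omega> * G s a)"
    by (intro Bochner_Integration.integrable_sum int)
  then show "integrable (hist_law lam \<phi> \<pi> x n) (\<lambda>\<omega>. G (snd \<omega>) (\<pi> n \<omega>))"
    by (subst Bochner_Integration.integrable_cong[OF refl eq]) (simp_all add: space_hist_law pi)
qed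

lemma integral_hist_law_0:
  fixes F :: "_ \<Rightarrow> real"
  assumes "F \<in> borel_measurable (hist_space 0)"
  shows "(\<integral>\<omega>. F \<omega> \<partial>hist_law lam \<phi> \<pi> x 0) = F (\<lambda>_. undefined, x)"
  using assms
  by (simp add: integral_return hist_space_def space_pair_measure space_PiM)

text \<open>A discrete Dynkin formula. The conditional mean of each increment depends only on the
  current state and action, so after summation nothing but \<open>occ\<close> is left of the policy.
  Choices of \<open>c\<close> and \<open>u\<close> yield counts, values and state
  probabilities.\<close>

theorem dynkin:
  fixes c :: "'s \<times> 'a \<times> real \<Rightarrow> real" and u :: "'s \<Rightarrow> real"
  assumes pi: "\<pi> \<in> policies"
    and c [measurable]: "c \<in> borel_measurable (count_space UNIV \<Otimes>\<^sub>M (count_space UNIV \<Otimes>\<^sub>M borel))"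
    and C: "\<And>z. \<bar>c z\<bar> \<le> C"
  shows "(\<integral>\<omega>. path_sum n c \<omega> + u (snd \<omega>) \<partial>hist_law lam \<phi> \<pi> x n) =
    u x + (\<Sum>s\<in>UNIV. \<Sum>a\<in>UNIV. occ lam \<phi> \<pi> x n s a *
      ((\<integral>r. c (s, a, r) \<partial>reward_law lam \<phi> s a) + step_mean \<phi> u s a - u s))"
proof (induction n)
  case 0
  show ?case
    by (subst integral_hist_law_0) (auto simp: path_sum_def occ_def)
next
  case (Suc n)
  obtain D where D: "0 \<le> D" "\<And>s. \<bar>u s\<bar> \<le> D" using finite_type_bound[of u] by blast
  let ?cb = "\<lambda>s a. \<integral>r. c (s, a, r) \<partial>reward_law lam \<phi> s a"
  let ?G = "\<lambda>s a. ?cb s a + step_mean \<phi> u s a - u s"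
  let ?m = "\<lambda>n s a. measure (hist_law lam \<phi> \<pi> x n) {\<omega>\<in>space (hist_space n). snd \<omega> = s \<and> \<pi> n \<omega> = a}"
  have bd: "\<bar>path_sum n c \<omega> + u (snd \<omega>)\<bar> \<le> real n * C + D" for n \<omega>
    using path_sum_bound[where c=c and C=C and n=n and \<omega>=\<omega>, OF C] D(2)[of "snd \<omega>"] by linarith
  have m: "(\<lambda>\<omega>. path_sum n c \<omega> + u (snd \<omega>)) \<in> borel_measurable (hist_space n)" for n
    by (intro borel_measurable_add measurable_path_sum c measurable_hist_snd_comp)
  have "(\<integral>\<omega>. path_sum (Suc n) c \<omega> + u (snd \<omega>) \<partial>hist_law lam \<phi> \<pi> x (Suc n)) =
    (\<integral>\<omega>. (\<integral>z. path_sum (Suc n) c z + u (snd z) \<partial>hist_kernel lam \<phi> \<pi> n \<omega>) \<partial>hist_law lam \<phi> \<pi> x n)"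
    by (rule integral_hist_law_Suc[OF pi m bd])
  also have "\<dots> = (\<integral>\<omega>. (path_sum n c \<omega> + u (snd \<omega>)) + ?G (snd \<omega>) (\<pi> n \<omega>) \<partial>hist_law lam \<phi> \<pi> x n)"
  proof (rule Bochner_Integration.integral_cong[OF refl])
    fix \<omega> assume "\<omega> \<in> space (hist_law lam \<phi> \<pi> x n)"
    then have \<omega>: "\<omega> \<in> space (hist_space n)" by (simp add: space_hist_law pi)
    define s a where sa: "s = snd \<omega>" "a = \<pi> n \<omega>"
    interpret A: prob_space "reward_law lam \<phi> s a" by (rule prob_space_reward_law)
    have [measurable]: "(\<lambda>r. c (s, a, r)) \<in> borel_measurable borel"
      by (rule measurable_compose[OF _ c]) simp
    have int: "integrable (reward_law lam \<phi> s a) (\<lambda>r. c (s, a, r))"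
      by (rule A.integrable_const_bound[of _ C]) (auto simp: C)
    have "(\<integral>z. path_sum (Suc n) c z + u (snd z) \<partial>hist_kernel lam \<phi> \<pi> n \<omega>) =
      (\<integral>r. (\<Sum>y\<in>UNIV. pmf (tr \<phi> s a) y * (path_sum n c \<omega> + c (s, a, r) + u y)) \<partial>reward_law lam \<phi> s a)"
      unfolding sa
      by (subst integral_hist_kernel(1)[OF pi m bd \<omega>])
         (simp add: path_sum_update[of n c "fst \<omega>" _ _ "snd \<omega>"])
    also have "\<dots> = (\<integral>r. (path_sum n c \<omega> + step_mean \<phi> u s a) + c (s, a, r) \<partial>reward_law lam \<phi> s a)"
      by (intro Bochner_Integration.integral_cong refl)
         (simp add: distrib_left sum.distrib flip: sum_distrib_right)
    also have "\<dots> = path_sum n c \<omega> + step_mean \<phi> u s a + ?cb s a"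
      using int A.prob_space by (subst Bochner_Integration.integral_add) auto
    finally show "(\<integral>z. path_sum (Suc n) c z + u (snd z) \<partial>hist_kernel lam \<phi> \<pi> n \<omega>) =
      (path_sum n c \<omega> + u (snd \<omega>)) + ?G (snd \<omega>) (\<pi> n \<omega>)"
      by (simp add: sa)
  qed
  also have "\<dots> = (\<integral>\<omega>. path_sum n c \<omega> + u (snd \<omega>) \<partial>hist_law lam \<phi> \<pi> x n) +
       (\<integral>\<omega>. ?G (snd \<omega>) (\<pi> n \<omega>) \<partial>hist_law lam \<phi> \<pi> x n)"
  proof (rule Bochner_Integration.integral_add)
    show "integrable (hist_law lam \<phi> \<pi> x n) (\<lambda>\<omega>. path_sum n c \<omega> + u (snd \<omega>))"
      by (rule integrable_hist_law[OF pi m bd])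
    show "integrable (hist_law lam \<phi> \<pi> x n) (\<lambda>\<omega>. ?G (snd \<omega>) (\<pi> n \<omega>))"
      using integral_state_action(3)[OF pi, where G="?G"] .
  qed
  also have "\<dots> = u x + (\<Sum>s\<in>UNIV. \<Sum>a\<in>UNIV. occ lam \<phi> \<pi> x n s a * ?G s a) + (\<Sum>s\<in>UNIV. \<Sum>a\<in>UNIV. ?m n s a * ?G s a)"
    unfolding Suc using integral_state_action(1)[OF pi, where G="?G"] by simp
  also have "\<dots> = u x + (\<Sum>s\<in>UNIV. \<Sum>a\<in>UNIV. occ lam \<phi> \<pi> x (Suc n) s a * ?G s a)"
    by (simp add: occ_def sum.distrib distrib_right)
  finally show ?case .
qed

corollary integral_state:
  fixes u :: "'s \<Rightarrow> real"
  assumes "\<pi> \<in> policies"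
  shows "(\<integral>\<omega>. u (snd \<omega>) \<partial>hist_law lam \<phi> \<pi> x n) =
    u x + (\<Sum>s\<in>UNIV. \<Sum>a\<in>UNIV. occ lam \<phi> \<pi> x n s a * (step_mean \<phi> u s a - u s))"
  using dynkin[OF assms, where c="\<lambda>_. 0" and C=0 and u=u] by (simp add: path_sum_def)

corollary integral_path_sum:
  assumes "\<pi> \<in> policies"
    and "c \<in> borel_measurable (count_space UNIV \<Otimes>\<^sub>M (count_space UNIV \<Otimes>\<^sub>M borel))"
    and "\<And>z. \<bar>c z\<bar> \<le> C"
  shows "(\<integral>\<omega>. path_sum n c \<omega> \<partial>hist_law lam \<phi> \<pi> x n) =
    (\<Sum>s\<in>UNIV. \<Sum>a\<in>UNIV. occ lam \<phi> \<pi> x n s a * (\<integral>r. c (s, a, r) \<partial>reward_law lam \<phi> s a))"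
  using dynkin[OF assms, where u="\<lambda>_. 0"] by simp

lemma sum_occ:
  assumes pi: "\<pi> \<in> policies"
  shows "(\<Sum>s\<in>UNIV. \<Sum>a\<in>UNIV. occ lam \<phi> \<pi> x n s a) = real n"
proof -
  interpret prob_space "hist_law lam \<phi> \<pi> x n" by (rule prob_space_hist_law) fact
  have "(\<integral>r. 1 \<partial>reward_law lam \<phi> s a) = (1::real)" for s a
    using prob_space.prob_space[OF prob_space_reward_law[of s a]] by simp
  then have "(\<Sum>s\<in>UNIV. \<Sum>a\<in>UNIV. occ lam \<phi> \<pi> x n s a) = (\<integral>\<omega>. path_sum n (\<lambda>_. 1) \<omega> \<partial>hist_law lam \<phi> \<pi> x n)"
    by (subst integral_path_sum[OF pi, of _ 1]) auto
  also have "\<dots> = real n" using prob_space by (simp add: path_sum_def)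
  finally show ?thesis .
qed

text \<open>Outside \<open>[0,1]\<close> the summands of \<open>value_fn\<close> are unbounded; this is what allows replacing rewards by
  their truncations, to which \<open>dynkin\<close> applies.\<close>

lemma AE_rewards_unit:
  assumes pi: "\<pi> \<in> policies"
  shows "AE \<omega> in hist_law lam \<phi> \<pi> x n. \<forall>i<n. snd (snd (fst \<omega> i)) \<in> {0..1}"
proof -
  \<comment> \<open>\<open>?c\<close> flags rewards outside the unit interval. Its path sum has mean
    0 and is nonnegative, so it vanishes almost everywhere.\<close>
  let ?c = "\<lambda>(s::'s, a::'a, r::real). indicator (- {0..1}) r :: real"
  have c: "?c \<in> borel_measurable (count_space UNIV \<Otimes>\<^sub>M (count_space UNIV \<Otimes>\<^sub>M borel))"
    by (rule measurable_step_function) simp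
  have b: "\<bar>?c z\<bar> \<le> 1" for z by (auto simp: indicator_def split: prod.split)
  have 0: "(\<integral>r. ?c (s, a, r) \<partial>reward_law lam \<phi> s a) = 0" for s a
    using AE_reward_law_unit[of s a]
    by (subst integral_eq_zero_AE) (auto simp: indicator_def elim!: eventually_mono)
  have i: "(\<integral>\<omega>. path_sum n ?c \<omega> \<partial>hist_law lam \<phi> \<pi> x n) = 0"
    by (subst integral_path_sum[OF pi c b]) (simp only: 0 mult_zero_right sum.neutral_const)
  have "integrable (hist_law lam \<phi> \<pi> x n) (path_sum n ?c)"
    by (rule integrable_hist_law[OF pi measurable_path_sum[OF c] path_sum_bound[OF b]])
  moreover have nn: "0 \<le> path_sum n ?c \<omega>" for \<omega>
    unfolding path_sum_def by (intro sum_nonneg) (auto split: prod.split)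
  ultimately have "AE \<omega> in hist_law lam \<phi> \<pi> x n. path_sum n ?c \<omega> = 0"
    using i by (subst (asm) integral_nonneg_eq_0_iff_AE) auto
  then show ?thesis
  proof (rule eventually_mono)
    fix \<omega> assume "path_sum n ?c \<omega> = 0"
    then have "\<forall>i\<in>{..<n}. ?c (fst \<omega> i) = 0"
      unfolding path_sum_def by (subst (asm) sum_nonneg_eq_0_iff) (auto split: prod.split)
    then show "\<forall>i<n. snd (snd (fst \<omega> i)) \<in> {0..1}"
      by (auto simp: indicator_def case_prod_beta' split: if_splits)
  qed
qed

section \<open>Values as sums over occupation measures\<close>

lemma mean_reward_clamp:
  "(\<integral>r. max 0 (min 1 r) \<partial>reward_law lam \<phi> s a) = mean_reward lam \<phi> s a"
  unfolding mean_reward_def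
proof (rule integral_cong_AE)
  show "AE r in reward_law lam \<phi> s a. max 0 (min 1 r) = r"
    using AE_reward_law_unit[of s a] by (rule eventually_mono) auto
qed auto

text \<open>\<open>dynkin\<close> wants a bounded cost, so rewards are clamped, which changes their
  sum only on a null set. The last two facts transfer integrability to the raw reward sum in
  \<open>stationary_bias\<close>.\<close>

lemma value_fn_occ:
  assumes pi: "\<pi> \<in> policies"
  shows "value_fn lam \<phi> \<pi> x n = (\<Sum>s\<in>UNIV. \<Sum>a\<in>UNIV. occ lam \<phi> \<pi> x n s a * mean_reward lam \<phi> s a)"
    and "value_fn lam \<phi> \<pi> x n = (\<integral>\<omega>. path_sum n (\<lambda>(s, a, r). max 0 (min 1 r)) \<omega> \<partial>hist_law lam \<phi> \<pi> x n)"
    and "AE \<omega> in hist_law lam \<phi> \<pi> x n. path_sum n (\<lambda>(s, a, r). max 0 (min 1 r)) \<omega> = (\<Sum>i<n. snd (snd (fst \<omega> i)))"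
    and "(\<lambda>\<omega>. \<Sum>i<n. snd (snd (fst \<omega> i))) \<in> borel_measurable (hist_law lam \<phi> \<pi> x n)"
proof -
  let ?c = "\<lambda>(s::'s, a::'a, r::real). max 0 (min 1 r) :: real"
  have c: "?c \<in> borel_measurable (count_space UNIV \<Otimes>\<^sub>M (count_space UNIV \<Otimes>\<^sub>M borel))"
    by (rule measurable_step_function) simp
  have b: "\<bar>?c z\<bar> \<le> 1" for z by (auto split: prod.split)
  have "(\<lambda>z. snd (snd z)) \<in> borel_measurable ((count_space UNIV :: 's measure) \<Otimes>\<^sub>M ((count_space UNIV :: 'a measure) \<Otimes>\<^sub>M borel))"
    by measurable
  then show raw: "(\<lambda>\<omega>. \<Sum>i<n. snd (snd (fst \<omega> i))) \<in> borel_measurable (hist_law lam \<phi> \<pi> x n)"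
    unfolding measurable_hist_law[OF pi]
    by (intro borel_measurable_sum measurable_compose[OF measurable_hist_fst]) simp_all
  show ae: "AE \<omega> in hist_law lam \<phi> \<pi> x n. path_sum n ?c \<omega> = (\<Sum>i<n. snd (snd (fst \<omega> i)))"
    using AE_rewards_unit[OF pi, where x=x and n=n]
    by (rule eventually_mono) (auto simp: path_sum_def case_prod_beta' intro!: sum.cong)
  show "value_fn lam \<phi> \<pi> x n = (\<integral>\<omega>. path_sum n ?c \<omega> \<partial>hist_law lam \<phi> \<pi> x n)"
    unfolding value_fn_def
  proof (rule integral_cong_AE[OF raw])
    show "path_sum n ?c \<in> borel_measurable (hist_law lam \<phi> \<pi> x n)"
      unfolding measurable_hist_law[OF pi] by (rule measurable_path_sum[OF c])
    show "AE \<omega> in hist_law lam \<phi> \<pi> x n. (\<Sum>i<n. snd (snd (fst \<omega> i))) = path_sum n ?c \<omega>"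
      using ae by (rule eventually_mono) simp
  qed
  also have "\<dots> = (\<Sum>s\<in>UNIV. \<Sum>a\<in>UNIV. occ lam \<phi> \<pi> x n s a * mean_reward lam \<phi> s a)"
    by (subst integral_path_sum[OF pi c b]) (simp add: mean_reward_clamp)
  finally show "value_fn lam \<phi> \<pi> x n = \<dots>" .
qed

lemma mean_reward_bounds: "0 \<le> mean_reward lam \<phi> s a" "mean_reward lam \<phi> s a \<le> 1"
proof -
  interpret A: prob_space "reward_law lam \<phi> s a" by (rule prob_space_reward_law)
  have int: "integrable (reward_law lam \<phi> s a) (\<lambda>r. max 0 (min 1 r))"
    by (rule A.integrable_const_bound[of _ 1]) auto
  show "0 \<le> mean_reward lam \<phi> s a"
    unfolding mean_reward_clamp[symmetric] by (rule Bochner_Integration.integral_nonneg) auto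
  have "(\<integral>r. max 0 (min 1 r) \<partial>reward_law lam \<phi> s a) \<le> (\<integral>r. 1 \<partial>reward_law lam \<phi> s a)"
    using int by (intro integral_mono) auto
  then show "mean_reward lam \<phi> s a \<le> 1"
    unfolding mean_reward_clamp[symmetric] using A.prob_space by simp
qed

lemma value_fn_bounds:
  assumes "\<pi> \<in> policies"
  shows "0 \<le> value_fn lam \<phi> \<pi> x n" "value_fn lam \<phi> \<pi> x n \<le> real n"
proof -
  show "0 \<le> value_fn lam \<phi> \<pi> x n"
    unfolding value_fn_occ(1)[OF assms] by (intro sum_nonneg mult_nonneg_nonneg occ_nonneg mean_reward_bounds)
  have "value_fn lam \<phi> \<pi> x n \<le> (\<Sum>s\<in>UNIV. \<Sum>a\<in>UNIV. occ lam \<phi> \<pi> x n s a * 1)"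
    unfolding value_fn_occ(1)[OF assms] by (intro sum_mono mult_left_mono occ_nonneg mean_reward_bounds)
  then show "value_fn lam \<phi> \<pi> x n \<le> real n" by (simp add: sum_occ assms)
qed

lemma value_fn_le_opt_value: "\<pi> \<in> policies \<Longrightarrow> value_fn lam \<phi> \<pi> x n \<le> opt_value lam \<phi> x n"
  unfolding opt_value_def
  by (rule cSUP_upper) (auto intro!: bdd_aboveI[of _ "real n"] value_fn_bounds)

text \<open>A performance difference identity for arbitrary \<open>g\<close> and \<open>h\<close>:
  \<open>sum_occ\<close> spreads \<open>real n * g\<close> over the steps and
  \<open>integral_state\<close> telescopes \<open>h\<close>. Values of stationary policies, the
  upper bound for all policies and the regret bound arise from different choices of \<open>g\<close>
  and \<open>h\<close>.\<close>

lemma value_fn_decomposition: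
  fixes h :: "'s \<Rightarrow> real"
  assumes "\<pi> \<in> policies"
  shows "value_fn lam \<phi> \<pi> x n = real n * g + h x - (\<integral>\<omega>. h (snd \<omega>) \<partial>hist_law lam \<phi> \<pi> x n)
    - (\<Sum>s\<in>UNIV. \<Sum>a\<in>UNIV. occ lam \<phi> \<pi> x n s a * (g + h s - bellman lam \<phi> a h s))"
proof -
  have "real n * g = (\<Sum>s\<in>UNIV. \<Sum>a\<in>UNIV. occ lam \<phi> \<pi> x n s a * g)"
    by (simp add: sum_occ[OF assms, where x=x and n=n, symmetric] flip: sum_distrib_right)
  then show ?thesis
    unfolding integral_state[OF assms] value_fn_occ(1)[OF assms]
    by (simp add: bellman_def algebra_simps sum.distrib sum_subtractf)
qed

lemma integral_state_bound:
  fixes u :: "'s \<Rightarrow> real"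
  assumes "\<pi> \<in> policies" "\<And>s. \<bar>u s\<bar> \<le> D"
  shows "\<bar>\<integral>\<omega>. u (snd \<omega>) \<partial>hist_law lam \<phi> \<pi> x n\<bar> \<le> D"
proof -
  interpret prob_space "hist_law lam \<phi> \<pi> x n" by (rule prob_space_hist_law) fact
  have i: "integrable (hist_law lam \<phi> \<pi> x n) (\<lambda>\<omega>. u (snd \<omega>))"
    by (rule integrable_hist_law[of _ _ _ D]) (use assms in auto)
  have "\<bar>\<integral>\<omega>. u (snd \<omega>) \<partial>hist_law lam \<phi> \<pi> x n\<bar> \<le> (\<integral>\<omega>. \<bar>u (snd \<omega>)\<bar> \<partial>hist_law lam \<phi> \<pi> x n)"
    by (rule integral_abs_bound)
  also have "\<dots> \<le> (\<integral>\<omega>. D \<partial>hist_law lam \<phi> \<pi> x n)"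
    using i assms(2) by (intro integral_mono integrable_abs) auto
  also have "\<dots> = D" using prob_space by simp
  finally show ?thesis .
qed

text \<open>The drift condition bounds the conditional mean after one step by \<open>\<beta>\<close>
  times the current value, whatever the action. With a negative \<open>c\<close> at a single state
  this controls the Laplace transform of the number of visits there.\<close>

lemma exponential_supermartingale:
  fixes u c :: "'s \<Rightarrow> real"
  assumes pi: "\<pi> \<in> policies" and u0: "\<And>s. 0 \<le> u s" and \<beta>: "0 \<le> \<beta>"
    and drift: "\<And>s a. exp (c s) * step_mean \<phi> u s a \<le> \<beta> * u s"
  shows "(\<integral>\<omega>. u (snd \<omega>) * exp (path_sum n (\<lambda>z. c (fst z)) \<omega>) \<partial>hist_law lam \<phi> \<pi> x n) \<le> \<beta> ^ n * u x"
proof (induction n)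
  case 0
  then show ?case by (subst integral_hist_law_0) (auto simp: path_sum_def)
next
  case (Suc n)
  obtain D where D: "0 \<le> D" "\<And>s. \<bar>u s\<bar> \<le> D" using finite_type_bound[of u] by blast
  obtain C where C: "0 \<le> C" "\<And>s. \<bar>c s\<bar> \<le> C" using finite_type_bound[of c] by blast
  let ?S = "\<lambda>n. path_sum n (\<lambda>z. c (fst z) :: real)"
  have cm [measurable]: "(\<lambda>z. c (fst z)) \<in> borel_measurable (count_space UNIV \<Otimes>\<^sub>M (count_space UNIV \<Otimes>\<^sub>M borel))"
    by measurable
  have bS: "\<bar>?S n \<omega>\<bar> \<le> real n * C" for n and \<omega> :: "('s, 'a) hist" using C(2) by (rule path_sum_bound)
  have bd: "\<bar>u (snd \<omega>) * exp (?S n \<omega>)\<bar> \<le> D * exp (real n * C)" for n and \<omega> :: "('s, 'a) hist"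
    using D bS[of n \<omega>] by (auto simp: abs_mult intro!: mult_mono)
  have m: "(\<lambda>\<omega>. u (snd \<omega>) * exp (?S n \<omega>)) \<in> borel_measurable (hist_space n)" for n
    by (intro borel_measurable_times borel_measurable_exp[THEN measurable_compose[rotated]]
        measurable_path_sum cm measurable_hist_snd_comp)
  have ker: "(\<integral>z. u (snd z) * exp (?S (Suc n) z) \<partial>hist_kernel lam \<phi> \<pi> n \<omega>) =
      exp (?S n \<omega>) * (exp (c (snd \<omega>)) * step_mean \<phi> u (snd \<omega>) (\<pi> n \<omega>))"
    if \<omega>: "\<omega> \<in> space (hist_space n)" for \<omega>
  proof -
    define s a where sa: "s = snd \<omega>" "a = \<pi> n \<omega>"
    interpret A: prob_space "reward_law lam \<phi> s a" by (rule prob_space_reward_law)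
    have "(\<integral>z. u (snd z) * exp (?S (Suc n) z) \<partial>hist_kernel lam \<phi> \<pi> n \<omega>) =
      (\<integral>r. (\<Sum>y\<in>UNIV. pmf (tr \<phi> s a) y * (u y * exp (?S n \<omega> + c s))) \<partial>reward_law lam \<phi> s a)"
      unfolding sa
      by (subst integral_hist_kernel(1)[OF pi m bd \<omega>])
         (simp add: path_sum_update[of n "\<lambda>z. c (fst z)" "fst \<omega>" _ _ "snd \<omega>"])
    also have "\<dots> = (\<Sum>y\<in>UNIV. pmf (tr \<phi> s a) y * (u y * exp (?S n \<omega> + c s)))"
      using A.prob_space by simp
    also have "\<dots> = exp (?S n \<omega>) * (exp (c s) * step_mean \<phi> u s a)"
      by (simp add: exp_add sum_distrib_left mult_ac)
    finally show ?thesis by (simp add: sa)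
  qed
  have "(\<integral>\<omega>. u (snd \<omega>) * exp (?S (Suc n) \<omega>) \<partial>hist_law lam \<phi> \<pi> x (Suc n)) =
    (\<integral>\<omega>. (\<integral>z. u (snd z) * exp (?S (Suc n) z) \<partial>hist_kernel lam \<phi> \<pi> n \<omega>) \<partial>hist_law lam \<phi> \<pi> x n)"
    by (rule integral_hist_law_Suc[OF pi m bd])
  also have "\<dots> \<le> (\<integral>\<omega>. \<beta> * (u (snd \<omega>) * exp (?S n \<omega>)) \<partial>hist_law lam \<phi> \<pi> x n)"
  proof (rule integral_mono')
    show "integrable (hist_law lam \<phi> \<pi> x n) (\<lambda>\<omega>. \<beta> * (u (snd \<omega>) * exp (?S n \<omega>)))"
      by (intro integrable_mult_right integrable_hist_law[OF pi m bd])
    fix \<omega> assume "\<omega> \<in> space (hist_law lam \<phi> \<pi> x n)"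
    then have \<omega>: "\<omega> \<in> space (hist_space n)" by (simp add: space_hist_law pi)
    show "(\<integral>z. u (snd z) * exp (?S (Suc n) z) \<partial>hist_kernel lam \<phi> \<pi> n \<omega>) \<le> \<beta> * (u (snd \<omega>) * exp (?S n \<omega>))"
      unfolding ker[OF \<omega>] using mult_left_mono[OF drift[of "snd \<omega>" "\<pi> n \<omega>"], of "exp (?S n \<omega>)"]
      by (simp add: mult_ac)
    show "0 \<le> \<beta> * (u (snd \<omega>) * exp (?S n \<omega>))" using u0 \<beta> by simp
  qed
  also have "\<dots> = \<beta> * (\<integral>\<omega>. u (snd \<omega>) * exp (?S n \<omega>) \<partial>hist_law lam \<phi> \<pi> x n)" by simp
  also have "\<dots> \<le> \<beta> * (\<beta> ^ n * u x)" by (intro mult_left_mono Suc \<beta>)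
  finally show ?case by (simp add: mult_ac)
qed

end

section \<open>Irreducibility\<close>

text \<open>Irreducibility under every stationary policy, phrased by closed sets. It depends on the
  supports of the transitions alone, which suits maximum principles and passes from
  \<open>\<phi>\<close> to \<open>\<psi>\<close> under absolute continuity.
  \<open>ergodic_iff_irreducible\<close> identifies it with \<open>ergodic\<close>.\<close>

definition irreducible_mdp :: "('s, 'a) mdp \<Rightarrow> bool" where
  "irreducible_mdp \<phi> \<longleftrightarrow>
     (\<forall>f B. B \<noteq> {} \<longrightarrow> (\<forall>s\<in>B. set_pmf (tr \<phi> s (f s)) \<subseteq> B) \<longrightarrow> B = UNIV)"

lemma irreducible_mdpD:
  "irreducible_mdp \<phi> \<Longrightarrow> B \<noteq> {} \<Longrightarrow> (\<And>s. s \<in> B \<Longrightarrow> set_pmf (tr \<phi> s (f s)) \<subseteq> B) \<Longrightarrow> B = UNIV"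
  unfolding irreducible_mdp_def by blast

text \<open>Maximum principle: subharmonicity forces every successor of a maximizer to be a
  maximizer, so the maximizers form a closed set.\<close>

lemma subharmonic_constant:
  fixes \<phi> :: "('s::finite, 'a) mdp"
  assumes irr: "irreducible_mdp \<phi>" and sub: "\<And>s. u s \<le> step_mean \<phi> u s (f s)"
  shows "u s = u s'"
proof -
  define m where "m = Max (range u)"
  have le: "u s \<le> m" for s by (simp add: m_def)
  have "m \<in> range u" unfolding m_def by (rule Max_in) auto
  then have ne: "{s. u s = m} \<noteq> {}" by auto
  have "{s. u s = m} = UNIV"
  proof (rule irreducible_mdpD[OF irr ne, of f], clarify)
    fix s y assume s: "m = u s" and y: "y \<in> set_pmf (tr \<phi> s (f s))"
    \<comment> \<open>A mean of nonnegative terms that is at most 0: each term vanishes, so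
      \<open>u\<close> is maximal on the support.\<close>
    have "(\<Sum>y\<in>UNIV. pmf (tr \<phi> s (f s)) y * (m - u y)) = m - step_mean \<phi> u s (f s)"
      by (simp add: right_diff_distrib sum_subtractf flip: sum_distrib_right)
    also have "\<dots> \<le> 0" using sub[of s] s by simp
    finally have "(\<Sum>y\<in>UNIV. pmf (tr \<phi> s (f s)) y * (m - u y)) = 0"
      by (intro antisym sum_nonneg) (auto simp: le)
    then have "pmf (tr \<phi> s (f s)) y * (m - u y) = 0"
      by (subst (asm) sum_nonneg_eq_0_iff) (auto simp: le)
    then show "u y = u s" using y s by (auto simp: set_pmf_iff)
  qed
  then show ?thesis by (metis UNIV_I mem_Collect_eq)
qed

text \<open>Normalizing \<open>h z = 0\<close> turns the Poisson equation into a square linear system in \<open>g\<close> and the other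
  values of \<open>h\<close>; it is injective by \<open>subharmonic_constant\<close>, applied to \<open>h\<close> or \<open>-h\<close> according to the sign
  of \<open>g\<close>.\<close>

lemma poisson_solution_exists:
  fixes \<phi> :: "('s::finite, 'a) mdp" and r :: "'s \<Rightarrow> real"
  assumes irr: "irreducible_mdp \<phi>"
  obtains g h where "\<And>s. g + h s = r s + step_mean \<phi> h s (f s)"
proof -
  fix z :: 's
  \<comment> \<open>As \<open>h z\<close> is fixed to 0, coordinate \<open>z\<close> of the vector
    is free to hold \<open>g\<close>: \<open>H\<close> reads off \<open>h\<close>, and
    \<open>v $ z\<close> reads off \<open>g\<close>.\<close>
  define H :: "real ^ 's \<Rightarrow> 's \<Rightarrow> real" where "H v = (\<lambda>s. if s = z then 0 else v $ s)" for v
  define L :: "real ^ 's \<Rightarrow> real ^ 's"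
    where "L v = (\<chi> s. v $ z + H v s - step_mean \<phi> (H v) s (f s))" for v
  have H_add: "H (v + w) = (\<lambda>s. H v s + H w s)" for v w by (auto simp: H_def)
  have H_scale: "H (c *\<^sub>R v) = (\<lambda>s. c * H v s)" for c v by (auto simp: H_def)
  have lin: "linear L"
    by (rule linearI)
       (simp_all add: L_def vec_eq_iff H_add H_scale sum.distrib sum_distrib_left algebra_simps)
  have "inj L"
    unfolding linear_injective_0[OF lin]
  proof (intro allI impI)
    fix v assume "L v = 0"
    then have eq: "v $ z + H v s = step_mean \<phi> (H v) s (f s)" for s
      by (simp add: L_def vec_eq_iff)
    have "H v s = H v z" for s
    proof (cases "0 \<le> v $ z")
      case True
      then show ?thesis using eq by (intro subharmonic_constant[OF irr, of _ f]) (simp flip: eq)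
    next
      case False
      have "- H v s = - H v z"
      proof (rule subharmonic_constant[OF irr, of "\<lambda>s. - H v s" f])
        fix s
        have "step_mean \<phi> (\<lambda>s. - H v s) s (f s) = - step_mean \<phi> (H v) s (f s)"
          by (simp add: sum_negf)
        then show "- H v s \<le> step_mean \<phi> (\<lambda>s. - H v s) s (f s)"
          using False eq[of s] by linarith
      qed
      then show ?thesis by simp
    qed
    then have H0: "H v s = 0" for s by (simp add: H_def)
    then have "v $ z = 0" using eq[of z] by simp
    moreover have "v $ s = 0" if "s \<noteq> z" for s using H0[of s] that by (simp add: H_def)
    ultimately show "v = 0" by (metis vec_eq_iff zero_index)
  qed
  then have "surj L" using lin linear_injective_imp_surjective by blast
  then obtain v where v: "L v = (\<chi> s. r s)" by (metis surjD)
  then have "v $ z + H v s = r s + step_mean \<phi> (H v) s (f s)" for s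
    by (simp add: L_def vec_eq_iff algebra_simps)
  then show ?thesis by (rule that)
qed

text \<open>\<open>U\<close> is built by enlarging its support: if every state outside \<open>B\<close> had an action that surely stays
  outside \<open>B\<close>, these actions would form a policy avoiding \<open>z\<close>. So some new state reaches \<open>B\<close> under every
  action and can be given a small positive value.\<close>

lemma lyapunov_function_exists:
  fixes \<phi> :: "('s::finite, 'a::finite) mdp"
  assumes irr: "irreducible_mdp \<phi>"
  obtains U where "\<And>s. 0 < U s" "\<And>s a. s \<noteq> z \<Longrightarrow> U s < step_mean \<phi> U s a"
proof -
  define Q where "Q B \<longleftrightarrow> z \<in> B \<and> (\<exists>U. (\<forall>s\<in>B. 0 < U s) \<and> (\<forall>s. s \<notin> B \<longrightarrow> U s = 0) \<and>
     (\<forall>s\<in>B - {z}. \<forall>a. U s < step_mean \<phi> U s a))" for B :: "'s set"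
  have Qz: "Q {z}" unfolding Q_def
    by (intro conjI exI[of _ "\<lambda>s. if s = z then 1 else 0"]) auto
  have grow: "\<exists>s. s \<notin> B \<and> Q (insert s B)" if Q: "Q B" and B: "B \<noteq> UNIV" for B
  proof -
    from Q obtain U where U: "z \<in> B" "\<And>s. s \<in> B \<Longrightarrow> 0 < U s" "\<And>s. s \<notin> B \<Longrightarrow> U s = 0"
      "\<And>s a. s \<in> B \<Longrightarrow> s \<noteq> z \<Longrightarrow> U s < step_mean \<phi> U s a"
      unfolding Q_def by blast
    have U0: "0 \<le> U s" for s using U(2,3)[of s] by (cases "s \<in> B") auto
    have "\<exists>s. s \<notin> B \<and> (\<forall>a. \<not> set_pmf (tr \<phi> s a) \<subseteq> - B)"
    proof (rule ccontr)
      assume "\<not> ?thesis"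
      then have "\<forall>s. \<exists>a. s \<notin> B \<longrightarrow> set_pmf (tr \<phi> s a) \<subseteq> - B" by blast
      then obtain f where "\<And>s. s \<notin> B \<Longrightarrow> set_pmf (tr \<phi> s (f s)) \<subseteq> - B" by metis
      then have "- B = UNIV" using B by (intro irreducible_mdpD[OF irr, of _ f]) auto
      then show False using \<open>z \<in> B\<close> by auto
    qed
    then obtain s where s: "s \<notin> B" "\<And>a. \<not> set_pmf (tr \<phi> s a) \<subseteq> - B" by blast
    have pos: "0 < step_mean \<phi> U s a" for a
    proof -
      from s(2)[of a] obtain y where y: "y \<in> set_pmf (tr \<phi> s a)" "y \<in> B" by auto
      then have "0 < pmf (tr \<phi> s a) y * U y" using U(2) by (simp add: pmf_positive)
      also have "\<dots> \<le> step_mean \<phi> U s a"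
        by (rule member_le_sum) (auto simp: U0)
      finally show ?thesis .
    qed
    \<comment> \<open>Half of the least mean of \<open>U\<close> over the actions at
      \<open>s\<close>, so the strict inequality at \<open>s\<close> holds for each action. Since
      \<open>U s\<close> was 0, the new value can only raise means, and the inequalities on
      \<open>B\<close> survive (\<open>mono\<close>).\<close>
    define \<epsilon> where "\<epsilon> = Min (range (step_mean \<phi> U s)) / 2"
    have "0 < Min (range (step_mean \<phi> U s))" using pos by (subst Min_gr_iff) auto
    moreover have "Min (range (step_mean \<phi> U s)) \<le> step_mean \<phi> U s a" for a by simp
    ultimately have \<epsilon>: "0 < \<epsilon>" "\<epsilon> < step_mean \<phi> U s a" for a
      unfolding \<epsilon>_def by (auto simp: field_simps intro: less_le_trans[of _ "Min (range (step_mean \<phi> U s)) * 2"])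
    define U' where "U' = U(s := \<epsilon>)"
    have mono: "step_mean \<phi> U t a \<le> step_mean \<phi> U' t a" for t a
      using \<epsilon> U(3)[OF s(1)] by (intro sum_mono mult_left_mono) (auto simp: U'_def)
    have "Q (insert s B)" unfolding Q_def
    proof (intro conjI exI[of _ U'] ballI allI impI)
      show "z \<in> insert s B" using U(1) by simp
      show "0 < U' t" if "t \<in> insert s B" for t using that \<epsilon> U(2) by (auto simp: U'_def)
      show "U' t = 0" if "t \<notin> insert s B" for t using that U(3) by (auto simp: U'_def)
      show "U' t < step_mean \<phi> U' t a" if "t \<in> insert s B - {z}" for t a
        using that mono[of t a] \<epsilon>(2)[of a] U(4)[of t a] by (auto simp: U'_def)
    qed
    with s(1) show ?thesis by blast
  qed
  \<comment> \<open>Each enlargement adds one state, so counting up to the size of the type turns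
    \<open>B\<close> into the whole type.\<close>
  have "\<exists>B. Q B \<and> card B = n" if "1 \<le> n" "n \<le> card (UNIV :: 's set)" for n
    using that
  proof (induction n rule: dec_induct)
    case base then show ?case using Qz by (intro exI[of _ "{z}"]) auto
  next
    case (step n)
    then obtain B where B: "Q B" "card B = n" by auto
    then have "B \<noteq> UNIV" using step by auto
    then obtain s where "s \<notin> B" "Q (insert s B)" using grow[OF B(1)] by blast
    then show ?case using B by (intro exI[of _ "insert s B"]) (auto simp: card_insert_if)
  qed
  moreover have "1 \<le> card (UNIV :: 's set)" by (simp add: Suc_leI card_gt_0_iff)
  ultimately obtain B where B: "Q B" "card B = card (UNIV :: 's set)" by blast
  then have "B = UNIV" by (intro card_subset_eq) auto
  with B(1) obtain U where "\<forall>s. 0 < U s" "\<forall>s. s \<noteq> z \<longrightarrow> (\<forall>a. U s < step_mean \<phi> U s a)"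
    unfolding Q_def by auto
  then show ?thesis using that by blast
qed

text \<open>\<open>W\<close> is \<open>U\<close> turned upside down and shifted to stay at least 1.
  Off \<open>z\<close> its mean decreases strictly, by finiteness with a common factor below 1; at
  \<open>z\<close> it may increase, and the discount \<open>exp (- \<kappa>)\<close>
  compensates.\<close>

lemma geometric_drift_exists:
  fixes \<phi> :: "('s::finite, 'a::finite) mdp"
  assumes irr: "irreducible_mdp \<phi>"
  obtains W \<beta> \<kappa> where "\<And>s. 1 \<le> W s" "0 < \<beta>" "\<beta> < (1::real)" "0 < \<kappa>"
    "\<And>s a. exp (- \<kappa> * indicator {z} s) * step_mean \<phi> W s a \<le> \<beta> * W s"
proof -
  obtain U where U: "\<And>s. 0 < U s" "\<And>s a. s \<noteq> z \<Longrightarrow> U s < step_mean \<phi> U s a"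
    using lyapunov_function_exists[OF irr] by blast
  obtain D where D: "0 \<le> D" "\<And>s. \<bar>U s\<bar> \<le> D" using finite_type_bound[of U] by blast
  define W where "W s = D + 1 - U s" for s
  have W: "1 \<le> W s" "W s \<le> D + 1" for s using D(2)[of s] U(1)[of s] by (auto simp: W_def)
  have PW: "step_mean \<phi> W s a = D + 1 - step_mean \<phi> U s a" for s a
    by (simp add: W_def right_diff_distrib sum_subtractf distrib_left sum.distrib flip: sum_distrib_right)
  \<comment> \<open>The extra \<open>1/2\<close> keeps \<open>\<beta>\<close> positive, and
    \<open>R\<close> nonempty if \<open>z\<close> is the only state.\<close>
  define R where "R = insert (1/2) ((\<lambda>(s, a). step_mean \<phi> W s a / W s) ` ((- {z}) \<times> UNIV))"
  define \<beta> where "\<beta> = Max R"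
  have fin: "finite R" "R \<noteq> {}" by (auto simp: R_def)
  have \<beta>1: "\<beta> < 1" unfolding \<beta>_def
  proof (subst Max_less_iff[OF fin], rule ballI)
    fix q assume "q \<in> R"
    then consider "q = 1/2" | s a where "s \<noteq> z" "q = step_mean \<phi> W s a / W s" by (auto simp: R_def)
    then show "q < 1"
    proof cases
      case 2
      have "step_mean \<phi> W s a < W s" unfolding PW using U(2)[OF 2(1), of a] by (simp add: W_def)
      then show ?thesis using W(1)[of s] 2 by (simp add: divide_less_eq)
    qed simp
  qed
  have "1/2 \<le> \<beta>" unfolding \<beta>_def using fin by (intro Max_ge) (auto simp: R_def)
  then have \<beta>0: "0 < \<beta>" by simp
  \<comment> \<open>\<open>D + 1\<close> bounds \<open>W\<close>, so this discount brings any mean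
    at \<open>z\<close> down to at most \<open>\<beta>\<close>, hence to at most
    \<open>\<beta> * W s\<close>.\<close>
  define \<kappa> where "\<kappa> = ln ((D + 1) / \<beta>)"
  have "1 < (D + 1) / \<beta>" using D(1) \<beta>0 \<beta>1 by (simp add: less_divide_eq)
  then have \<kappa>: "0 < \<kappa>" "exp (- \<kappa>) * (D + 1) = \<beta>"
    using \<beta>0 D(1) by (auto simp: \<kappa>_def exp_minus)
  have "exp (- \<kappa> * indicator {z} s) * step_mean \<phi> W s a \<le> \<beta> * W s" for s a
  proof (cases "s = z")
    case True
    have "step_mean \<phi> W s a \<le> step_mean \<phi> (\<lambda>_. D + 1) s a" by (intro sum_mono mult_left_mono W) auto
    then have "step_mean \<phi> W s a \<le> D + 1" by (simp only: step_mean_const)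
    then have "exp (- \<kappa>) * step_mean \<phi> W s a \<le> exp (- \<kappa>) * (D + 1)" by (intro mult_left_mono) auto
    also have "\<dots> \<le> \<beta> * W s" unfolding \<kappa> using \<beta>0 W(1)[of s] by (simp add: mult_le_cancel_left1)
    finally show ?thesis using True by simp
  next
    case False
    then have "step_mean \<phi> W s a / W s \<le> \<beta>" unfolding \<beta>_def using fin
      by (intro Max_ge) (auto simp: R_def intro!: image_eqI[of _ _ "(s, a)"])
    then show ?thesis using False W(1)[of s] by (simp add: divide_le_eq split: if_splits)
  qed
  with W(1) \<beta>0 \<beta>1 \<kappa>(1) show ?thesis by (rule that)
qed

section \<open>Ergodicity in terms of closed sets\<close>

context mdp_model
begin

lemma integral_state_Suc:
  fixes u :: "'s \<Rightarrow> real"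
  assumes pi: "\<pi> \<in> policies"
  shows "(\<integral>\<omega>. u (snd \<omega>) \<partial>hist_law lam \<phi> \<pi> x (Suc n)) =
    (\<integral>\<omega>. step_mean \<phi> u (snd \<omega>) (\<pi> n \<omega>) \<partial>hist_law lam \<phi> \<pi> x n)"
proof -
  let ?m = "\<lambda>s a. measure (hist_law lam \<phi> \<pi> x n) {\<omega>\<in>space (hist_space n). snd \<omega> = s \<and> \<pi> n \<omega> = a}"
  have "(\<integral>\<omega>. u (snd \<omega>) \<partial>hist_law lam \<phi> \<pi> x (Suc n)) =
     (\<integral>\<omega>. u (snd \<omega>) \<partial>hist_law lam \<phi> \<pi> x n) + (\<Sum>s\<in>UNIV. \<Sum>a\<in>UNIV. ?m s a * (step_mean \<phi> u s a - u s))"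
    unfolding integral_state[OF pi] by (simp add: occ_def distrib_right sum.distrib)
  also have "(\<integral>\<omega>. u (snd \<omega>) \<partial>hist_law lam \<phi> \<pi> x n) = (\<Sum>s\<in>UNIV. \<Sum>a\<in>UNIV. ?m s a * u s)"
    using integral_state_action(1)[OF pi, where G="\<lambda>s a. u s"] .
  also have "\<dots> + (\<Sum>s\<in>UNIV. \<Sum>a\<in>UNIV. ?m s a * (step_mean \<phi> u s a - u s)) =
      (\<Sum>s\<in>UNIV. \<Sum>a\<in>UNIV. ?m s a * step_mean \<phi> u s a)"
    by (simp add: right_diff_distrib sum_subtractf)
  also have "\<dots> = (\<integral>\<omega>. step_mean \<phi> u (snd \<omega>) (\<pi> n \<omega>) \<partial>hist_law lam \<phi> \<pi> x n)"
    using integral_state_action(1)[OF pi, where G="step_mean \<phi> u"] by simp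
  finally show ?thesis .
qed

lemma occ_stationary_eq_0: "a \<noteq> f s \<Longrightarrow> occ lam \<phi> (stationary f) x n s a = 0"
proof -
  assume "a \<noteq> f s"
  then have "{\<omega> \<in> space (hist_space i). snd \<omega> = s \<and> stationary f i \<omega> = a} = {}" for i
    by (auto simp: stationary_def)
  then show ?thesis by (simp only: occ_def measure_empty sum.neutral_const)
qed

lemma sum_occ_stationary:
  "(\<Sum>s\<in>UNIV. \<Sum>a\<in>UNIV. occ lam \<phi> (stationary f) x n s a * G s a) =
   (\<Sum>s\<in>UNIV. occ lam \<phi> (stationary f) x n s (f s) * G s (f s))"
proof (rule sum.cong[OF refl])
  fix s
  have "(\<Sum>a\<in>UNIV. occ lam \<phi> (stationary f) x n s a * G s a) =
     (\<Sum>a\<in>UNIV. if a = f s then occ lam \<phi> (stationary f) x n s (f s) * G s (f s) else 0)"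
    by (intro sum.cong refl) (auto simp: occ_stationary_eq_0)
  then show "(\<Sum>a\<in>UNIV. occ lam \<phi> (stationary f) x n s a * G s a) =
     occ lam \<phi> (stationary f) x n s (f s) * G s (f s)" by simp
qed

lemma prob_state:
  assumes pi: "\<pi> \<in> policies"
  shows "\<P>(\<omega> in hist_law lam \<phi> \<pi> x n. snd \<omega> = y) = (\<integral>\<omega>. indicator {y} (snd \<omega>) \<partial>hist_law lam \<phi> \<pi> x n)"
proof -
  interpret prob_space "hist_law lam \<phi> \<pi> x n" by (rule prob_space_hist_law) fact
  have "{\<omega>\<in>space (hist_space n). snd \<omega> = y} \<in> sets (hist_space n)" by measurable
  then have "{\<omega>\<in>space (hist_law lam \<phi> \<pi> x n). snd \<omega> = y} \<in> events"
    by (simp add: sets_hist_law pi space_hist_law)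
  then have "\<P>(\<omega> in hist_law lam \<phi> \<pi> x n. snd \<omega> = y) =
      (\<integral>\<omega>. indicator {\<omega>\<in>space (hist_law lam \<phi> \<pi> x n). snd \<omega> = y} \<omega> \<partial>hist_law lam \<phi> \<pi> x n)"
    by simp
  also have "\<dots> = (\<integral>\<omega>. indicator {y} (snd \<omega>) \<partial>hist_law lam \<phi> \<pi> x n)"
    by (intro Bochner_Integration.integral_cong) (auto simp: indicator_def)
  finally show ?thesis .
qed

text \<open>From left to right: started in a closed set \<open>B\<close>, the probability of its
  complement stays 0, since the indicator of the complement has nonpositive drift. From right to
  left: the states reached with positive probability form a closed set.\<close>

lemma ergodic_iff_irreducible: "ergodic lam \<phi> \<longleftrightarrow> irreducible_mdp \<phi>"
proof
  assume erg: "ergodic lam \<phi>"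
  show "irreducible_mdp \<phi>"
    unfolding irreducible_mdp_def
  proof (intro allI impI)
    fix f B assume "B \<noteq> {}" and closed: "\<forall>s\<in>B. set_pmf (tr \<phi> s (f s)) \<subseteq> B"
    then obtain x where x: "x \<in> B" by auto
    have "y \<in> B" for y
    proof (rule ccontr)
      assume y: "y \<notin> B"
      let ?u = "indicator (- B) :: 's \<Rightarrow> real"
      have drift: "step_mean \<phi> ?u s (f s) - ?u s \<le> 0" for s
      proof (cases "s \<in> B")
        case True
        then have "pmf (tr \<phi> s (f s)) y * ?u y = 0" for y
          using closed by (auto simp: indicator_def pmf_eq_0_set_pmf)
        then have "step_mean \<phi> ?u s (f s) = 0" by (intro sum.neutral) blast
        then show ?thesis by simp
      next
        case False
        have "step_mean \<phi> ?u s (f s) \<le> step_mean \<phi> (\<lambda>_. 1) s (f s)"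
          by (intro sum_mono mult_left_mono) (auto simp: indicator_def)
        then show ?thesis using False by (simp only: step_mean_const) simp
      qed
      have E: "(\<integral>\<omega>. ?u (snd \<omega>) \<partial>hist_law lam \<phi> (stationary f) x n) \<le> 0" for n
      proof -
        have "(\<Sum>s\<in>UNIV. occ lam \<phi> (stationary f) x n s (f s) * (step_mean \<phi> ?u s (f s) - ?u s)) \<le> 0"
          by (rule sum_nonpos, rule mult_nonneg_nonpos, rule occ_nonneg, rule drift)
        then show ?thesis
          using x unfolding integral_state[OF stationary_in_policies] sum_occ_stationary by (simp del: sum_mult_indicator)
      qed
      obtain n where n: "\<P>(\<omega> in hist_law lam \<phi> (stationary f) x n. snd \<omega> = y) > 0"
        using erg unfolding ergodic_def by blast
      have "\<P>(\<omega> in hist_law lam \<phi> (stationary f) x n. snd \<omega> = y) \<le>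
          (\<integral>\<omega>. ?u (snd \<omega>) \<partial>hist_law lam \<phi> (stationary f) x n)"
        unfolding prob_state[OF stationary_in_policies]
      proof (rule integral_mono)
        have "integrable (hist_law lam \<phi> (stationary f) x n) (\<lambda>\<omega>. indicator A (snd \<omega>) :: real)" for A
          by (rule integrable_hist_law[of _ _ _ 1]) (auto simp: indicator_def)
        then show "integrable (hist_law lam \<phi> (stationary f) x n) (\<lambda>\<omega>. indicator {y} (snd \<omega>) :: real)"
          "integrable (hist_law lam \<phi> (stationary f) x n) (\<lambda>\<omega>. ?u (snd \<omega>))" by blast+
      qed (use y in \<open>auto simp: indicator_def\<close>)
      then show False using n E[of n] by linarith
    qed
    then show "B = UNIV" by auto
  qed
next
  assume irr: "irreducible_mdp \<phi>"
  show "ergodic lam \<phi>"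
    unfolding ergodic_def
  proof (intro allI)
    fix f x y
    let ?\<pi> = "stationary f :: ('s, 'a) policy"
    let ?p = "\<lambda>n y. \<P>(\<omega> in hist_law lam \<phi> ?\<pi> x n. snd \<omega> = y)"
    have "{y. \<exists>n. ?p n y > 0} = UNIV"
    proof (rule irreducible_mdpD[OF irr, of _ f])
      have "?p 0 x = 1"
        unfolding prob_state[OF stationary_in_policies] by (subst integral_hist_law_0) auto
      then have "?p 0 x > 0" by linarith
      then show "{y. \<exists>n. ?p n y > 0} \<noteq> {}" by blast
      show "set_pmf (tr \<phi> s (f s)) \<subseteq> {y. \<exists>n. ?p n y > 0}" if s: "s \<in> {y. \<exists>n. ?p n y > 0}" for s
      proof (rule subsetI, rule CollectI)
        fix t assume t: "t \<in> set_pmf (tr \<phi> s (f s))"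
        from s obtain n where n: "?p n s > 0" by auto
        have "0 < pmf (tr \<phi> s (f s)) t * ?p n s" using n t by (simp add: pmf_positive)
        also have "\<dots> = (\<integral>\<omega>. pmf (tr \<phi> s (f s)) t * indicator {s} (snd \<omega>) \<partial>hist_law lam \<phi> ?\<pi> x n)"
          unfolding prob_state[OF stationary_in_policies] by simp
        also have "\<dots> \<le> (\<integral>\<omega>. step_mean \<phi> (indicator {t}) (snd \<omega>) (?\<pi> n \<omega>) \<partial>hist_law lam \<phi> ?\<pi> x n)"
        proof (rule integral_mono)
          show "integrable (hist_law lam \<phi> ?\<pi> x n) (\<lambda>\<omega>. pmf (tr \<phi> s (f s)) t * indicator {s} (snd \<omega>))"
            by (rule integrable_hist_law[of _ _ _ 1]) (auto simp: indicator_def pmf_le_1)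
          show "integrable (hist_law lam \<phi> ?\<pi> x n) (\<lambda>\<omega>. step_mean \<phi> (indicator {t}) (snd \<omega>) (?\<pi> n \<omega>))"
            using integral_state_action(3)[OF stationary_in_policies, where G="step_mean \<phi> (indicator {t})"] by simp
          show "pmf (tr \<phi> s (f s)) t * indicator {s} (snd \<omega>) \<le> step_mean \<phi> (indicator {t}) (snd \<omega>) (?\<pi> n \<omega>)" for \<omega>
          proof (cases "snd \<omega> = s")
            case True
            then have [simp]: "?\<pi> n \<omega> = f s" by (auto simp: stationary_def case_prod_beta')
            have "pmf (tr \<phi> s (f s)) t * indicator {t} t \<le> step_mean \<phi> (indicator {t}) s (f s)"
              by (rule member_le_sum) auto
            then show ?thesis using True by simp
          qed (auto intro!: sum_nonneg)
        qed
        also have "\<dots> = ?p (Suc n) t"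
          unfolding prob_state[OF stationary_in_policies] integral_state_Suc[OF stationary_in_policies] ..
        finally show "\<exists>n. ?p n t > 0" by blast
      qed
    qed
    then show "\<exists>n. ?p n y > 0" by auto
  qed
qed

end

section \<open>Average-reward optimality\<close>

lemma tendsto_linear_over_n:
  fixes b :: "nat \<Rightarrow> real"
  assumes "\<And>n. \<bar>v n - real n * g\<bar> \<le> D"
  shows "(\<lambda>n. v n / real n) \<longlonglongrightarrow> g"
proof -
  have "(\<lambda>n. v n / real n - g) \<longlonglongrightarrow> 0"
  proof (rule Lim_null_comparison)
    show "\<forall>\<^sub>F n in sequentially. norm (v n / real n - g) \<le> D / real n"
    proof (rule eventually_sequentiallyI[of 1])
      fix n :: nat assume n: "1 \<le> n"
      then have "v n / real n - g = (v n - real n * g) / real n" by (simp add: field_simps)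
      then show "norm (v n / real n - g) \<le> D / real n"
        using assms[of n] n by (simp add: divide_right_mono)
    qed
    show "(\<lambda>n. D / real n) \<longlonglongrightarrow> 0"
      by (intro tendsto_divide_0[OF tendsto_const] filterlim_at_top_imp_at_infinity filterlim_real_sequentially)
  qed
  then show ?thesis by (rule LIM_zero_cancel)
qed

context mdp_model
begin

text \<open>Under \<open>stationary f\<close> only pairs \<open>(s, f s)\<close> are occupied, and
  there the defect in \<open>value_fn_decomposition\<close> vanishes.\<close>

lemma stationary_value:
  assumes "\<And>s. g + h s = bellman lam \<phi> (f s) h s"
  shows "value_fn lam \<phi> (stationary f) x n =
    real n * g + h x - (\<integral>\<omega>. h (snd \<omega>) \<partial>hist_law lam \<phi> (stationary f) x n)"
proof -
  have "(\<Sum>s\<in>UNIV. \<Sum>a\<in>UNIV. occ lam \<phi> (stationary f) x n s a * (g + h s - bellman lam \<phi> a h s)) = 0"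
    unfolding sum_occ_stationary using assms by simp
  then show ?thesis by (subst value_fn_decomposition[of _ x n g h]) auto
qed

lemma stationary_gain:
  assumes "\<And>s. g + h s = bellman lam \<phi> (f s) h s"
  shows "(\<lambda>n. value_fn lam \<phi> (stationary f) x n / real n) \<longlonglongrightarrow> g"
    and "gain lam \<phi> (stationary f) x = g"
proof -
  obtain D where D: "0 \<le> D" "\<And>s. \<bar>h s\<bar> \<le> D" using finite_type_bound[of h] by blast
  show lim: "(\<lambda>n. value_fn lam \<phi> (stationary f) x n / real n) \<longlonglongrightarrow> g"
  proof (rule tendsto_linear_over_n)
    show "\<bar>value_fn lam \<phi> (stationary f) x n - real n * g\<bar> \<le> 2 * D" for n
      unfolding stationary_value[OF assms]
      using D(2)[of x] integral_state_bound[where \<pi>="stationary f" and x=x and n=n and u=h, OF stationary_in_policies D(2)]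
      by linarith
  qed
  then show "gain lam \<phi> (stationary f) x = g" unfolding gain_def by (rule limI)
qed

text \<open>The chain may be periodic, so only averages converge. They telescope along a solution of the Poisson
  equation with reward \<open>u\<close>.\<close>

lemma cesaro_state:
  assumes irr: "irreducible_mdp \<phi>"
  obtains \<gamma> where "\<And>x. (\<lambda>N. (\<Sum>n=1..N. \<integral>\<omega>. u (snd \<omega>) \<partial>hist_law lam \<phi> (stationary f) x n) / real N) \<longlonglongrightarrow> (\<gamma> :: real)"
proof -
  obtain \<gamma> k where k: "\<And>s. \<gamma> + k s = u s + step_mean \<phi> k s (f s)"
    using poisson_solution_exists[OF irr, of u f] by blast
  obtain D where D: "0 \<le> D" "\<And>s. \<bar>k s\<bar> \<le> D" using finite_type_bound[of k] by blast
  let ?E = "\<lambda>u x n. \<integral>\<omega>. u (snd \<omega>) \<partial>hist_law lam \<phi> (stationary f) x n"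
  have int: "integrable (hist_law lam \<phi> (stationary f) x n) (\<lambda>\<omega>. v (snd \<omega>))" for v :: "'s \<Rightarrow> real" and x n
  proof -
    obtain D where "\<And>s. \<bar>v s\<bar> \<le> D" using finite_type_bound[of v] by blast
    then show ?thesis by (intro integrable_hist_law[where B=D]) auto
  qed
  have step: "?E k x (Suc n) = \<gamma> + ?E k x n - ?E u x n" for x n
  proof -
    interpret prob_space "hist_law lam \<phi> (stationary f) x n" by (rule prob_space_hist_law) simp
    have "?E k x (Suc n) = (\<integral>\<omega>. step_mean \<phi> k (snd \<omega>) (stationary f n \<omega>) \<partial>hist_law lam \<phi> (stationary f) x n)"
      by (rule integral_state_Suc) simp
    also have "\<dots> = (\<integral>\<omega>. \<gamma> + k (snd \<omega>) - u (snd \<omega>) \<partial>hist_law lam \<phi> (stationary f) x n)"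
      by (intro Bochner_Integration.integral_cong) (auto simp: stationary_def k)
    also have "\<dots> = \<gamma> + ?E k x n - ?E u x n"
      using int prob_space by simp
    finally show ?thesis .
  qed
  \<comment> \<open>The sum starts at 1, hence boundary terms at 1 and \<open>Suc N\<close>.\<close>
  have sum: "(\<Sum>n=1..N. ?E u x n) = real N * \<gamma> + ?E k x 1 - ?E k x (Suc N)" for x N
  proof (induction N)
    case (Suc N)
    then show ?case using step[of x "Suc N"] by (simp add: algebra_simps)
  qed simp
  have "(\<lambda>N. (\<Sum>n=1..N. ?E u x n) / real N) \<longlonglongrightarrow> \<gamma>" for x
  proof (rule tendsto_linear_over_n)
    have b: "\<bar>?E k x n\<bar> \<le> D" for n
      by (rule integral_state_bound[OF stationary_in_policies D(2)])
    show "\<bar>(\<Sum>n=1..N. ?E u x n) - real N * \<gamma>\<bar> \<le> 2 * D" for N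
      using b[of 1] b[of "Suc N"] unfolding sum by linarith
  qed
  then show ?thesis by (rule that)
qed

text \<open>The bias is a Poisson solution \<open>h\<close> shifted by a constant: the excess reward
  up to \<open>T\<close> has mean \<open>h x\<close> minus the mean of \<open>h\<close> at the
  current state, and the Cesaro limit of the latter does not depend on \<open>x\<close>. A shift
  leaves the Poisson equation valid.\<close>

lemma stationary_bias:
  assumes irr: "irreducible_mdp \<phi>"
  obtains g where "\<And>s. gain lam \<phi> (stationary f) s = g"
    "\<And>s. g + bias lam \<phi> f s = bellman lam \<phi> (f s) (bias lam \<phi> f) s"
proof -
  obtain g h where gh: "\<And>s. g + h s = mean_reward lam \<phi> s (f s) + step_mean \<phi> h s (f s)"
    using poisson_solution_exists[OF irr, of "\<lambda>s. mean_reward lam \<phi> s (f s)" f] by blast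
  then have B: "g + h s = bellman lam \<phi> (f s) h s" for s by (simp add: bellman_def)
  have gain: "gain lam \<phi> (stationary f) s = g" for s by (rule stationary_gain(2)[OF B])
  obtain \<gamma> where \<gamma>: "\<And>x. (\<lambda>N. (\<Sum>n=1..N. \<integral>\<omega>. h (snd \<omega>) \<partial>hist_law lam \<phi> (stationary f) x n) / real N) \<longlonglongrightarrow> \<gamma>"
    using cesaro_state[OF irr, where u=h and f=f] by blast
  have excess: "(\<integral>\<omega>. (\<Sum>i<T. snd (snd (fst \<omega> i)) - gain lam \<phi> (stationary f) (fst (fst \<omega> i)))
       \<partial>hist_law lam \<phi> (stationary f) x T) =
      h x - (\<integral>\<omega>. h (snd \<omega>) \<partial>hist_law lam \<phi> (stationary f) x T)" for x T
  proof -
    interpret prob_space "hist_law lam \<phi> (stationary f) x T" by (rule prob_space_hist_law) simp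
    let ?c = "\<lambda>(s::'s, a::'a, r::real). max 0 (min 1 r) :: real"
    have pi: "stationary f \<in> policies" by simp
    \<comment> \<open>The raw reward sum is bounded only almost everywhere, so its integrability is
      borrowed from the clamped sum.\<close>
    have "integrable (hist_law lam \<phi> (stationary f) x T) (path_sum T ?c)"
    proof (rule integrable_hist_law[OF pi])
      show "path_sum T ?c \<in> borel_measurable (hist_space T)"
        by (intro measurable_path_sum measurable_step_function) simp
      show "\<bar>path_sum T ?c \<omega>\<bar> \<le> real T * 1" for \<omega>
        by (rule path_sum_bound) (auto split: prod.split)
    qed
    then have int: "integrable (hist_law lam \<phi> (stationary f) x T) (\<lambda>\<omega>. \<Sum>i<T. snd (snd (fst \<omega> i)))"
      using integrable_cong_AE[OF borel_measurable_integrable value_fn_occ(4)[OF pi] value_fn_occ(3)[OF pi]] by blast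
    have "(\<integral>\<omega>. (\<Sum>i<T. snd (snd (fst \<omega> i)) - gain lam \<phi> (stationary f) (fst (fst \<omega> i))) \<partial>hist_law lam \<phi> (stationary f) x T)
      = (\<integral>\<omega>. (\<Sum>i<T. snd (snd (fst \<omega> i))) - real T * g \<partial>hist_law lam \<phi> (stationary f) x T)"
      by (simp add: gain sum_subtractf)
    also have "\<dots> = value_fn lam \<phi> (stationary f) x T - real T * g"
      unfolding value_fn_def using int prob_space by simp
    also have "\<dots> = h x - (\<integral>\<omega>. h (snd \<omega>) \<partial>hist_law lam \<phi> (stationary f) x T)"
      unfolding stationary_value[OF B] by simp
    finally show ?thesis .
  qed
  have bias: "bias lam \<phi> f x = h x - \<gamma>" for x
    unfolding bias_def cesaro_lim_def excess
  proof (rule limI, rule Lim_transform_eventually)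
    show "(\<lambda>N. h x - (\<Sum>n=1..N. \<integral>\<omega>. h (snd \<omega>) \<partial>hist_law lam \<phi> (stationary f) x n) / real N) \<longlonglongrightarrow> h x - \<gamma>"
      by (intro tendsto_diff tendsto_const \<gamma>)
    show "\<forall>\<^sub>F N in sequentially. h x - (\<Sum>n=1..N. \<integral>\<omega>. h (snd \<omega>) \<partial>hist_law lam \<phi> (stationary f) x n) / real N
       = (\<Sum>T=1..N. h x - (\<integral>\<omega>. h (snd \<omega>) \<partial>hist_law lam \<phi> (stationary f) x T)) / real N"
      by (rule eventually_sequentiallyI[of 1]) (simp add: sum_subtractf field_simps)
  qed
  have "bellman lam \<phi> (f s) (bias lam \<phi> f) s = bellman lam \<phi> (f s) h s - \<gamma>" for s
    by (simp add: bellman_def bias right_diff_distrib sum_subtractf flip: sum_distrib_right)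
  then have "g + bias lam \<phi> f s = bellman lam \<phi> (f s) (bias lam \<phi> f) s" for s
    using B[of s] by (simp add: bias)
  with gain show ?thesis by (rule that)
qed

text \<open>Howard's improvement step, strict by irreducibility: were the new gain no larger, the
  difference of \<open>h\<close> and the new bias would be subharmonic for the new policy, hence
  constant, against the strict inequality at \<open>z\<close>.\<close>

lemma policy_improvement:
  assumes irr: "irreducible_mdp \<phi>"
    and B: "\<And>s. g + h s = bellman lam \<phi> (f s) h s"
    and better: "g + h z < bellman lam \<phi> a h z"
  shows "g < gain lam \<phi> (stationary (f(z := a))) x"
proof (rule ccontr)
  let ?f = "f(z := a)"
  obtain g' where g': "\<And>s. gain lam \<phi> (stationary ?f) s = g'"
    "\<And>s. g' + bias lam \<phi> ?f s = bellman lam \<phi> (?f s) (bias lam \<phi> ?f) s"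
    using stationary_bias[OF irr, where f="?f"] by blast
  define h' where "h' = bias lam \<phi> ?f"
  assume "\<not> ?thesis"
  then have le: "g' \<le> g" using g'(1) by simp
  define u where "u s = h s - h' s" for s
  have Pu: "step_mean \<phi> u s (?f s) = bellman lam \<phi> (?f s) h s - bellman lam \<phi> (?f s) h' s" for s
    by (simp add: u_def bellman_def right_diff_distrib sum_subtractf)
  have ge: "g + h s \<le> bellman lam \<phi> (?f s) h s" for s
    using B better by (auto intro: less_imp_le)
  have sub: "u s \<le> step_mean \<phi> u s (?f s)" for s
    unfolding Pu using ge[of s] g'(2)[of s] le by (simp add: u_def h'_def)
  then have "u y = u z" for y
    by (rule subharmonic_constant[OF irr])
  then have "step_mean \<phi> u z (?f z) = step_mean \<phi> (\<lambda>_. u z) z (?f z)"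
    by (intro sum.cong) auto
  then have "step_mean \<phi> u z (?f z) = u z" by (simp only: step_mean_const)
  moreover have "u z < step_mean \<phi> u z (?f z)"
    unfolding Pu using better g'(2)[of z] le by (simp add: u_def h'_def)
  ultimately show False by simp
qed

lemma value_fn_upper:
  assumes pi: "\<pi> \<in> policies" and sup: "\<And>s a. bellman lam \<phi> a h s \<le> g + h s"
    and D: "\<And>s. \<bar>h s\<bar> \<le> D"
  shows "value_fn lam \<phi> \<pi> x n \<le> real n * g + 2 * D"
proof -
  have "0 \<le> (\<Sum>s\<in>UNIV. \<Sum>a\<in>UNIV. occ lam \<phi> \<pi> x n s a * (g + h s - bellman lam \<phi> a h s))"
    using sup by (intro sum_nonneg mult_nonneg_nonneg occ_nonneg) (simp add: algebra_simps)
  moreover have "\<bar>\<integral>\<omega>. h (snd \<omega>) \<partial>hist_law lam \<phi> \<pi> x n\<bar> \<le> D"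
    using integral_state_bound[OF pi D] .
  ultimately show ?thesis
    unfolding value_fn_decomposition[OF pi, of x n g h] using D[of x] by linarith
qed

text \<open>\<open>value_fn_upper\<close> bounds the gain of every history-dependent policy by
  \<open>g\<close>, and \<open>stationary f\<close> attains it.\<close>

lemma opt_gain_eq:
  assumes B: "\<And>s. g + h s = bellman lam \<phi> (f s) h s"
    and sup: "\<And>s a. bellman lam \<phi> a h s \<le> g + h s"
  shows "opt_gain lam \<phi> x = g"
proof -
  obtain D where D: "0 \<le> D" "\<And>s. \<bar>h s\<bar> \<le> D" using finite_type_bound[of h] by blast
  let ?C = "{\<pi>\<in>policies. convergent (\<lambda>T. value_fn lam \<phi> \<pi> x T / real T)}"
  have le: "gain lam \<phi> \<pi> x \<le> g" if "\<pi> \<in> ?C" for \<pi>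
  proof (rule LIMSEQ_le)
    show "(\<lambda>T. value_fn lam \<phi> \<pi> x T / real T) \<longlonglongrightarrow> gain lam \<phi> \<pi> x"
      using that unfolding gain_def by (simp add: convergent_LIMSEQ_iff)
    show "(\<lambda>T. (real T * g + 2 * D) / real T) \<longlonglongrightarrow> g"
      by (rule tendsto_linear_over_n[of _ _ "2 * D"]) (use D(1) in simp)
    show "\<exists>N. \<forall>n\<ge>N. value_fn lam \<phi> \<pi> x n / real n \<le> (real n * g + 2 * D) / real n"
      using that value_fn_upper[OF _ sup D(2)] by (auto intro!: divide_right_mono)
  qed
  have f: "stationary f \<in> ?C" "gain lam \<phi> (stationary f) x = g"
    using stationary_gain[OF B, of x] by (auto simp: convergent_def)
  show ?thesis
    unfolding opt_gain_def
  proof (rule antisym)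
    show "(SUP \<pi>\<in>?C. gain lam \<phi> \<pi> x) \<le> g" using f(1) le by (intro cSUP_least) blast+
    have bdd: "bdd_above ((\<lambda>\<pi>. gain lam \<phi> \<pi> x) ` ?C)" using le by (rule bdd_aboveI2)
    show "g \<le> (SUP \<pi>\<in>?C. gain lam \<phi> \<pi> x)"
      using cSUP_upper[OF f(1) bdd] unfolding f(2) .
  qed
qed

text \<open>A stationary policy of largest gain exists by finiteness, and
  \<open>policy_improvement\<close> turns its maximality into the optimality equation for its own
  bias. This is shown for every maximal \<open>f\<close>, because \<open>opt_bias\<close> uses one
  picked by choice.\<close>

theorem optimality_equation:
  assumes irr: "irreducible_mdp \<phi>"
  obtains g where "\<And>s. bellman_opt lam \<phi> (opt_bias lam \<phi>) s = g + opt_bias lam \<phi> s"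
    and "\<And>s. opt_gain lam \<phi> s = g"
proof -
  \<comment> \<open>The gain of a stationary policy does not depend on the initial state, so any
    fixed state serves.\<close>
  define G where "G f = gain lam \<phi> (stationary f) undefined" for f
  have "Max (range G) \<in> range G" by (rule Max_in) auto
  then obtain f0 where f0: "G f0 = Max (range G)" by (metis imageE)
  then have f0_max: "G f \<le> G f0" for f by simp
  have opt: "\<forall>s. \<forall>a. bellman lam \<phi> a (bias lam \<phi> f) s \<le> G f + bias lam \<phi> f s"
    "\<forall>s. G f + bias lam \<phi> f s = bellman lam \<phi> (f s) (bias lam \<phi> f) s"
    "\<forall>s. gain lam \<phi> (stationary f) s = G f"
    if f_max: "\<And>f'. G f' \<le> G f" for f
  proof -
    obtain g where "\<And>s. gain lam \<phi> (stationary f) s = g"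
        and B: "\<And>s. g + bias lam \<phi> f s = bellman lam \<phi> (f s) (bias lam \<phi> f) s"
      using stationary_bias[OF irr] by blast
    then show 3: "\<forall>s. gain lam \<phi> (stationary f) s = G f" by (simp add: G_def)
    then have g: "g = G f" using \<open>\<And>s. gain lam \<phi> (stationary f) s = g\<close> by simp
    show 2: "\<forall>s. G f + bias lam \<phi> f s = bellman lam \<phi> (f s) (bias lam \<phi> f) s" using B g by simp
    show "\<forall>s. \<forall>a. bellman lam \<phi> a (bias lam \<phi> f) s \<le> G f + bias lam \<phi> f s"
    proof (intro allI, rule ccontr)
      fix s a assume "\<not> bellman lam \<phi> a (bias lam \<phi> f) s \<le> G f + bias lam \<phi> f s"
      then have "G f < G (f(s := a))" unfolding G_def[of "f(s := a)"]
        using 2 by (intro policy_improvement[OF irr]) auto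
      then show False using f_max[of "f(s := a)"] by simp
    qed
  qed
  have og: "opt_gain lam \<phi> s = G f0" for s
    using opt[OF f0_max] by (intro opt_gain_eq[of _ "bias lam \<phi> f0" f0]) auto
  have "f0 \<in> opt_policies lam \<phi>"
    unfolding opt_policies_def using og opt(3)[OF f0_max] by simp
  then have "\<exists>f. f \<in> opt_policies lam \<phi>" by blast
  then have "(SOME f. f \<in> opt_policies lam \<phi>) \<in> opt_policies lam \<phi>" by (rule someI_ex)
  then obtain f1 where f1: "f1 \<in> opt_policies lam \<phi>" "opt_bias lam \<phi> = bias lam \<phi> f1"
    unfolding opt_bias_def by blast
  \<comment> \<open>The chosen policy may differ from \<open>f0\<close> but has the same gain, so
    \<open>opt\<close> applies to it as well.\<close>
  then have "G f1 = G f0" unfolding opt_policies_def by (simp add: G_def[of f1] og)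
  then have f1_max: "G f \<le> G f1" for f using f0_max by simp
  have "bellman_opt lam \<phi> (opt_bias lam \<phi>) s = G f0 + opt_bias lam \<phi> s" for s
    unfolding bellman_opt_def f1(2)
  proof (rule Max_eqI)
    show "y \<le> G f0 + bias lam \<phi> f1 s" if "y \<in> range (\<lambda>a. bellman lam \<phi> a (bias lam \<phi> f1) s)" for y
      using that opt(1)[OF f1_max] \<open>G f1 = G f0\<close> by auto
    show "G f0 + bias lam \<phi> f1 s \<in> range (\<lambda>a. bellman lam \<phi> a (bias lam \<phi> f1) s)"
      using opt(2)[OF f1_max] \<open>G f1 = G f0\<close> by (intro image_eqI[of _ _ "f1 s"]) auto
  qed simp
  then show ?thesis using og by (rule that)
qed

section \<open>Gaps, regret and visits\<close>

lemma gap_nonneg: "0 \<le> gap lam \<phi> s a"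
  by (simp add: gap_def bellman_opt_def)

lemma gap_eq_0_iff: "gap lam \<phi> s a = 0 \<longleftrightarrow> a \<in> opt_actions lam \<phi> s"
  by (auto simp: gap_def opt_actions_def)

lemma opt_actions_nonempty: "opt_actions lam \<phi> s \<noteq> {}"
proof -
  have "bellman_opt lam \<phi> (opt_bias lam \<phi>) s \<in> range (\<lambda>a. bellman lam \<phi> a (opt_bias lam \<phi>) s)"
    unfolding bellman_opt_def by (rule Max_in) auto
  then show ?thesis by (auto simp: opt_actions_def)
qed

lemma gap_lower_bound:
  obtains d where "0 < d" "\<And>s a. a \<notin> opt_actions lam \<phi> s \<Longrightarrow> d \<le> gap lam \<phi> s a"
proof -
  \<comment> \<open>The inserted 1 covers the case that all actions are optimal.\<close>
  let ?R = "insert 1 ((\<lambda>(s, a). gap lam \<phi> s a) ` {(s, a). a \<notin> opt_actions lam \<phi> s})"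
  have "0 < Min ?R"
    using gap_nonneg gap_eq_0_iff by (subst Min_gr_iff) (auto simp: less_le)
  moreover have "Min ?R \<le> gap lam \<phi> s a" if "a \<notin> opt_actions lam \<phi> s" for s a
    using that by (intro Min_le) auto
  ultimately show ?thesis by (rule that)
qed

text \<open>Optimal actions make \<open>opt_bias\<close> solve the Poisson equation of
  \<open>f\<close> with the optimal gain. Read backwards, irreducible models without a common
  optimal policy have a state without a common optimal action.\<close>

lemma opt_policiesI:
  assumes irr: "irreducible_mdp \<phi>" and f: "\<And>s. f s \<in> opt_actions lam \<phi> s"
  shows "f \<in> opt_policies lam \<phi>"
proof -
  obtain g where g: "\<And>s. bellman_opt lam \<phi> (opt_bias lam \<phi>) s = g + opt_bias lam \<phi> s"
    and og: "\<And>s. opt_gain lam \<phi> s = g" using optimality_equation[OF irr] by blast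
  have "g + opt_bias lam \<phi> s = bellman lam \<phi> (f s) (opt_bias lam \<phi>) s" for s
    using f[of s] g[of s] by (simp add: opt_actions_def)
  then have "gain lam \<phi> (stationary f) s = g" for s by (rule stationary_gain(2))
  then show ?thesis by (simp add: opt_policies_def og)
qed

text \<open>With \<open>opt_bias\<close> for \<open>h\<close>, the defect in
  \<open>value_fn_decomposition\<close> is exactly the gap. The finite-horizon optimum is bounded
  below by a greedy stationary policy, whose defect is 0; this leaves only boundary terms in
  \<open>h\<close>, bounded uniformly in policy, initial state and horizon.\<close>

theorem regret_lower_bound:
  assumes irr: "irreducible_mdp \<phi>"
  obtains C where "\<And>\<pi> x n. \<pi> \<in> policies \<Longrightarrow>
    (\<Sum>s\<in>UNIV. \<Sum>a\<in>UNIV. occ lam \<phi> \<pi> x n s a * gap lam \<phi> s a) \<le> regret lam \<phi> \<pi> x n + C"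
proof -
  obtain g where g: "\<And>s. bellman_opt lam \<phi> (opt_bias lam \<phi>) s = g + opt_bias lam \<phi> s"
    using optimality_equation[OF irr] by blast
  define h where "h = opt_bias lam \<phi>"
  obtain D where D: "0 \<le> D" "\<And>s. \<bar>h s\<bar> \<le> D" using finite_type_bound[of h] by blast
  have "\<forall>s. \<exists>a. a \<in> opt_actions lam \<phi> s" using opt_actions_nonempty by blast
  then obtain f where f: "\<And>s. f s \<in> opt_actions lam \<phi> s" by metis
  then have B: "g + h s = bellman lam \<phi> (f s) h s" for s
    using g[of s] by (simp add: opt_actions_def h_def)
  have gap: "gap lam \<phi> s a = g + h s - bellman lam \<phi> a h s" for s a
    by (simp add: gap_def g h_def)
  have "(\<Sum>s\<in>UNIV. \<Sum>a\<in>UNIV. occ lam \<phi> \<pi> x n s a * gap lam \<phi> s a) \<le> regret lam \<phi> \<pi> x n + 4 * D"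
    if pi: "\<pi> \<in> policies" for \<pi> x n
  proof -
    have "real n * g + h x - D \<le> value_fn lam \<phi> (stationary f) x n"
      unfolding stationary_value[OF B] using integral_state_bound[where \<pi>="stationary f" and x=x and n=n and u=h, OF _ D(2)] by simp
    also have "\<dots> \<le> opt_value lam \<phi> x n" by (rule value_fn_le_opt_value) simp
    finally have "real n * g + h x - D \<le> opt_value lam \<phi> x n" .
    moreover have "value_fn lam \<phi> \<pi> x n \<le> real n * g + h x + D - (\<Sum>s\<in>UNIV. \<Sum>a\<in>UNIV. occ lam \<phi> \<pi> x n s a * gap lam \<phi> s a)"
      unfolding value_fn_decomposition[OF pi, of x n g h] gap
      using integral_state_bound[where x=x and n=n and u=h, OF pi D(2)] by simp
    ultimately show ?thesis unfolding regret_def using D(1) by linarith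
  qed
  then show ?thesis by (rule that)
qed

text \<open>A Chernoff bound valid for all policies: few visits to \<open>z\<close> keep
  \<open>exp\<close> of \<open>- \<kappa>\<close> times their number large, while the mean of this
  discount decays geometrically.\<close>

theorem visits_linear:
  assumes irr: "irreducible_mdp \<phi>"
  obtains c where "0 < c" "\<And>\<pi> x. \<pi> \<in> policies \<Longrightarrow>
    (\<lambda>n. measure (hist_law lam \<phi> \<pi> x n)
       {\<omega>\<in>space (hist_space n). path_sum n (\<lambda>t. indicator {z} (fst t)) \<omega> < c * real n}) \<longlonglongrightarrow> 0"
proof -
  obtain W \<beta> \<kappa> where W: "\<And>s. 1 \<le> W s" and \<beta>: "0 < \<beta>" "\<beta> < 1" and \<kappa>: "0 < \<kappa>"
    and drift: "\<And>s a. exp (- \<kappa> * indicator {z} s) * step_mean \<phi> W s a \<le> \<beta> * W s"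
    using geometric_drift_exists[OF irr, of z] by blast
  \<comment> \<open>With this threshold the discount is at least \<open>sqrt \<beta> ^ n\<close> on
    the bad event; dividing the bound \<open>\<beta> ^ n\<close> by it still leaves
    \<open>sqrt \<beta> ^ n\<close>.\<close>
  define c where "c = - ln \<beta> / (2 * \<kappa>)"
  have c: "0 < c" using \<beta> \<kappa> by (simp add: c_def divide_neg_pos)
  obtain D where D: "0 \<le> D" "\<And>s. \<bar>W s\<bar> \<le> D" using finite_type_bound[of W] by blast
  have "(\<lambda>n. measure (hist_law lam \<phi> \<pi> x n)
       {\<omega>\<in>space (hist_space n). path_sum n (\<lambda>t. indicator {z} (fst t)) \<omega> < c * real n}) \<longlonglongrightarrow> 0"
    if pi: "\<pi> \<in> policies" for \<pi> x
  proof (rule tendsto_sandwich[OF _ _ tendsto_const])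
    show "\<forall>\<^sub>F n in sequentially. measure (hist_law lam \<phi> \<pi> x n)
       {\<omega>\<in>space (hist_space n). path_sum n (\<lambda>t. indicator {z} (fst t)) \<omega> < c * real n} \<le> W x * sqrt \<beta> ^ n"
    proof (rule always_eventually, rule allI)
      fix n
      interpret prob_space "hist_law lam \<phi> \<pi> x n" by (rule prob_space_hist_law) fact
      let ?N = "path_sum n (\<lambda>t. indicator {z} (fst t) :: real) :: ('s, 'a) hist \<Rightarrow> real"
      let ?S = "path_sum n (\<lambda>t. - \<kappa> * indicator {z} (fst t) :: real) :: ('s, 'a) hist \<Rightarrow> real"
      have m: "(\<lambda>t. k * indicator {z} (fst t) :: real) \<in> borel_measurable (count_space UNIV \<Otimes>\<^sub>M (count_space UNIV \<Otimes>\<^sub>M borel))" for k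
        by measurable
      have S: "?S \<omega> = - \<kappa> * ?N \<omega>" for \<omega> by (simp add: path_sum_def sum_distrib_left sum_negf)
      have mS: "?S \<in> borel_measurable (hist_space n)" by (rule measurable_path_sum[OF m])
      have mN: "?N \<in> borel_measurable (hist_space n)" using measurable_path_sum[OF m[of 1]] by simp
      have S0: "?S \<omega> \<le> 0" for \<omega>
        unfolding path_sum_def using \<kappa> by (intro sum_nonpos) auto
      have int: "integrable (hist_law lam \<phi> \<pi> x n) (\<lambda>\<omega>. W (snd \<omega>) * exp (?S \<omega>))"
      proof (rule integrable_hist_law[OF pi, of _ _ D])
        show "(\<lambda>\<omega>. W (snd \<omega>) * exp (?S \<omega>)) \<in> borel_measurable (hist_space n)"
          using mS by measurable
        show "\<bar>W (snd \<omega>) * exp (?S \<omega>)\<bar> \<le> D" for \<omega>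
          using mult_mono[OF D(2)[of "snd \<omega>"], of "exp (?S \<omega>)" 1] S0[of \<omega>] D(1) by (simp add: abs_mult)
      qed
      have A: "{\<omega>\<in>space (hist_space n). ?N \<omega> < c * real n} \<in> events"
        unfolding sets_hist_law[OF pi] using mN by measurable
      define A where "A = {\<omega>\<in>space (hist_space n). ?N \<omega> < c * real n}"
      have A_ev: "A \<in> events" unfolding A_def by (rule A)
      define E where "E = exp (- \<kappa> * (c * real n))"
      have "E * prob A = (\<integral>\<omega>. E * indicator A \<omega> \<partial>hist_law lam \<phi> \<pi> x n)"
        using A_ev by simp
      also have "\<dots> \<le> (\<integral>\<omega>. W (snd \<omega>) * exp (?S \<omega>) \<partial>hist_law lam \<phi> \<pi> x n)"
      proof (rule integral_mono[OF _ int])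
        show "integrable (hist_law lam \<phi> \<pi> x n) (\<lambda>\<omega>. E * indicator A \<omega>)"
          using A_ev by (intro integrable_mult_right) (auto simp: less_top[symmetric])
        show "E * indicator A \<omega> \<le> W (snd \<omega>) * exp (?S \<omega>)" for \<omega>
        proof (cases "\<omega> \<in> A")
          case True
          then have "- \<kappa> * (c * real n) \<le> ?S \<omega>" unfolding S A_def using \<kappa> by simp
          then have "1 * E \<le> W (snd \<omega>) * exp (?S \<omega>)"
            unfolding E_def using W[of "snd \<omega>"] by (intro mult_mono) auto
          then show ?thesis using True by simp
        next
          case False
          have "0 \<le> W (snd \<omega>) * exp (?S \<omega>)" using W[of "snd \<omega>"] by (intro mult_nonneg_nonneg) auto
          then show ?thesis using False by simp
        qed
      qed
      also have "\<dots> \<le> \<beta> ^ n * W x"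
        using W \<beta> drift order_trans[OF zero_le_one W]
        by (intro exponential_supermartingale[OF pi, where c="\<lambda>s. - \<kappa> * indicator {z} s"]) auto
      finally have "E * prob A \<le> \<beta> ^ n * W x" .
      moreover have "E = sqrt \<beta> ^ n"
      proof -
        have "- \<kappa> * (c * real n) = real n * (ln \<beta> / 2)" using \<kappa> by (simp add: c_def field_simps)
        then have "E = exp (ln \<beta> / 2) ^ n" unfolding E_def by (simp only: exp_of_nat_mult)
        also have "exp (ln \<beta> / 2) = sqrt \<beta>" using \<beta>(1) by (simp add: powr_half_sqrt[symmetric] powr_def)
        finally show ?thesis .
      qed
      moreover have "\<beta> ^ n = sqrt \<beta> ^ n * sqrt \<beta> ^ n"
        using \<beta>(1) by (simp flip: power_mult_distrib)
      ultimately have "sqrt \<beta> ^ n * prob A \<le> sqrt \<beta> ^ n * (W x * sqrt \<beta> ^ n)"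
        by (simp add: mult_ac)
      then have "prob A \<le> W x * sqrt \<beta> ^ n"
        using \<beta>(1) by (subst (asm) mult_le_cancel_left_pos) auto
      then show "prob {\<omega>\<in>space (hist_space n). ?N \<omega> < c * real n} \<le> W x * sqrt \<beta> ^ n"
        unfolding A_def .
    qed
    show "(\<lambda>n. W x * sqrt \<beta> ^ n) \<longlonglongrightarrow> 0"
      using \<beta> by (intro tendsto_mult_right_zero LIMSEQ_realpow_zero) auto
  qed (auto intro!: always_eventually)
  with c show ?thesis by (rule that)
qed

end

section \<open>Change of measure\<close>

text \<open>The inequality \<open>ln y \<le> y - 1\<close>, multiplied by \<open>p\<close> and
  integrated, where \<open>y\<close> is the ratio of the exponentially tilted density
  \<open>q * exp F / Z\<close> to \<open>p\<close>. The argument stays with densities over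
  \<open>M\<close>, so it serves counting measure and \<open>lam\<close> alike.\<close>

lemma donsker_varadhan:
  fixes p q F :: "'b \<Rightarrow> real"
  assumes [measurable]: "F \<in> borel_measurable M"
    and p0: "\<And>x. 0 \<le> p x" and q0: "\<And>x. 0 \<le> q x"
    and p: "integrable M p" "(\<integral>x. p x \<partial>M) = 1" and q: "integrable M q" "(\<integral>x. q x \<partial>M) = 1"
    and ac: "AE x in M. q x = 0 \<longrightarrow> p x = 0"
    and kl: "integrable M (\<lambda>x. p x * ln (p x / q x))"
    and B: "\<And>x. x \<in> space M \<Longrightarrow> \<bar>F x\<bar> \<le> B"
  shows "(\<integral>x. p x * F x \<partial>M) \<le> (\<integral>x. p x * ln (p x / q x) \<partial>M) + ln (\<integral>x. q x * exp (F x) \<partial>M)"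
proof -
  have [measurable]: "p \<in> borel_measurable M" "q \<in> borel_measurable M" using p q by auto
  have intF: "integrable M (\<lambda>x. p x * F x)"
  proof (rule Bochner_Integration.integrable_bound[of _ "\<lambda>x. B * p x"])
    show "AE x in M. norm (p x * F x) \<le> norm (B * p x)"
    proof (rule AE_I2)
      fix x assume "x \<in> space M"
      then have "\<bar>F x\<bar> \<le> \<bar>B\<bar>" using B by force
      then show "norm (p x * F x) \<le> norm (B * p x)"
        using mult_left_mono[of "\<bar>F x\<bar>" "\<bar>B\<bar>" "p x"] p0[of x] by (simp add: abs_mult mult.commute)
    qed
  qed (use p in auto)
  have intE: "integrable M (\<lambda>x. q x * exp (F x))"
  proof (rule Bochner_Integration.integrable_bound[of _ "\<lambda>x. exp B * q x"])
    show "AE x in M. norm (q x * exp (F x)) \<le> norm (exp B * q x)"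
    proof (rule AE_I2)
      fix x assume "x \<in> space M"
      then have "F x \<le> B" using B by force
      then have "q x * exp (F x) \<le> q x * exp B" using q0[of x] by (intro mult_left_mono) auto
      then show "norm (q x * exp (F x)) \<le> norm (exp B * q x)"
        using q0[of x] by (simp add: abs_mult mult.commute[of "exp B"])
    qed
  qed (use q in auto)
  define Z where "Z = (\<integral>x. q x * exp (F x) \<partial>M)"
  \<comment> \<open>The bound on \<open>F\<close> makes \<open>Z\<close> positive, so that
    \<open>ln Z\<close> and the tilted density make sense.\<close>
  have "(\<integral>x. exp (- B) * q x \<partial>M) \<le> Z"
    unfolding Z_def
  proof (rule integral_mono[OF _ intE])
    fix x assume "x \<in> space M"
    then have "- B \<le> F x" using B by force
    then show "exp (- B) * q x \<le> q x * exp (F x)"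
      using q0[of x] by (simp add: mult.commute mult_left_mono)
  qed (use q in auto)
  then have "exp (- B) \<le> Z" using q by simp
  then have Z: "0 < Z" using exp_gt_zero[of "- B"] by linarith
  have "(\<integral>x. p x * F x \<partial>M) \<le> (\<integral>x. p x * ln (p x / q x) + ln Z * p x + q x * exp (F x) / Z - p x \<partial>M)"
  proof (rule integral_mono_AE[OF intF])
    show "integrable M (\<lambda>x. p x * ln (p x / q x) + ln Z * p x + q x * exp (F x) / Z - p x)"
      using kl p intE by auto
    show "AE x in M. p x * F x \<le> p x * ln (p x / q x) + ln Z * p x + q x * exp (F x) / Z - p x"
      using ac
    proof (rule eventually_mono)
      fix x assume x: "q x = 0 \<longrightarrow> p x = 0"
      show "p x * F x \<le> p x * ln (p x / q x) + ln Z * p x + q x * exp (F x) / Z - p x"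
      proof (cases "p x = 0")
        case True
        then show ?thesis using q0[of x] Z by simp
      next
        case False
        then have pos: "0 < p x" "0 < q x" using x p0[of x] q0[of x] by (auto simp: less_le)
        let ?y = "q x * exp (F x) / (Z * p x)"
        have y: "0 < ?y" using pos Z by simp
        have "ln ?y = ln (q x) + F x - (ln Z + ln (p x))"
          using pos Z by (simp add: ln_div ln_mult)
        also have "\<dots> = F x - ln Z - ln (p x / q x)" using pos by (simp add: ln_div)
        finally have "F x - ln Z - ln (p x / q x) \<le> ?y - 1" using ln_le_minus_one[OF y] by simp
        then have "p x * (F x - ln Z - ln (p x / q x)) \<le> p x * (?y - 1)"
          using pos(1) by (intro mult_left_mono) auto
        also have "p x * (?y - 1) = q x * exp (F x) / Z - p x" using pos Z by (simp add: field_simps)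
        finally show ?thesis by (simp add: algebra_simps)
      qed
    qed
  qed
  also have "\<dots> = (\<integral>x. p x * ln (p x / q x) \<partial>M) + ln Z * 1 + Z / Z - 1"
    using kl p intE by (simp add: Z_def)
  also have "\<dots> = (\<integral>x. p x * ln (p x / q x) \<partial>M) + ln Z" using Z by simp
  finally show ?thesis by (simp add: Z_def)
qed

lemma (in mdp_model) integrable_rdens: "integrable lam (rdens \<phi> s a)"
  using nn_integral_rdens[of s a] by (intro integrableI_nonneg) (auto simp: rdens_nonneg)

lemma (in mdp_model) integral_rdens: "(\<integral>r. rdens \<phi> s a r \<partial>lam) = 1"
  using nn_integral_rdens[of s a] by (subst integral_eq_nn_integral) (auto simp: rdens_nonneg)

section \<open>Two models, one absolutely continuous with respect to the other\<close>

locale mdp_pair = P: mdp_model lam \<phi> + Q: mdp_model lam \<psi>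
  for lam :: "real measure" and \<phi> \<psi> :: "('s::finite, 'a::finite) mdp" +
  assumes ac: "mdp_ac lam \<phi> \<psi>"
begin

definition kl_tr :: "'s \<Rightarrow> 'a \<Rightarrow> real" where
  "kl_tr s a = (\<Sum>y\<in>UNIV. pmf (tr \<phi> s a) y * ln (pmf (tr \<phi> s a) y / pmf (tr \<psi> s a) y))"

definition kl_rew :: "'s \<Rightarrow> 'a \<Rightarrow> real \<Rightarrow> real" where
  "kl_rew s a r = rdens \<phi> s a r * ln (rdens \<phi> s a r / rdens \<psi> s a r)"

lemma pmf_ac: "pmf (tr \<psi> s a) y = 0 \<Longrightarrow> pmf (tr \<phi> s a) y = 0"
proof -
  assume "pmf (tr \<psi> s a) y = 0"
  then have "{y} \<in> null_sets (measure_pmf (tr \<psi> s a))"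
    by (simp add: null_sets_def emeasure_pmf_single)
  then have "{y} \<in> null_sets (measure_pmf (tr \<phi> s a))"
    using ac by (auto simp: mdp_ac_def absolutely_continuous_def)
  then show ?thesis by (simp add: null_sets_def emeasure_pmf_single)
qed

text \<open>Supports only grow from \<open>\<phi>\<close> to \<open>\<psi>\<close>, so a set closed
  for \<open>\<psi>\<close> is closed for \<open>\<phi>\<close>. Thus confusing models are ergodic,
  and uniform goodness says something about them.\<close>

lemma irreducible_transfer: "irreducible_mdp \<phi> \<Longrightarrow> irreducible_mdp \<psi>"
proof -
  assume irr: "irreducible_mdp \<phi>"
  have sub: "set_pmf (tr \<phi> s a) \<subseteq> set_pmf (tr \<psi> s a)" for s a
    using pmf_ac by (auto simp: set_pmf_iff)
  show ?thesis
    unfolding irreducible_mdp_def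
  proof (intro allI impI)
    fix f B assume "B \<noteq> {}" "\<forall>s\<in>B. set_pmf (tr \<psi> s (f s)) \<subseteq> B"
    then show "B = UNIV" using sub by (intro irreducible_mdpD[OF irr, of B f]) blast+
  qed
qed

lemma rdens_ac: "AE r in lam. rdens \<psi> s a r = 0 \<longrightarrow> rdens \<phi> s a r = 0"
proof -
  let ?A = "{r. rdens \<psi> s a r = 0}"
  have A: "?A \<in> sets lam"
    unfolding P.sets_lam using Q.measurable_rdens_borel[of s a] by measurable
  have "?A \<in> null_sets (reward_law lam \<psi> s a)"
    unfolding reward_law_def using A by (subst null_sets_density_iff) auto
  then have "?A \<in> null_sets (reward_law lam \<phi> s a)"
    using ac by (auto simp: mdp_ac_def absolutely_continuous_def)
  then have "AE r in lam. r \<in> ?A \<longrightarrow> ennreal (rdens \<phi> s a r) = 0"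
    unfolding reward_law_def by (subst (asm) null_sets_density_iff) auto
  then show ?thesis
    by (rule eventually_mono) (auto simp: ennreal_eq_0_iff intro: antisym P.rdens_nonneg)
qed

lemma measurable_kl_rew [measurable]: "kl_rew s a \<in> borel_measurable lam"
  unfolding kl_rew_def by measurable

text \<open>Where \<open>p\<close> and \<open>q\<close> are positive,
  \<open>- p * ln (p / q) = p * ln (q / p) \<le> q - p \<le> q\<close>, and \<open>q\<close> has
  mass 1. So \<open>ext_integral\<close> in \<open>KL\<close> never meets infinity minus
  infinity.\<close>

lemma kl_rew_neg_part: "(\<integral>\<^sup>+ r. ennreal (- kl_rew s a r) \<partial>lam) \<le> 1"
proof -
  have "(\<integral>\<^sup>+ r. ennreal (- kl_rew s a r) \<partial>lam) \<le> (\<integral>\<^sup>+ r. ennreal (rdens \<psi> s a r) \<partial>lam)"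
  proof (rule nn_integral_mono_AE)
    show "AE r in lam. ennreal (- kl_rew s a r) \<le> ennreal (rdens \<psi> s a r)"
      using rdens_ac[of s a]
    proof (rule eventually_mono)
      fix r assume r: "rdens \<psi> s a r = 0 \<longrightarrow> rdens \<phi> s a r = 0"
      let ?p = "rdens \<phi> s a r" and ?q = "rdens \<psi> s a r"
      have "- kl_rew s a r \<le> ?q"
      proof (cases "?p = 0")
        case True
        then show ?thesis using Q.rdens_nonneg[of s a r] by (simp add: kl_rew_def)
      next
        case False
        then have pos: "0 < ?p" "0 < ?q"
          using r P.rdens_nonneg[of s a r] Q.rdens_nonneg[of s a r] by (auto simp: less_le)
        have "- kl_rew s a r = ?p * ln (?q / ?p)" using pos by (simp add: kl_rew_def ln_div right_diff_distrib)
        also have "\<dots> \<le> ?p * (?q / ?p - 1)"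
          using pos by (intro mult_left_mono ln_le_minus_one) auto
        also have "\<dots> \<le> ?q" using pos by (simp add: right_diff_distrib)
        finally show ?thesis .
      qed
      then show "ennreal (- kl_rew s a r) \<le> ennreal ?q" by (rule ennreal_leI)
    qed
  qed
  then show ?thesis by (simp add: Q.nn_integral_rdens)
qed

text \<open>The transition part is a finite real sum and the negative part of the reward integrand
  has finite mass, so infinity can come only from the positive part; otherwise the Bochner integral
  is available.\<close>

lemma KL_cases:
  obtains (infinite) "KL lam \<phi> \<psi> s a = \<infinity>"
  | (finite) "integrable lam (kl_rew s a)" "KL lam \<phi> \<psi> s a = ereal (kl_tr s a + (\<integral>r. kl_rew s a r \<partial>lam))"
proof -
  let ?A = "\<integral>\<^sup>+ r. ennreal (kl_rew s a r) \<partial>lam" and ?B = "\<integral>\<^sup>+ r. ennreal (- kl_rew s a r) \<partial>lam"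
  have KL: "KL lam \<phi> \<psi> s a = ereal (kl_tr s a) + (enn2ereal ?A - enn2ereal ?B)"
    by (simp add: KL_def kl_tr_def ext_integral_def kl_rew_def)
  have B: "?B \<noteq> \<infinity>" using kl_rew_neg_part[of s a] by (auto simp: top_unique)
  show ?thesis
  proof (cases "?A = \<infinity>")
    case True
    obtain b where "?B = ennreal b" "0 \<le> b" using B by (cases ?B) auto
    then have "KL lam \<phi> \<psi> s a = \<infinity>" unfolding KL True by (simp add: enn2ereal_ennreal)
    then show ?thesis by (rule infinite)
  next
    case False
    then have int: "integrable lam (kl_rew s a)" using B by (simp add: real_integrable_def)
    obtain a' b where ab: "?A = ennreal a'" "0 \<le> a'" "?B = ennreal b" "0 \<le> b"
      using B False by (metis ennreal_cases infinity_ennreal_def)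
    have "(\<integral>r. kl_rew s a r \<partial>lam) = a' - b"
      by (subst real_lebesgue_integral_def[OF int]) (simp add: ab)
    then have "KL lam \<phi> \<psi> s a = ereal (kl_tr s a + (\<integral>r. kl_rew s a r \<partial>lam))"
      unfolding KL ab by (simp add: enn2ereal_ennreal ab)
    with int show ?thesis by (rule finite)
  qed
qed

lemma donsker_varadhan_tr:
  "step_mean \<phi> F s a \<le> kl_tr s a + ln (step_mean \<psi> (\<lambda>y. exp (F y)) s a)"
proof -
  obtain B where B: "\<And>y. \<bar>F y\<bar> \<le> B" using finite_type_bound[of F] by blast
  show ?thesis
    using donsker_varadhan[of F "count_space UNIV" "pmf (tr \<phi> s a)" "pmf (tr \<psi> s a)" B]
    by (simp add: lebesgue_integral_count_space_finite integrable_count_space AE_count_space pmf_ac B kl_tr_def)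
qed

lemma donsker_varadhan_rew:
  assumes int: "integrable lam (kl_rew s a)" and F: "F \<in> borel_measurable borel" and B: "\<And>r. \<bar>F r\<bar> \<le> B"
  shows "(\<integral>r. F r \<partial>reward_law lam \<phi> s a) \<le>
    (\<integral>r. kl_rew s a r \<partial>lam) + ln (\<integral>r. exp (F r) \<partial>reward_law lam \<psi> s a)"
proof -
  have [measurable]: "F \<in> borel_measurable lam"
    using F by (simp add: measurable_cong_sets[OF P.sets_lam refl])
  have E: "(\<lambda>r. exp (F r)) \<in> borel_measurable borel" using F by measurable
  show ?thesis
    unfolding P.integral_reward_law[OF F] Q.integral_reward_law[OF E] kl_rew_def
    using int[unfolded kl_rew_def[abs_def]]
    by (intro donsker_varadhan[OF _ P.rdens_nonneg Q.rdens_nonneg _ _ _ _ rdens_ac])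
       (auto simp: P.integrable_rdens P.integral_rdens Q.integrable_rdens Q.integral_rdens intro: B)
qed

text \<open>Gibbs' inequality, obtained from the zero function in both Donsker-Varadhan
  inequalities.\<close>

lemma KL_nonneg: "0 \<le> KL lam \<phi> \<psi> s a"
proof (cases s a rule: KL_cases)
  case finite
  have "prob_space (reward_law lam \<psi> s a)" by (rule Q.prob_space_reward_law)
  then have "(\<integral>r. exp 0 \<partial>reward_law lam \<psi> s a) = (1::real)"
    using prob_space.prob_space by fastforce
  then have "0 \<le> (\<integral>r. kl_rew s a r \<partial>lam)"
    using donsker_varadhan_rew[OF finite(1), of "\<lambda>_. 0" 0] by simp
  moreover have "0 \<le> kl_tr s a" using donsker_varadhan_tr[where F="\<lambda>_. 0" and s=s and a=a] by simp
  ultimately show ?thesis using finite by simp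
qed simp

text \<open>Nested use over two independent draws: the transition inequality for each fixed
  \<open>r\<close>, then the reward inequality for the function \<open>ln (e r)\<close>, whose
  exponential is the inner moment \<open>e r\<close>.\<close>

lemma donsker_varadhan_step:
  fixes F :: "real \<Rightarrow> 's \<Rightarrow> real"
  assumes fin: "KL lam \<phi> \<psi> s a \<noteq> \<infinity>"
    and F: "(\<lambda>(r, y). F r y) \<in> borel_measurable (borel \<Otimes>\<^sub>M count_space UNIV)"
    and B: "\<And>r y. \<bar>F r y\<bar> \<le> B"
  shows "(\<integral>r. step_mean \<phi> (F r) s a \<partial>reward_law lam \<phi> s a) \<le>
    real_of_ereal (KL lam \<phi> \<psi> s a) + ln (\<integral>r. step_mean \<psi> (\<lambda>y. exp (F r y)) s a \<partial>reward_law lam \<psi> s a)"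
proof (cases s a rule: KL_cases)
  case finite
  interpret A: prob_space "reward_law lam \<phi> s a" by (rule P.prob_space_reward_law)
  have [measurable]: "(\<lambda>r. F r y) \<in> borel_measurable borel" for y
    using measurable_compose[OF measurable_Pair F, of "\<lambda>r. r" borel "\<lambda>_. y"] by simp
  define e where "e r = step_mean \<psi> (\<lambda>y. exp (F r y)) s a" for r
  have e: "exp (- B) \<le> e r" "e r \<le> exp B" for r
  proof -
    have FB: "F r y \<le> B" "- B \<le> F r y" for y using B[of r y] by auto
    have "step_mean \<psi> (\<lambda>_. exp (- B)) s a \<le> e r" "e r \<le> step_mean \<psi> (\<lambda>_. exp B) s a"
      unfolding e_def by (intro sum_mono mult_left_mono; use FB in simp)+
    then show "exp (- B) \<le> e r" "e r \<le> exp B" by (simp_all only: step_mean_const)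
  qed
  have epos: "0 < e r" for r using e(1)[of r] exp_gt_zero[of "- B"] by linarith
  have lnB: "\<bar>ln (e r)\<bar> \<le> B" for r
  proof -
    have "ln (exp (- B)) \<le> ln (e r)" "ln (e r) \<le> ln (exp B)"
      using e[of r] epos[of r] by (subst ln_le_cancel_iff; simp)+
    then show ?thesis by simp
  qed
  have [measurable]: "e \<in> borel_measurable borel" unfolding e_def by measurable
  have intF: "integrable (reward_law lam \<phi> s a) (\<lambda>r. step_mean \<phi> (F r) s a)"
  proof (rule A.integrable_const_bound[of _ B])
    show "AE r in reward_law lam \<phi> s a. norm (step_mean \<phi> (F r) s a) \<le> B"
    proof (rule AE_I2)
      fix r
      have "\<bar>step_mean \<phi> (F r) s a\<bar> \<le> (\<Sum>y\<in>UNIV. \<bar>pmf (tr \<phi> s a) y * F r y\<bar>)" by (rule sum_abs)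
      also have "\<dots> \<le> step_mean \<phi> (\<lambda>_. B) s a"
        using B by (intro sum_mono) (auto simp: abs_mult intro!: mult_left_mono)
      finally show "norm (step_mean \<phi> (F r) s a) \<le> B" by (simp only: step_mean_const real_norm_def)
    qed
  qed measurable
  have intG: "integrable (reward_law lam \<phi> s a) (\<lambda>r. ln (e r))"
    by (rule A.integrable_const_bound[of _ B]) (auto simp: lnB)
  have "(\<integral>r. step_mean \<phi> (F r) s a \<partial>reward_law lam \<phi> s a) \<le> (\<integral>r. kl_tr s a + ln (e r) \<partial>reward_law lam \<phi> s a)"
    using intF intG by (intro integral_mono) (auto simp: e_def donsker_varadhan_tr)
  also have "\<dots> = kl_tr s a + (\<integral>r. ln (e r) \<partial>reward_law lam \<phi> s a)"
    using intG A.prob_space by simp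
  also have "\<dots> \<le> kl_tr s a + ((\<integral>r. kl_rew s a r \<partial>lam) + ln (\<integral>r. exp (ln (e r)) \<partial>reward_law lam \<psi> s a))"
    by (intro add_left_mono donsker_varadhan_rew[OF finite(1) _ lnB]) measurable
  also have "(\<lambda>r. exp (ln (e r))) = e" using epos by auto
  finally show ?thesis using finite(2) by (simp add: e_def)
qed (use fin in simp)

text \<open>The last step is peeled off: the one-step inequality bounds the conditional mean of
  \<open>F\<close> by a divergence plus \<open>ln (e \<omega>)\<close>, and the induction hypothesis
  is applied to \<open>ln e\<close> on shorter histories, whence the generalization over
  \<open>F\<close>. Both laws use the same policy, so the choice of actions costs no
  divergence.\<close>

theorem donsker_varadhan_hist:
  fixes F :: "_ \<Rightarrow> real"
  assumes pi: "\<pi> \<in> policies" and fin: "\<And>s a. KL lam \<phi> \<psi> s a \<noteq> \<infinity>"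
    and F: "F \<in> borel_measurable (hist_space n)"
    and B: "\<And>\<omega>. \<omega> \<in> space (hist_space n) \<Longrightarrow> \<bar>F \<omega>\<bar> \<le> B"
  shows "(\<integral>\<omega>. F \<omega> \<partial>hist_law lam \<phi> \<pi> x n) \<le>
    (\<Sum>s\<in>UNIV. \<Sum>a\<in>UNIV. occ lam \<phi> \<pi> x n s a * real_of_ereal (KL lam \<phi> \<psi> s a)) +
    ln (\<integral>\<omega>. exp (F \<omega>) \<partial>hist_law lam \<psi> \<pi> x n)"
  using F B
proof (induction n arbitrary: F)
  case 0
  have m: "(\<lambda>\<omega>. exp (F \<omega>)) \<in> borel_measurable (hist_space 0)" using 0(1) by measurable
  show ?case
    unfolding P.integral_hist_law_0[OF 0(1)] Q.integral_hist_law_0[OF m] by (simp add: occ_def)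
next
  case (Suc n)
  note F = Suc.prems(1) and B = Suc.prems(2)
  let ?kl = "\<lambda>s a. real_of_ereal (KL lam \<phi> \<psi> s a)"
  let ?m = "\<lambda>s a. measure (hist_law lam \<phi> \<pi> x n) {\<omega>\<in>space (hist_space n). snd \<omega> = s \<and> \<pi> n \<omega> = a}"
  have expF: "(\<lambda>\<omega>. exp (F \<omega>)) \<in> borel_measurable (hist_space (Suc n))" using F by measurable
  have expB: "\<bar>exp (F \<omega>)\<bar> \<le> exp B" "exp (- B) \<le> exp (F \<omega>)" if "\<omega> \<in> space (hist_space (Suc n))" for \<omega>
    using B[OF that] by auto
  define e where "e \<omega> = (\<integral>z. exp (F z) \<partial>hist_kernel lam \<psi> \<pi> n \<omega>)" for \<omega>
  have e: "exp (- B) \<le> e \<omega>" "e \<omega> \<le> exp B" if \<omega>: "\<omega> \<in> space (hist_space n)" for \<omega>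
  proof -
    have K: "hist_kernel lam \<psi> \<pi> n \<omega> \<in> space (prob_algebra (hist_space (Suc n)))"
      using measurable_space[OF Q.measurable_hist_kernel[OF pi] \<omega>] .
    interpret K: prob_space "hist_kernel lam \<psi> \<pi> n \<omega>" using K by (simp add: space_prob_algebra)
    have sets: "sets (hist_kernel lam \<psi> \<pi> n \<omega>) = sets (hist_space (Suc n))"
      using K by (simp add: space_prob_algebra)
    have space: "space (hist_kernel lam \<psi> \<pi> n \<omega>) = space (hist_space (Suc n))"
      by (rule sets_eq_imp_space_eq[OF sets])
    have int: "integrable (hist_kernel lam \<psi> \<pi> n \<omega>) (\<lambda>z. exp (F z))"
    proof (rule K.integrable_const_bound[of _ "exp B"])
      show "(\<lambda>z. exp (F z)) \<in> borel_measurable (hist_kernel lam \<psi> \<pi> n \<omega>)"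
        using expF by (simp add: measurable_cong_sets[OF sets refl])
    qed (use expB(1) in \<open>auto simp: space\<close>)
    show "exp (- B) \<le> e \<omega>" unfolding e_def
      by (rule K.integral_ge_const[OF int]) (use expB(2) in \<open>auto simp: space\<close>)
    show "e \<omega> \<le> exp B" unfolding e_def
      by (rule K.integral_le_const[OF int]) (use expB(1) in \<open>auto simp: space\<close>)
  qed
  have epos: "0 < e \<omega>" if "\<omega> \<in> space (hist_space n)" for \<omega>
    using e(1)[OF that] exp_gt_zero[of "- B"] by linarith
  have lnB: "\<bar>ln (e \<omega>)\<bar> \<le> B" if "\<omega> \<in> space (hist_space n)" for \<omega>
  proof -
    have "ln (exp (- B)) \<le> ln (e \<omega>)" "ln (e \<omega>) \<le> ln (exp B)"
      using e[OF that] epos[OF that] by (subst ln_le_cancel_iff; simp)+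
    then show ?thesis by simp
  qed
  have e_meas: "e \<in> borel_measurable (hist_space n)"
    unfolding e_def by (rule Q.measurable_integral_hist_kernel[OF pi expF])
  then have ln_meas: "(\<lambda>\<omega>. ln (e \<omega>)) \<in> borel_measurable (hist_space n)" by measurable
  have ln_int: "integrable (hist_law lam \<phi> \<pi> x n) (\<lambda>\<omega>. ln (e \<omega>))"
    by (rule P.integrable_hist_law[OF pi ln_meas lnB])
  have kl_int: "integrable (hist_law lam \<phi> \<pi> x n) (\<lambda>\<omega>. ?kl (snd \<omega>) (\<pi> n \<omega>))"
    using P.integral_state_action(3)[OF pi, where G="?kl"] .
  have step: "(\<integral>z. F z \<partial>hist_kernel lam \<phi> \<pi> n \<omega>) \<le> ?kl (snd \<omega>) (\<pi> n \<omega>) + ln (e \<omega>)"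
    if \<omega>: "\<omega> \<in> space (hist_space n)" for \<omega>
  proof -
    let ?up = "\<lambda>r y. ((fst \<omega>)(n := (snd \<omega>, \<pi> n \<omega>, r)), y)"
    have "(\<integral>z. F z \<partial>hist_kernel lam \<phi> \<pi> n \<omega>) =
        (\<integral>r. step_mean \<phi> (\<lambda>y. F (?up r y)) (snd \<omega>) (\<pi> n \<omega>) \<partial>reward_law lam \<phi> (snd \<omega>) (\<pi> n \<omega>))"
      by (rule P.integral_hist_kernel(1)[OF pi F B \<omega>])
    also have "\<dots> \<le> ?kl (snd \<omega>) (\<pi> n \<omega>) +
        ln (\<integral>r. step_mean \<psi> (\<lambda>y. exp (F (?up r y))) (snd \<omega>) (\<pi> n \<omega>) \<partial>reward_law lam \<psi> (snd \<omega>) (\<pi> n \<omega>))"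
      by (rule donsker_varadhan_step[OF fin P.integral_hist_kernel(2,3)[OF pi F B \<omega>]])
    also have "(\<integral>r. step_mean \<psi> (\<lambda>y. exp (F (?up r y))) (snd \<omega>) (\<pi> n \<omega>) \<partial>reward_law lam \<psi> (snd \<omega>) (\<pi> n \<omega>)) = e \<omega>"
      unfolding e_def by (rule Q.integral_hist_kernel(1)[OF pi expF expB(1) \<omega>, symmetric])
    finally show ?thesis .
  qed
  have ker_int: "integrable (hist_law lam \<phi> \<pi> x n) (\<lambda>\<omega>. \<integral>z. F z \<partial>hist_kernel lam \<phi> \<pi> n \<omega>)"
  proof (rule P.integrable_hist_law[OF pi P.measurable_integral_hist_kernel[OF pi F]])
    fix \<omega> :: "('s, 'a) hist" assume \<omega>: "\<omega> \<in> space (hist_space n)"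
    have K: "hist_kernel lam \<phi> \<pi> n \<omega> \<in> space (prob_algebra (hist_space (Suc n)))"
      using measurable_space[OF P.measurable_hist_kernel[OF pi] \<omega>] .
    interpret K: prob_space "hist_kernel lam \<phi> \<pi> n \<omega>" using K by (simp add: space_prob_algebra)
    have sets: "sets (hist_kernel lam \<phi> \<pi> n \<omega>) = sets (hist_space (Suc n))"
      using K by (simp add: space_prob_algebra)
    have space: "space (hist_kernel lam \<phi> \<pi> n \<omega>) = space (hist_space (Suc n))"
      by (rule sets_eq_imp_space_eq[OF sets])
    have int: "integrable (hist_kernel lam \<phi> \<pi> n \<omega>) F"
    proof (rule K.integrable_const_bound[of _ B])
      show "F \<in> borel_measurable (hist_kernel lam \<phi> \<pi> n \<omega>)"
        using F by (simp add: measurable_cong_sets[OF sets refl])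
    qed (use B in \<open>auto simp: space\<close>)
    have "- B \<le> (\<integral>z. F z \<partial>hist_kernel lam \<phi> \<pi> n \<omega>)"
      using B by (intro K.integral_ge_const[OF int] AE_I2) (force simp: space)
    moreover have "(\<integral>z. F z \<partial>hist_kernel lam \<phi> \<pi> n \<omega>) \<le> B"
      using B by (intro K.integral_le_const[OF int] AE_I2) (force simp: space)
    ultimately show "\<bar>\<integral>z. F z \<partial>hist_kernel lam \<phi> \<pi> n \<omega>\<bar> \<le> B" by simp
  qed
  have "(\<integral>\<omega>. F \<omega> \<partial>hist_law lam \<phi> \<pi> x (Suc n)) =
      (\<integral>\<omega>. (\<integral>z. F z \<partial>hist_kernel lam \<phi> \<pi> n \<omega>) \<partial>hist_law lam \<phi> \<pi> x n)"
    by (rule P.integral_hist_law_Suc[OF pi F B])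
  also have "\<dots> \<le> (\<integral>\<omega>. ?kl (snd \<omega>) (\<pi> n \<omega>) + ln (e \<omega>) \<partial>hist_law lam \<phi> \<pi> x n)"
    using step by (intro integral_mono ker_int Bochner_Integration.integrable_add kl_int ln_int)
      (simp add: P.space_hist_law pi)
  also have "\<dots> = (\<Sum>s\<in>UNIV. \<Sum>a\<in>UNIV. ?m s a * ?kl s a) + (\<integral>\<omega>. ln (e \<omega>) \<partial>hist_law lam \<phi> \<pi> x n)"
    using P.integral_state_action(1)[OF pi, where G="?kl"] kl_int ln_int
    by (subst Bochner_Integration.integral_add) auto
  also have "\<dots> \<le> (\<Sum>s\<in>UNIV. \<Sum>a\<in>UNIV. ?m s a * ?kl s a) +
     ((\<Sum>s\<in>UNIV. \<Sum>a\<in>UNIV. occ lam \<phi> \<pi> x n s a * ?kl s a) + ln (\<integral>\<omega>. exp (ln (e \<omega>)) \<partial>hist_law lam \<psi> \<pi> x n))"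
    by (intro add_left_mono Suc.IH[OF ln_meas lnB])
  \<comment> \<open>\<open>exp\<close> undoes \<open>ln\<close>, and averaging \<open>e\<close> over
    the shorter histories gives back the exponential moment of \<open>F\<close>.\<close>
  also have "(\<integral>\<omega>. exp (ln (e \<omega>)) \<partial>hist_law lam \<psi> \<pi> x n) = (\<integral>\<omega>. e \<omega> \<partial>hist_law lam \<psi> \<pi> x n)"
    by (intro Bochner_Integration.integral_cong) (auto simp: Q.space_hist_law pi epos)
  also have "\<dots> = (\<integral>\<omega>. exp (F \<omega>) \<partial>hist_law lam \<psi> \<pi> x (Suc n))"
    unfolding e_def by (rule Q.integral_hist_law_Suc[OF pi expF expB(1), symmetric])
  also have "(\<Sum>s\<in>UNIV. \<Sum>a\<in>UNIV. ?m s a * ?kl s a) +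
     ((\<Sum>s\<in>UNIV. \<Sum>a\<in>UNIV. occ lam \<phi> \<pi> x n s a * ?kl s a) + ln (\<integral>\<omega>. exp (F \<omega>) \<partial>hist_law lam \<psi> \<pi> x (Suc n))) =
     (\<Sum>s\<in>UNIV. \<Sum>a\<in>UNIV. occ lam \<phi> \<pi> x (Suc n) s a * ?kl s a) + ln (\<integral>\<omega>. exp (F \<omega>) \<partial>hist_law lam \<psi> \<pi> x (Suc n))"
    by (simp add: occ_def distrib_right sum.distrib)
  finally show ?case .
qed

text \<open>For \<open>L\<close> times an indicator the exponential moment is 1 plus
  \<open>exp L - 1\<close> times the probability. An event likely under \<open>\<phi>\<close> but of
  probability at most \<open>exp (- L)\<close> under \<open>\<psi>\<close> thus forces a total
  divergence of about \<open>L\<close>, up to \<open>ln 2\<close>.\<close>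

corollary change_of_measure:
  assumes pi: "\<pi> \<in> policies" and fin: "\<And>s a. KL lam \<phi> \<psi> s a \<noteq> \<infinity>"
    and A: "A \<in> sets (hist_space n)" and L: "0 \<le> L"
  shows "L * measure (hist_law lam \<phi> \<pi> x n) A \<le>
    (\<Sum>s\<in>UNIV. \<Sum>a\<in>UNIV. occ lam \<phi> \<pi> x n s a * real_of_ereal (KL lam \<phi> \<psi> s a)) +
    ln (1 + exp L * measure (hist_law lam \<psi> \<pi> x n) A)"
proof -
  interpret PP: prob_space "hist_law lam \<phi> \<pi> x n" by (rule P.prob_space_hist_law) fact
  interpret QQ: prob_space "hist_law lam \<psi> \<pi> x n" by (rule Q.prob_space_hist_law) fact
  have AP: "A \<in> PP.events" and AQ: "A \<in> QQ.events"
    using A by (simp_all add: P.sets_hist_law Q.sets_hist_law pi)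
  let ?F = "\<lambda>\<omega>. L * indicator A \<omega> :: real"
  have "L * PP.prob A = (\<integral>\<omega>. ?F \<omega> \<partial>hist_law lam \<phi> \<pi> x n)" using AP by simp
  also have "\<dots> \<le> (\<Sum>s\<in>UNIV. \<Sum>a\<in>UNIV. occ lam \<phi> \<pi> x n s a * real_of_ereal (KL lam \<phi> \<psi> s a)) +
      ln (\<integral>\<omega>. exp (?F \<omega>) \<partial>hist_law lam \<psi> \<pi> x n)"
    using A L by (intro donsker_varadhan_hist[OF pi fin, of _ _ L]) (auto simp: indicator_def)
  also have "(\<integral>\<omega>. exp (?F \<omega>) \<partial>hist_law lam \<psi> \<pi> x n) = (\<integral>\<omega>. 1 + (exp L - 1) * indicator A \<omega> \<partial>hist_law lam \<psi> \<pi> x n)"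
    by (intro Bochner_Integration.integral_cong) (auto simp: indicator_def)
  also have "\<dots> = 1 + (exp L - 1) * QQ.prob A"
    using AQ QQ.prob_space by (subst Bochner_Integration.integral_add) (auto simp: less_top[symmetric])
  also have "ln \<dots> \<le> ln (1 + exp L * QQ.prob A)"
  proof (subst ln_le_cancel_iff)
    show "0 < 1 + (exp L - 1) * QQ.prob A" "0 < 1 + exp L * QQ.prob A"
      using L by (auto intro!: add_pos_nonneg mult_nonneg_nonneg)
    show "1 + (exp L - 1) * QQ.prob A \<le> 1 + exp L * QQ.prob A"
      by (simp add: mult_right_mono)
  qed
  finally show ?thesis by simp
qed

end

section \<open>The lower bound\<close>

abbreviation visits :: "('s \<times> 'a) set \<Rightarrow> 's \<times> 'a \<times> real \<Rightarrow> real" where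
  "visits K \<equiv> (\<lambda>(s, a, r). indicator K (s, a))"

lemma measurable_visits:
  "visits K \<in> borel_measurable (count_space (UNIV :: 's::finite set) \<Otimes>\<^sub>M (count_space (UNIV :: 'a::finite set) \<Otimes>\<^sub>M borel))"
  by (rule measurable_step_function) simp

lemma sum_pairs:
  "(\<Sum>s\<in>UNIV. \<Sum>a\<in>UNIV. f s a) = (\<Sum>(s, a)\<in>(UNIV :: ('s::finite \<times> 'a::finite) set). f s a)"
  by (simp add: sum.cartesian_product)

text \<open>Each use of a pair in \<open>K\<close> costs at least \<open>d\<close>, so the regret
  bounds the mean count, and Markov's inequality does the rest. \<open>C\<close> and
  \<open>d\<close> depend on the model alone.\<close>

lemma (in mdp_model) suboptimal_visits_tail:
  assumes irr: "irreducible_mdp \<phi>"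
  obtains C d where "0 < d" "\<And>\<pi> x n K b. \<pi> \<in> policies \<Longrightarrow> 0 < b \<Longrightarrow>
    (\<And>s a. (s, a) \<in> K \<Longrightarrow> a \<notin> opt_actions lam \<phi> s) \<Longrightarrow>
    measure (hist_law lam \<phi> \<pi> x n) {\<omega>\<in>space (hist_space n). b \<le> path_sum n (visits K) \<omega>}
      \<le> (regret lam \<phi> \<pi> x n + C) / (d * b)"
proof -
  obtain C where C: "\<And>\<pi> x n. \<pi> \<in> policies \<Longrightarrow>
    (\<Sum>s\<in>UNIV. \<Sum>a\<in>UNIV. occ lam \<phi> \<pi> x n s a * gap lam \<phi> s a) \<le> regret lam \<phi> \<pi> x n + C"
    by (rule regret_lower_bound[OF irr]) blast
  obtain d where d: "0 < d" "\<And>s a. a \<notin> opt_actions lam \<phi> s \<Longrightarrow> d \<le> gap lam \<phi> s a"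
    by (rule gap_lower_bound) blast
  have "measure (hist_law lam \<phi> \<pi> x n) {\<omega>\<in>space (hist_space n). b \<le> path_sum n (visits K) \<omega>}
      \<le> (regret lam \<phi> \<pi> x n + C) / (d * b)"
    if pi: "\<pi> \<in> policies" and b: "0 < b" and K: "\<And>s a. (s, a) \<in> K \<Longrightarrow> a \<notin> opt_actions lam \<phi> s"
    for \<pi> x n K b
  proof -
    interpret prob_space "hist_law lam \<phi> \<pi> x n" by (rule prob_space_hist_law) fact
    have vb: "\<bar>visits K z\<bar> \<le> 1" for z by (auto simp: indicator_def split: prod.split)
    have int: "integrable (hist_law lam \<phi> \<pi> x n) (path_sum n (visits K))"
      by (rule integrable_hist_law[OF pi measurable_path_sum[OF measurable_visits] path_sum_bound[OF vb]])
    have "(\<integral>\<omega>. path_sum n (visits K) \<omega> \<partial>hist_law lam \<phi> \<pi> x n) =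
        (\<Sum>s\<in>UNIV. \<Sum>a\<in>UNIV. occ lam \<phi> \<pi> x n s a * indicator K (s, a))"
      by (subst integral_path_sum[OF pi measurable_visits vb])
         (simp add: prob_space.prob_space[OF prob_space_reward_law, simplified])
    then have "d * (\<integral>\<omega>. path_sum n (visits K) \<omega> \<partial>hist_law lam \<phi> \<pi> x n) =
        (\<Sum>s\<in>UNIV. \<Sum>a\<in>UNIV. occ lam \<phi> \<pi> x n s a * (d * indicator K (s, a)))"
      by (simp only: sum_distrib_left mult.left_commute)
    also have "\<dots> \<le> (\<Sum>s\<in>UNIV. \<Sum>a\<in>UNIV. occ lam \<phi> \<pi> x n s a * gap lam \<phi> s a)"
      using K d(2) by (intro sum_mono mult_left_mono occ_nonneg) (auto simp: indicator_def gap_nonneg)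
    also have "\<dots> \<le> regret lam \<phi> \<pi> x n + C" by (rule C[OF pi])
    finally have E: "(\<integral>\<omega>. path_sum n (visits K) \<omega> \<partial>hist_law lam \<phi> \<pi> x n) \<le> (regret lam \<phi> \<pi> x n + C) / d"
      using d(1) by (simp add: le_divide_eq mult.commute)
    have "prob {\<omega>\<in>space (hist_law lam \<phi> \<pi> x n). b \<le> path_sum n (visits K) \<omega>} \<le>
        (\<integral>\<omega>. path_sum n (visits K) \<omega> \<partial>hist_law lam \<phi> \<pi> x n) / b"
    proof (rule integral_Markov_inequality_measure[OF int, of "{}"])
      show "AE \<omega> in hist_law lam \<phi> \<pi> x n. 0 \<le> path_sum n (visits K) \<omega>"
        unfolding path_sum_def by (intro AE_I2 sum_nonneg) (auto split: prod.split)
    qed (use b in auto)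
    also have "\<dots> \<le> (regret lam \<phi> \<pi> x n + C) / d / b"
      using E b by (intro divide_right_mono) auto
    finally show ?thesis by (simp add: space_hist_law pi)
  qed
  with d(1) show ?thesis by (rule that)
qed

text \<open>Regret enters twice, with different exponents: sublinear regret under
  \<open>\<phi>\<close> makes most visits to \<open>z\<close> use actions optimal for
  \<open>\<phi>\<close>, and regret below order \<open>T powr \<alpha>\<close> under
  \<open>\<psi>\<close> makes the same behaviour unlikely there.\<close>

lemma (in mdp_pair) information_lower_bound:
  assumes irr: "irreducible_mdp \<phi>" and pi: "\<pi> \<in> policies"
    and fin: "\<And>s a. KL lam \<phi> \<psi> s a \<noteq> \<infinity>"
    and disj: "opt_policies lam \<phi> \<inter> opt_policies lam \<psi> = {}"
    and good_\<phi>: "\<And>\<alpha>. 0 < \<alpha> \<Longrightarrow> (\<lambda>T. regret lam \<phi> \<pi> x T) \<in> o(\<lambda>T. real T powr \<alpha>)"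
    and good_\<psi>: "\<And>\<alpha>. 0 < \<alpha> \<Longrightarrow> (\<lambda>T. regret lam \<psi> \<pi> x T) \<in> o(\<lambda>T. real T powr \<alpha>)"
    and \<epsilon>: "0 < \<epsilon>" "\<epsilon> < 1"
  shows "\<forall>\<^sub>F T in sequentially. (1 - \<epsilon>) * ln (real T) \<le>
    (\<Sum>s\<in>UNIV. \<Sum>a\<in>UNIV. occ lam \<phi> \<pi> x T s a * real_of_ereal (KL lam \<phi> \<psi> s a))"
proof -
  \<comment> \<open>Three losses of \<open>\<alpha>\<close> each: in the choice of \<open>L\<close>,
    in the probability of \<open>A\<close> under \<open>\<phi>\<close>, and in absorbing
    \<open>ln 2\<close>.\<close>
  define \<alpha> where "\<alpha> = \<epsilon> / 3"
  have \<alpha>: "0 < \<alpha>" "\<alpha> < 1" using \<epsilon> by (auto simp: \<alpha>_def)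
  have "\<exists>z. opt_actions lam \<phi> z \<inter> opt_actions lam \<psi> z = {}"
  proof (rule ccontr)
    assume "\<not> ?thesis"
    then have "\<forall>z. \<exists>a. a \<in> opt_actions lam \<phi> z \<and> a \<in> opt_actions lam \<psi> z" by blast
    then obtain f where "\<And>z. f z \<in> opt_actions lam \<phi> z" "\<And>z. f z \<in> opt_actions lam \<psi> z" by metis
    then have "f \<in> opt_policies lam \<phi> \<inter> opt_policies lam \<psi>"
      using P.opt_policiesI[OF irr] Q.opt_policiesI[OF irreducible_transfer[OF irr]] by blast
    then show False using disj by blast
  qed
  then obtain z where z: "opt_actions lam \<phi> z \<inter> opt_actions lam \<psi> z = {}" by blast
  obtain c where c: "0 < c" and N': "\<And>\<pi> x. \<pi> \<in> policies \<Longrightarrow> (\<lambda>n. measure (hist_law lam \<phi> \<pi> x n)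
       {\<omega>\<in>space (hist_space n). path_sum n (\<lambda>t. indicator {z} (fst t)) \<omega> < c * real n}) \<longlonglongrightarrow> 0"
    by (rule P.visits_linear[OF irr, of z]) blast
  note N = N'[OF pi, of x]
  obtain C1 d1 where d1: "0 < d1" and tail1: "\<And>\<pi> x n K b. \<pi> \<in> policies \<Longrightarrow> 0 < b \<Longrightarrow>
    (\<And>s a. (s, a) \<in> K \<Longrightarrow> a \<notin> opt_actions lam \<phi> s) \<Longrightarrow>
    measure (hist_law lam \<phi> \<pi> x n) {\<omega>\<in>space (hist_space n). b \<le> path_sum n (visits K) \<omega>}
      \<le> (regret lam \<phi> \<pi> x n + C1) / (d1 * b)"
    by (rule P.suboptimal_visits_tail[OF irr]) blast
  obtain C2 d2 where d2: "0 < d2" and tail2: "\<And>\<pi> x n K b. \<pi> \<in> policies \<Longrightarrow> 0 < b \<Longrightarrow>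
    (\<And>s a. (s, a) \<in> K \<Longrightarrow> a \<notin> opt_actions lam \<psi> s) \<Longrightarrow>
    measure (hist_law lam \<psi> \<pi> x n) {\<omega>\<in>space (hist_space n). b \<le> path_sum n (visits K) \<omega>}
      \<le> (regret lam \<psi> \<pi> x n + C2) / (d2 * b)"
    by (rule Q.suboptimal_visits_tail[OF irreducible_transfer[OF irr]]) blast
  \<comment> \<open>Visits to \<open>z\<close> split into \<open>O1\<close> and \<open>O2\<close>.
    Pairs in \<open>O2\<close> are suboptimal for \<open>\<phi>\<close>, and by the choice of
    \<open>z\<close> pairs in \<open>O1\<close> are suboptimal for \<open>\<psi>\<close>. Of
    \<open>c * n\<close> visits, one of the two sets takes at least half.\<close>
  define O1 where "O1 = {z} \<times> opt_actions lam \<phi> z"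
  define O2 where "O2 = {z} \<times> (- opt_actions lam \<phi> z)"
  define A where "A n = {\<omega>\<in>space (hist_space n). c / 2 * real n \<le> path_sum n (visits O1) \<omega>}" for n
  let ?N = "\<lambda>n. measure (hist_law lam \<phi> \<pi> x n)
       {\<omega>\<in>space (hist_space n). path_sum n (\<lambda>t. indicator {z} (fst t)) \<omega> < c * real n}"
  let ?Y = "\<lambda>n. (regret lam \<phi> \<pi> x n + C1) / (d1 * (c / 2 * real n))"
  have mA: "A n \<in> sets (hist_space n)" for n
    unfolding A_def using measurable_path_sum[OF measurable_visits, of n O1] by measurable
  have split: "path_sum n (\<lambda>t. indicator {z} (fst t)) \<omega> = path_sum n (visits O1) \<omega> + path_sum n (visits O2) \<omega>" for n \<omega>
    unfolding path_sum_def sum.distrib[symmetric]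
    by (intro sum.cong) (auto simp: O1_def O2_def indicator_def split: prod.split)
  have PA: "1 - ?N n - ?Y n \<le> measure (hist_law lam \<phi> \<pi> x n) (A n)" if n: "0 < n" for n
  proof -
    interpret prob_space "hist_law lam \<phi> \<pi> x n" by (rule P.prob_space_hist_law) fact
    let ?B1 = "{\<omega>\<in>space (hist_space n :: ('s, 'a) hist measure). path_sum n (\<lambda>t. indicator {z} (fst t)) \<omega> < c * real n}"
    let ?B2 = "{\<omega>\<in>space (hist_space n). c / 2 * real n \<le> path_sum n (visits O2) \<omega>}"
    have m1: "path_sum n (\<lambda>t. indicator {z} (fst t) :: real) \<in> borel_measurable (hist_space n :: ('s, 'a) hist measure)"
    proof -
      have "path_sum n (\<lambda>t. indicator {z} (fst t) :: real) = (\<lambda>\<omega>. path_sum n (visits O1) \<omega> + path_sum n (visits O2) \<omega>)"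
        by (rule ext) (rule split)
      then show ?thesis
        by (simp only:) (intro borel_measurable_add measurable_path_sum measurable_visits)
    qed
    have B1: "?B1 \<in> sets (hist_space n)" using m1 by measurable
    have B2: "?B2 \<in> sets (hist_space n)"
      using measurable_path_sum[OF measurable_visits, of n O2] by measurable
    have ev: "A n \<in> events" "?B1 \<in> events" "?B2 \<in> events"
      using mA B1 B2 by (simp_all add: P.sets_hist_law pi)
    have sub: "space (hist_law lam \<phi> \<pi> x n) \<subseteq> A n \<union> (?B1 \<union> ?B2)"
    proof
      fix \<omega> assume "\<omega> \<in> space (hist_law lam \<phi> \<pi> x n)"
      then have "\<omega> \<in> space (hist_space n)" by (simp add: P.space_hist_law pi)
      moreover have "c / 2 * real n \<le> path_sum n (visits O1) \<omega> \<or> c / 2 * real n \<le> path_sum n (visits O2) \<omega> \<or>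
          path_sum n (\<lambda>t. indicator {z} (fst t)) \<omega> < c * real n"
        using split[of n \<omega>] by (simp add: field_simps) linarith
      ultimately show "\<omega> \<in> A n \<union> (?B1 \<union> ?B2)" unfolding A_def by blast
    qed
    have "1 \<le> prob (A n \<union> (?B1 \<union> ?B2))"
      unfolding prob_space[symmetric] by (intro finite_measure_mono sub sets.Un ev)
    moreover have "prob (A n \<union> (?B1 \<union> ?B2)) \<le> prob (A n) + prob (?B1 \<union> ?B2)"
      by (intro measure_Un_le sets.Un ev)
    moreover have "prob (?B1 \<union> ?B2) \<le> prob ?B1 + prob ?B2"
      by (intro measure_Un_le ev)
    moreover have "prob ?B2 \<le> ?Y n"
      using c n by (intro tail1 pi) (auto simp: O2_def)
    ultimately show ?thesis by linarith
  qed
  have lim: "(\<lambda>n. (f n + K) / real n powr \<beta>) \<longlonglongrightarrow> 0"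
    if f: "f \<in> o(\<lambda>T. real T powr \<beta>)" and \<beta>: "0 < \<beta>" for f :: "nat \<Rightarrow> real" and K \<beta>
  proof -
    have 1: "(\<lambda>n. f n / real n powr \<beta>) \<longlonglongrightarrow> 0" using f by (rule smalloD_tendsto)
    have 2: "(\<lambda>n. K * real n powr (- \<beta>)) \<longlonglongrightarrow> K * 0"
      using \<beta> by (intro tendsto_mult tendsto_const tendsto_neg_powr filterlim_real_sequentially) auto
    show ?thesis using tendsto_add[OF 1 2] by (simp add: add_divide_distrib powr_minus_divide)
  qed
  have Y0: "?Y \<longlonglongrightarrow> 0"
  proof -
    have "(\<lambda>n. (regret lam \<phi> \<pi> x n + C1) / real n powr 1 / (d1 * (c / 2))) \<longlonglongrightarrow> 0 / (d1 * (c / 2))"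
      using c d1 by (intro tendsto_divide lim good_\<phi> tendsto_const) auto
    then show ?thesis by (simp add: field_simps)
  qed
  have "(\<lambda>n. 1 - ?N n - ?Y n) \<longlonglongrightarrow> 1 - 0 - 0"
    by (intro tendsto_diff tendsto_const N Y0)
  then have evP: "\<forall>\<^sub>F n in sequentially. 1 - \<alpha> < 1 - ?N n - ?Y n"
    using \<alpha> by (intro order_tendstoD) auto
  have "(\<lambda>n. (regret lam \<psi> \<pi> x n + C2) / real n powr \<alpha>) \<longlonglongrightarrow> 0"
    using \<alpha> by (intro lim good_\<psi>)
  then have evQ: "\<forall>\<^sub>F n in sequentially. (regret lam \<psi> \<pi> x n + C2) / real n powr \<alpha> < d2 * (c / 2)"
    using c d2 by (intro order_tendstoD) auto
  have "filterlim (\<lambda>n. ln (real n)) at_top sequentially"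
    by (rule filterlim_compose[OF ln_at_top filterlim_real_sequentially])
  then have evL: "\<forall>\<^sub>F n in sequentially. ln 2 / \<alpha> \<le> ln (real n)"
    by (auto simp: filterlim_at_top)
  show ?thesis
    using evP evQ evL eventually_gt_at_top[of 0]
  proof eventually_elim
    case (elim n)
    note n = elim(4)
    let ?S = "\<Sum>s\<in>UNIV. \<Sum>a\<in>UNIV. occ lam \<phi> \<pi> x n s a * real_of_ereal (KL lam \<phi> \<psi> s a)"
    \<comment> \<open>The largest \<open>L\<close> for which \<open>exp L\<close> times the bound
      \<open>n powr \<alpha> / n\<close> on the probability under \<open>\<psi>\<close> is at most
      1, so that the logarithm in \<open>change_of_measure\<close> is at most
      \<open>ln 2\<close>.\<close>
    define L where "L = (1 - \<alpha>) * ln (real n)"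
    have L: "0 \<le> L" using \<alpha> n by (simp add: L_def)
    have "measure (hist_law lam \<psi> \<pi> x n) (A n) \<le> (regret lam \<psi> \<pi> x n + C2) / (d2 * (c / 2 * real n))"
      unfolding A_def using c n z by (intro tail2 pi) (auto simp: O1_def)
    also have "\<dots> = (regret lam \<psi> \<pi> x n + C2) / real n powr \<alpha> / (d2 * (c / 2)) * (real n powr \<alpha> / real n)"
      using n c d2 by (simp add: field_simps)
    also have "\<dots> \<le> 1 * (real n powr \<alpha> / real n)"
    proof (rule mult_right_mono)
      have "0 < d2 * (c / 2)" using c d2 by simp
      then show "(regret lam \<psi> \<pi> x n + C2) / real n powr \<alpha> / (d2 * (c / 2)) \<le> 1"
        using elim(2) by (simp only: divide_le_eq_1_pos less_imp_le)
    qed simp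
    finally have QA: "measure (hist_law lam \<psi> \<pi> x n) (A n) \<le> real n powr \<alpha> / real n" by simp
    have "exp L = real n powr (1 - \<alpha>)" using n by (simp add: L_def powr_def)
    then have "exp L * (real n powr \<alpha> / real n) = 1"
      using n by (simp add: powr_diff)
    then have "exp L * measure (hist_law lam \<psi> \<pi> x n) (A n) \<le> 1"
      using mult_left_mono[OF QA, of "exp L"] by simp
    then have "ln (1 + exp L * measure (hist_law lam \<psi> \<pi> x n) (A n)) \<le> ln 2"
      by (subst ln_le_cancel_iff) (auto intro!: add_pos_nonneg)
    then have 1: "L * measure (hist_law lam \<phi> \<pi> x n) (A n) \<le> ?S + ln 2"
      using change_of_measure[OF pi fin mA L, of x] by (meson add_left_mono order_trans)
    have "(1 - \<alpha>) * L \<le> measure (hist_law lam \<phi> \<pi> x n) (A n) * L"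
      using PA[OF n] elim(1) L by (intro mult_right_mono) auto
    then have "(1 - \<alpha>) * L \<le> ?S + ln 2" using 1 by (simp add: mult.commute)
    moreover have "ln 2 \<le> \<alpha> * ln (real n)" using elim(3) \<alpha> by (simp add: divide_le_eq mult.commute)
    moreover have "(1 - \<epsilon>) * ln (real n) \<le> (1 - \<alpha>) * L - \<alpha> * ln (real n)"
    proof -
      have "0 \<le> \<alpha> * \<alpha> * ln (real n)" using n \<alpha> by simp
      moreover have "\<epsilon> = 3 * \<alpha>" by (simp add: \<alpha>_def)
      ultimately show ?thesis by (simp add: L_def algebra_simps)
    qed
    ultimately show ?case by linarith
  qed
qed

text \<open>Suboptimal gaps are at least \<open>d\<close>, so the regret bound confines the
  normalized counts to a bounded set, and a subsequence converges. Counts of optimal pairs escape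
  this bound, as they cost nothing; they are replaced by 0.\<close>

lemma (in mdp_model) subsequential_allocation:
  assumes irr: "irreducible_mdp \<phi>" and pi: "\<pi> \<in> policies"
    and freq: "\<exists>\<^sub>F T in sequentially. regret lam \<phi> \<pi> x T / ln (real T) < c"
  obtains l r where "strict_mono r"
    "\<And>s a. 0 \<le> l s a" "\<And>s a. a \<in> opt_actions lam \<phi> s \<Longrightarrow> l s a = (0::real)"
    "\<And>s a. a \<notin> opt_actions lam \<phi> s \<Longrightarrow> (\<lambda>n. occ lam \<phi> \<pi> x (r n) s a / ln (real (r n))) \<longlonglongrightarrow> l s a"
    "(\<Sum>s\<in>UNIV. \<Sum>a\<in>UNIV. l s a * gap lam \<phi> s a) \<le> c"
proof -
  obtain C where C': "\<And>\<pi> x n. \<pi> \<in> policies \<Longrightarrow>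
    (\<Sum>s\<in>UNIV. \<Sum>a\<in>UNIV. occ lam \<phi> \<pi> x n s a * gap lam \<phi> s a) \<le> regret lam \<phi> \<pi> x n + C"
    by (rule regret_lower_bound[OF irr]) blast
  note C = C'[OF pi, of x]
  obtain d where d: "0 < d" "\<And>s a. a \<notin> opt_actions lam \<phi> s \<Longrightarrow> d \<le> gap lam \<phi> s a"
    by (rule gap_lower_bound) blast
  have ln_top: "filterlim (\<lambda>n. ln (real n)) at_top sequentially"
    by (rule filterlim_compose[OF ln_at_top filterlim_real_sequentially])
  \<comment> \<open>Denominators are kept at least 1, so that division preserves inequalities and
    \<open>C / ln (real T)\<close> stays bounded.\<close>
  then have "\<forall>\<^sub>F n in sequentially. 1 \<le> ln (real n)" by (auto simp: filterlim_at_top)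
  with freq have "\<exists>\<^sub>F T in sequentially. regret lam \<phi> \<pi> x T / ln (real T) < c \<and> 1 \<le> ln (real T)"
    by (rule frequently_eventually_frequently)
  then have "infinite {T. regret lam \<phi> \<pi> x T / ln (real T) < c \<and> 1 \<le> ln (real T)}"
    by (simp add: frequently_cofinite[symmetric] cofinite_eq_sequentially)
  then obtain r0 :: "nat \<Rightarrow> nat" where r0: "strict_mono r0"
    "\<And>n. regret lam \<phi> \<pi> x (r0 n) / ln (real (r0 n)) < c" "\<And>n. 1 \<le> ln (real (r0 n))"
    using infinite_enumerate by blast
  define v :: "nat \<Rightarrow> 's \<Rightarrow> 'a \<Rightarrow> real" where
    "v T s a = (if a \<in> opt_actions lam \<phi> s then 0 else occ lam \<phi> \<pi> x T s a / ln (real T))" for T s a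
  define w :: "nat \<Rightarrow> real ^ ('s \<times> 'a)" where "w n = (\<chi> p. v (r0 n) (fst p) (snd p))" for n
  have v0: "0 \<le> v (r0 n) s a" for n s a
    using occ_nonneg[of \<pi> x "r0 n" s a] r0(3)[of n] by (auto simp: v_def)
  have vgap: "(\<Sum>s\<in>UNIV. \<Sum>a\<in>UNIV. v (r0 n) s a * gap lam \<phi> s a) \<le> c + C / ln (real (r0 n))" for n
  proof -
    have pos: "0 < ln (real (r0 n))" using r0(3)[of n] by linarith
    have "(\<Sum>s\<in>UNIV. \<Sum>a\<in>UNIV. v (r0 n) s a * gap lam \<phi> s a) =
        (\<Sum>s\<in>UNIV. \<Sum>a\<in>UNIV. occ lam \<phi> \<pi> x (r0 n) s a * gap lam \<phi> s a) / ln (real (r0 n))"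
      unfolding sum_divide_distrib
      by (intro sum.cong refl) (auto simp: v_def gap_eq_0_iff[THEN iffD2])
    also have "\<dots> \<le> (regret lam \<phi> \<pi> x (r0 n) + C) / ln (real (r0 n))"
      using C[of "r0 n"] pos by (intro divide_right_mono) auto
    also have "\<dots> \<le> c + C / ln (real (r0 n))"
      using r0(2)[of n] by (simp add: add_divide_distrib)
    finally show ?thesis .
  qed
  have vbound: "\<bar>v (r0 n) s a\<bar> \<le> (c + \<bar>C\<bar>) / d" for n s a
  proof -
    have "d * v (r0 n) s a \<le> v (r0 n) s a * gap lam \<phi> s a"
    proof (cases "a \<in> opt_actions lam \<phi> s")
      case True
      then show ?thesis by (simp add: v_def)
    next
      case False
      then show ?thesis using mult_left_mono[OF d(2)[OF False] v0[of n s a]] by (simp only: mult.commute)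
    qed
    also have "\<dots> \<le> (\<Sum>a\<in>UNIV. v (r0 n) s a * gap lam \<phi> s a)"
      by (rule member_le_sum) (auto simp: v0 gap_nonneg)
    also have "\<dots> \<le> (\<Sum>s\<in>UNIV. \<Sum>a\<in>UNIV. v (r0 n) s a * gap lam \<phi> s a)"
      by (rule member_le_sum[where f="\<lambda>s. \<Sum>a\<in>UNIV. v (r0 n) s a * gap lam \<phi> s a"])
         (auto simp: v0 gap_nonneg intro!: sum_nonneg)
    also have "\<dots> \<le> c + C / ln (real (r0 n))" by (rule vgap)
    also have "C / ln (real (r0 n)) \<le> \<bar>C\<bar> / ln (real (r0 n))"
      using r0(3)[of n] by (intro divide_right_mono) auto
    also have "\<bar>C\<bar> / ln (real (r0 n)) \<le> \<bar>C\<bar> / 1"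
      using r0(3)[of n] by (intro divide_left_mono) auto
    finally show ?thesis using d(1) v0[of n s a] by (simp add: le_divide_eq mult.commute)
  qed
  have "bounded (range w)"
  proof (rule boundedI)
    fix y assume "y \<in> range w"
    then obtain n where y: "y = w n" by blast
    have "norm y \<le> (\<Sum>p\<in>UNIV. \<bar>w n $ p\<bar>)" unfolding y by (rule norm_le_l1_cart)
    also have "\<dots> \<le> (\<Sum>p\<in>(UNIV::('s \<times> 'a) set). (c + \<bar>C\<bar>) / d)"
      by (intro sum_mono) (simp add: w_def vbound)
    finally show "norm y \<le> (\<Sum>p\<in>(UNIV::('s \<times> 'a) set). (c + \<bar>C\<bar>) / d)" .
  qed
  then obtain m r1 where r1: "strict_mono r1" and m: "(w \<circ> r1) \<longlonglongrightarrow> m"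
    using bounded_imp_convergent_subsequence by blast
  define r where "r = r0 \<circ> r1"
  have r: "strict_mono r" unfolding r_def by (rule strict_mono_o[OF r0(1) r1])
  have vlim: "(\<lambda>n. v (r n) s a) \<longlonglongrightarrow> m $ (s, a)" for s a
    using tendsto_vec_nth[OF m, of "(s, a)"] by (simp add: w_def r_def o_def)
  have pos: "0 \<le> m $ (s, a)" for s a
    by (rule LIMSEQ_le_const[OF vlim]) (auto simp: r_def v0)
  have opt: "m $ (s, a) = 0" if "a \<in> opt_actions lam \<phi> s" for s a
  proof -
    have "(\<lambda>n. v (r n) s a) \<longlonglongrightarrow> 0" using that by (simp add: v_def)
    then show ?thesis using vlim LIMSEQ_unique by blast
  qed
  have sub: "(\<lambda>n. occ lam \<phi> \<pi> x (r n) s a / ln (real (r n))) \<longlonglongrightarrow> m $ (s, a)"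
    if "a \<notin> opt_actions lam \<phi> s" for s a
    using vlim[of s a] that by (simp add: v_def)
  have "(\<Sum>s\<in>UNIV. \<Sum>a\<in>UNIV. m $ (s, a) * gap lam \<phi> s a) \<le> c"
  proof (rule LIMSEQ_le)
    show "(\<lambda>n. \<Sum>s\<in>UNIV. \<Sum>a\<in>UNIV. v (r n) s a * gap lam \<phi> s a) \<longlonglongrightarrow> (\<Sum>s\<in>UNIV. \<Sum>a\<in>UNIV. m $ (s, a) * gap lam \<phi> s a)"
      by (intro tendsto_sum tendsto_mult tendsto_const vlim)
    have "filterlim (\<lambda>n. ln (real (r n))) at_top sequentially"
      using filterlim_compose[OF ln_top filterlim_subseq[OF r]] .
    then have "(\<lambda>n. C / ln (real (r n))) \<longlonglongrightarrow> 0"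
      by (intro tendsto_divide_0[OF tendsto_const] filterlim_at_top_imp_at_infinity)
    then show "(\<lambda>n. c + C / ln (real (r n))) \<longlonglongrightarrow> c"
      using tendsto_add[OF tendsto_const, of _ 0 sequentially c] by simp
    show "\<exists>N. \<forall>n\<ge>N. (\<Sum>s\<in>UNIV. \<Sum>a\<in>UNIV. v (r n) s a * gap lam \<phi> s a) \<le> c + C / ln (real (r n))"
      using vgap by (auto simp: r_def)
  qed
  with r pos opt sub show ?thesis by (rule that[where l="\<lambda>s a. m $ (s, a)"])
qed

theorem theorem1:
  fixes lam :: "real measure"
    and \<Phi> :: "('s::finite, 'a::finite) mdp set"
    and \<phi> :: "('s, 'a) mdp"
    and \<pi> :: "('s, 'a) policy"
    and x :: 's
  assumes "sets lam = sets borel"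
    and "emeasure lam (- {0..1}) = 0"
    and "\<Phi> \<subseteq> mdps lam"
    and "\<phi> \<in> \<Phi>"
    and "ergodic lam \<phi>"
    and "uniformly_good lam \<Phi> \<pi>"
  shows "liminf (\<lambda>T. ereal (regret lam \<phi> \<pi> x T / ln (real T))) \<ge> K_bound lam \<Phi> \<phi>"
proof (rule ccontr)
  interpret P: mdp_model lam \<phi> using assms by unfold_locales auto
  have irr: "irreducible_mdp \<phi>" using assms(5) P.ergodic_iff_irreducible by simp
  have pi: "\<pi> \<in> policies" using assms(6) by (simp add: uniformly_good_def)
  have good: "(\<lambda>T. regret lam \<psi> \<pi> x T) \<in> o(\<lambda>T. real T powr \<alpha>)"
    if "\<psi> \<in> \<Phi>" "ergodic lam \<psi>" "0 < \<alpha>" for \<psi> \<alpha>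
    using assms(6) that unfolding uniformly_good_def by blast
  assume "\<not> ?thesis"
  then have "liminf (\<lambda>T. ereal (regret lam \<phi> \<pi> x T / ln (real T))) < K_bound lam \<Phi> \<phi>" by simp
  then obtain c where c: "liminf (\<lambda>T. ereal (regret lam \<phi> \<pi> x T / ln (real T))) < ereal c" "ereal c < K_bound lam \<Phi> \<phi>"
    using ereal_dense2 by blast
  \<comment> \<open>\<open>c\<close> is spent on the limit allocation; the room between
    \<open>c\<close> and \<open>k\<close> pays for the slack \<open>\<delta>\<close> added to
    it.\<close>
  obtain k where k: "ereal c < ereal k" "ereal k < K_bound lam \<Phi> \<phi>" using ereal_dense2[OF c(2)] by blast
  have freq: "\<exists>\<^sub>F T in sequentially. regret lam \<phi> \<pi> x T / ln (real T) < c"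
  proof (rule ccontr)
    assume "\<not> ?thesis"
    then have "\<forall>\<^sub>F T in sequentially. ereal c \<le> ereal (regret lam \<phi> \<pi> x T / ln (real T))"
      by (simp add: not_frequently not_less)
    then have "ereal c \<le> liminf (\<lambda>T. ereal (regret lam \<phi> \<pi> x T / ln (real T)))"
      by (rule Liminf_bounded)
    then show False using c(1) by simp
  qed
  obtain l r where r: "strict_mono r"
    and l0: "\<And>s a. 0 \<le> l s a" and l_opt: "\<And>s a. a \<in> opt_actions lam \<phi> s \<Longrightarrow> l s a = (0::real)"
    and l_lim: "\<And>s a. a \<notin> opt_actions lam \<phi> s \<Longrightarrow> (\<lambda>n. occ lam \<phi> \<pi> x (r n) s a / ln (real (r n))) \<longlonglongrightarrow> l s a"
    and l_gap: "(\<Sum>s\<in>UNIV. \<Sum>a\<in>UNIV. l s a * gap lam \<phi> s a) \<le> c"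
    by (rule P.subsequential_allocation[OF irr pi freq]) (rule that)
  define G where "G = (\<Sum>s\<in>UNIV. \<Sum>a\<in>UNIV. gap lam \<phi> s a)"
  have G: "0 \<le> G" unfolding G_def by (intro sum_nonneg P.gap_nonneg)
  \<comment> \<open>The denominator is \<open>G + 1\<close> because all gaps may be 0.\<close>
  define \<delta> where "\<delta> = (k - c) / (G + 1)"
  have \<delta>: "0 < \<delta>" using k(1) G by (simp add: \<delta>_def)
  \<comment> \<open>The slack \<open>\<delta>\<close> is needed for infinite divergences: since \<open>\<infinity> * 0 = 0\<close>, the limit allocation itself
    could violate the constraint of a \<open>\<psi>\<close> with \<open>KL = \<infinity>\<close> at a pair where \<open>l\<close> vanishes.\<close>
  define \<eta> where "\<eta> s a = (if a \<in> opt_actions lam \<phi> s then 0 else l s a + \<delta>)" for s a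
  have \<eta>0: "0 \<le> \<eta> s a" for s a using l0 \<delta> by (simp add: \<eta>_def add_nonneg_nonneg)
  have \<eta>_ge: "l s a \<le> \<eta> s a" for s a using l_opt \<delta> by (auto simp: \<eta>_def)
  have "(\<lambda>s a. ereal (\<eta> s a)) \<in> feasible lam \<Phi> \<phi>"
    unfolding feasible_def
  proof (intro CollectI conjI allI ballI)
    show "0 \<le> ereal (\<eta> s a)" for s a using \<eta>0 by simp
    fix \<psi> assume \<psi>: "\<psi> \<in> confusing lam \<Phi> \<phi>"
    then have "\<psi> \<in> \<Phi>" and ac: "mdp_ac lam \<phi> \<psi>"
      and KL0: "\<And>s a. a \<in> opt_actions lam \<phi> s \<Longrightarrow> KL lam \<phi> \<psi> s a = 0"
      and disj: "opt_policies lam \<phi> \<inter> opt_policies lam \<psi> = {}"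
      by (auto simp: confusing_def)
    interpret PQ: mdp_pair lam \<phi> \<psi>
      using assms \<open>\<psi> \<in> \<Phi>\<close> ac by unfold_locales auto
    have erg: "ergodic lam \<psi>"
      using PQ.irreducible_transfer[OF irr] PQ.Q.ergodic_iff_irreducible by simp
    have nonneg: "0 \<le> ereal (\<eta> s a) * KL lam \<phi> \<psi> s a" for s a
      using \<eta>0 PQ.KL_nonneg by simp
    show "1 \<le> (\<Sum>(s, a)\<in>UNIV. ereal (\<eta> s a) * KL lam \<phi> \<psi> s a)"
    \<comment> \<open>A single infinite term settles the first case: it sits at a suboptimal pair,
      where \<open>\<eta>\<close> is at least \<open>\<delta>\<close>. Models with finite
      divergences go through \<open>information_lower_bound\<close>.\<close>
    proof (cases "\<exists>s a. KL lam \<phi> \<psi> s a = \<infinity>")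
      case True
      then obtain s a where sa: "KL lam \<phi> \<psi> s a = \<infinity>" by blast
      then have "a \<notin> opt_actions lam \<phi> s" using KL0 by fastforce
      then have "0 < \<eta> s a" using l0[of s a] \<delta> by (simp add: \<eta>_def)
      then have "ereal (\<eta> s a) * KL lam \<phi> \<psi> s a = \<infinity>" using sa by simp
      then have "(\<Sum>(s, a)\<in>UNIV. ereal (\<eta> s a) * KL lam \<phi> \<psi> s a) = \<infinity>"
        by (subst sum_Pinfty) (auto intro!: bexI[of _ "(s, a)"])
      then show ?thesis by simp
    next
      case False
      then have fin: "KL lam \<phi> \<psi> s a \<noteq> \<infinity>" for s a by blast
      define kl where "kl s a = real_of_ereal (KL lam \<phi> \<psi> s a)" for s a
      have KL: "KL lam \<phi> \<psi> s a = ereal (kl s a)" for s a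
        using fin[of s a] PQ.KL_nonneg[of s a] by (cases "KL lam \<phi> \<psi> s a") (auto simp: kl_def)
      have kl0: "0 \<le> kl s a" for s a using PQ.KL_nonneg[of s a] by (simp add: KL)
      have kl_opt: "kl s a = 0" if "a \<in> opt_actions lam \<phi> s" for s a using KL0[OF that] by (simp add: kl_def)
      \<comment> \<open>On optimal pairs the normalized counts may diverge, but there
        \<open>kl\<close> is 0, and the product tends to 0 nevertheless.\<close>
      have lim: "(\<lambda>n. (\<Sum>s\<in>UNIV. \<Sum>a\<in>UNIV. occ lam \<phi> \<pi> x (r n) s a * kl s a) / ln (real (r n)))
          \<longlonglongrightarrow> (\<Sum>s\<in>UNIV. \<Sum>a\<in>UNIV. l s a * kl s a)"
        unfolding sum_divide_distrib
      proof (intro tendsto_sum)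
        show "(\<lambda>n. occ lam \<phi> \<pi> x (r n) s a * kl s a / ln (real (r n))) \<longlonglongrightarrow> l s a * kl s a" for s a
        proof (cases "a \<in> opt_actions lam \<phi> s")
          case False
          then show ?thesis using tendsto_mult_right[OF l_lim, of a s "kl s a"] by (simp add: mult.commute)
        qed (simp add: kl_opt)
      qed
      have "1 - \<epsilon> \<le> (\<Sum>s\<in>UNIV. \<Sum>a\<in>UNIV. l s a * kl s a)" if \<epsilon>: "0 < \<epsilon>" "\<epsilon> < 1" for \<epsilon>
      proof (rule tendsto_lowerbound[OF lim])
        have "\<forall>\<^sub>F T in sequentially. (1 - \<epsilon>) * ln (real T) \<le> (\<Sum>s\<in>UNIV. \<Sum>a\<in>UNIV. occ lam \<phi> \<pi> x T s a * kl s a)"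
          unfolding kl_def
          by (rule PQ.information_lower_bound[OF irr pi fin disj good[OF assms(4,5)] good[OF \<open>\<psi> \<in> \<Phi>\<close> erg] \<epsilon>])
        then have "\<forall>\<^sub>F T in sequentially. 1 - \<epsilon> \<le> (\<Sum>s\<in>UNIV. \<Sum>a\<in>UNIV. occ lam \<phi> \<pi> x T s a * kl s a) / ln (real T)"
          using eventually_gt_at_top[of 1] by eventually_elim (simp add: le_divide_eq)
        then show "\<forall>\<^sub>F n in sequentially. 1 - \<epsilon> \<le> (\<Sum>s\<in>UNIV. \<Sum>a\<in>UNIV. occ lam \<phi> \<pi> x (r n) s a * kl s a) / ln (real (r n))"
          by (rule eventually_compose_filterlim[OF _ filterlim_subseq[OF r]])
      qed simp
      \<comment> \<open>This lets \<open>\<epsilon>\<close> tend to 0. The instance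
        \<open>1 / 2\<close> gives \<open>K \<ge> 1 / 2\<close>, which makes
        \<open>(1 - K) / 2\<close> an admissible second instance if \<open>K < 1\<close>.\<close>
      moreover have "1 \<le> K" if "\<And>\<epsilon>. 0 < \<epsilon> \<Longrightarrow> \<epsilon> < 1 \<Longrightarrow> 1 - \<epsilon> \<le> K" for K :: real
        using that[of "1 / 2"] that[of "(1 - K) / 2"] by (cases "1 \<le> K") (auto simp: field_simps)
      ultimately have "1 \<le> (\<Sum>s\<in>UNIV. \<Sum>a\<in>UNIV. l s a * kl s a)" by blast
      also have "\<dots> \<le> (\<Sum>s\<in>UNIV. \<Sum>a\<in>UNIV. \<eta> s a * kl s a)"
        by (intro sum_mono mult_right_mono \<eta>_ge kl0)
      finally have "1 \<le> (\<Sum>(s, a)\<in>UNIV. \<eta> s a * kl s a)" by (simp only: sum_pairs)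
      then have "ereal 1 \<le> ereal (\<Sum>(s, a)\<in>UNIV. \<eta> s a * kl s a)" by (simp only: ereal_less_eq)
      also have "\<dots> = (\<Sum>(s, a)\<in>UNIV. ereal (\<eta> s a) * KL lam \<phi> \<psi> s a)"
        by (simp add: KL sum_ereal[symmetric] case_prod_beta' del: sum_ereal)
      finally show ?thesis by (simp add: one_ereal_def)
    qed
  qed
  then have "K_bound lam \<Phi> \<phi> \<le> (\<Sum>(s, a)\<in>UNIV. ereal (\<eta> s a) * ereal (gap lam \<phi> s a))"
    unfolding K_bound_def by (rule INF_lower)
  also have "\<dots> = ereal (\<Sum>(s, a)\<in>UNIV. \<eta> s a * gap lam \<phi> s a)"
    by (simp add: sum_ereal[symmetric] case_prod_beta' del: sum_ereal)
  also have "(\<Sum>(s, a)\<in>UNIV. \<eta> s a * gap lam \<phi> s a) = (\<Sum>s\<in>UNIV. \<Sum>a\<in>UNIV. \<eta> s a * gap lam \<phi> s a)"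
    by (simp only: sum_pairs)
  also have "\<dots> \<le> (\<Sum>s\<in>UNIV. \<Sum>a\<in>UNIV. l s a * gap lam \<phi> s a + \<delta> * gap lam \<phi> s a)"
  proof (intro sum_mono)
    fix s a
    have "\<eta> s a \<le> l s a + \<delta>" using l0[of s a] \<delta> by (simp add: \<eta>_def)
    then show "\<eta> s a * gap lam \<phi> s a \<le> l s a * gap lam \<phi> s a + \<delta> * gap lam \<phi> s a"
      using mult_right_mono[OF _ P.gap_nonneg[of s a]] by (metis distrib_right)
  qed
  also have "\<dots> = (\<Sum>s\<in>UNIV. \<Sum>a\<in>UNIV. l s a * gap lam \<phi> s a) + \<delta> * G"
    by (simp add: G_def sum.distrib sum_distrib_left)
  also have "\<dots> \<le> c + \<delta> * (G + 1)" using l_gap \<delta> by (simp add: distrib_left)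
  also have "\<dots> = k" using G by (simp add: \<delta>_def)
  finally show False using k(2) by simp
qed

end
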